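(* Let $X_1,X_2,\ldots$ be i.i.d. non-lattice random variables with $\mathbb E X_k=0$, $\operatorname{Var}X_k=1$, such that for some $\sigma_0>0$, $\varphi(t):=\log\mathbb Ee^{tX_1}<\infty$ for all $t\geq-\sigma_0$. Suppose there is $t_*>0$ with $m_*:=\frac{\varphi(t_* )}{t_*^2/2}>1$ and that for every $\varepsilon>0$, $\sup_{0<t<t_*-\varepsilon}\frac{\varphi(t)}{t^2/2}<m_*$ and $\sup_{t>t_*+\varepsilon}\frac{\varphi(t)}{t^2/2}<m_*$. Let $d_*=1/\varphi(t_* )$. Fix real numbers $A_1<A_2$ and set $l_n^-=d_*\log n+A_1\sqrt{\log n}$, $l_n^+=d_*\log n+A_2\sqrt{\log n}$. Then for every $\tau\in\mathbb R$, $$\lim_{n\to\infty}\mathbb P\left[\tfrac12\mathbf M_n^2(l_n^-,l_n^+)\leq m_*(\log n+\tau)\right]=\exp\left\{-e^{-\tau}\int_{A_1}^{A_2}\Theta(a)\,da\right\},$$ where $\Theta(a)=\frac{\sqrt{m_*}H_*^2}{2\sqrt\pi\,\sigma_*}e^{-\beta_*^2a^2/2}$, with $\sigma_*^2=\varphi''(t_* )$, $\beta_*^2=\frac{(\varphi'(t_* ))^4}{8m_*}\left(\frac1{\sigma_*^2}-\frac1{m_*}\right)$ and $H_*=\lim_{B\to\infty}\frac1B\mathbb E\left[\max_{k=0,\ldots,B}e^{t_*S_k-k\varphi(t_* )}\right]$.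
   Context: $S_0=0$, $S_k=X_1+\cdots+X_k$. For $0\leq h_1<h_2$, $\mathbf M_n(h_1,h_2)=\max\{\frac{S_j-S_i}{\sqrt{j-i}}:0\leq i<j\leq n,\ h_1\leq j-i\leq h_2\}$. Non-lattice means not a.s. contained in $a\mathbb Z+b$ for any $a>0,b\in\mathbb R$. *)

theory Defs
  imports "HOL-Probability.Probability"
begin

text \<open>Partial sums S_k = X_1 + ... + X_k; the paper's X_1, X_2, ... are X 0, X 1, ...\<close>
definition psum :: "(nat \<Rightarrow> 'a \<Rightarrow> real) \<Rightarrow> nat \<Rightarrow> 'a \<Rightarrow> real" where
  "psum X k \<omega> = (\<Sum>i<k. X i \<omega>)"

definition Mmax :: "(nat \<Rightarrow> 'a \<Rightarrow> real) \<Rightarrow> nat \<Rightarrow> real \<Rightarrow> real \<Rightarrow> 'a \<Rightarrow> real" where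
  "Mmax X n h1 h2 \<omega> = Max {(psum X j \<omega> - psum X i \<omega>) / sqrt (real (j - i)) | i j.
      i < j \<and> j \<le> n \<and> h1 \<le> real (j - i) \<and> real (j - i) \<le> h2}"

definition cgf :: "'a measure \<Rightarrow> ('a \<Rightarrow> real) \<Rightarrow> real \<Rightarrow> real" where
  "cgf M Y t = ln (integral\<^sup>L M (\<lambda>\<omega>. exp (t * Y \<omega>)))"

end

theory Submission
  imports Defs "HOL-Real_Asymp.Real_Asymp"
begin

text \<open>All increments are tilted by the fixed parameter \<open>t = tstar\<close>. For a length
  \<open>l = L / \<phi>(t) + a * sqrt L\<close>, where \<open>L = ln n\<close>, and the level \<open>u = sqrt (2 * m * (L + \<tau>))\<close>, maximality
  of \<open>\<phi>(s) / (s\<^sup>2 / 2)\<close> at \<open>t\<close> gives \<open>\<phi>'(t) = m * t\<close> and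
  \<open>l * \<phi>(t) - t * u * sqrt l = - (L + \<tau>) + (sqrt (l * \<phi>(t)) - sqrt (L + \<tau>))\<^sup>2\<close>, so that a
  local limit theorem for a single tilted law, at distance of order \<open>sqrt l\<close> from its mean, yields the tail of each increment. The exceedances \<open>(i, j)\<close> are grouped into cells in which \<open>i\<close> and \<open>j\<close> each range
  over a window of size \<open>B\<close>. The two windows contribute independent maxima, whence the square of
  \<open>E max\<^sub>k\<^sub>\<le>\<^sub>B exp (t * S\<^sub>k - k * \<phi>(t))\<close>. Since \<open>2 * \<phi>(t / 2) < \<phi>(t)\<close>, a joint exceedance of two intervals at
  distance \<open>D\<close> costs a factor \<open>exp (- c * D)\<close>; the union bound over adjacent cells and Bonferroni's
  inequality over cells at spacing \<open>g\<close> therefore enclose the same quantity, and letting \<open>B\<close> and then \<open>g\<close> grow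
  also proves that the limit \<open>H\<close> exists. Blocks of length \<open>(ln n)\<^sup>2\<close> are independent, and the probability
  that none of them contains an exceedance converges to the Poisson limit.\<close>

section \<open>The smoothing kernel\<close>

text \<open>Testing it against a kernel whose transform has compact support confines the inversion
  integral to a bounded range of frequencies, where the non-lattice property does give a Gaussian
  bound; weak convergence carries the result over to the exponential tail function. Two outputs are
  extracted: a limit along each single sequence of lengths and levels, and an upper bound uniform in
  both. They replace a uniform local limit theorem: the sum over the lengths of the strip is the
  integral of a step function in \<open>a\<close>, and dominated convergence combines the two. As
  \<open>lim\<close> is a total function, the value \<open>H\<close> in the theorem carries
  information only because convergence is proved alongside; this is why the upper and lower
  estimates share one error constant that is independent of \<open>B\<close> and \<open>g\<close>.
  Finally, the square of the maximum is also large when the maximum is very negative; a single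
  increment and Chebyshev's inequality exclude that case.\<close>

definition fejer :: "real \<Rightarrow> real" where
  "fejer x = (if x = 0 then 1 else 2 * (1 - cos x) / x\<^sup>2)"

definition tri :: "real \<Rightarrow> real" where
  "tri v = max 0 (1 - \<bar>v\<bar>)"

lemma tri_nonneg: "0 \<le> tri v" and tri_le_1: "tri v \<le> 1" and tri_eq_0: "1 \<le> \<bar>v\<bar> \<Longrightarrow> tri v = 0"
  and tri_0: "tri 0 = 1" and tri_minus: "tri (- v) = tri v"
  by (auto simp: tri_def)

lemma continuous_on_tri [continuous_intros]: "continuous_on A f \<Longrightarrow> continuous_on A (\<lambda>x. tri (f x))"
  unfolding tri_def by (intro continuous_intros)

lemma tri_measurable [measurable]: "tri \<in> borel_measurable borel"
  unfolding tri_def by measurable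

lemma fejer_measurable [measurable]: "fejer \<in> borel_measurable borel"
  unfolding fejer_def by measurable

lemma fejer_nonneg: "0 \<le> fejer x"
  by (simp add: fejer_def)

lemma fejer_le_1: "fejer x \<le> 1"
proof (cases "x = 0")
  case False
  have "cos x = 1 - 2 * (sin (x / 2))\<^sup>2"
    using cos_double_sin[of "x / 2"] by simp
  moreover have "(sin (x / 2))\<^sup>2 \<le> (x / 2)\<^sup>2"
    using abs_sin_x_le_abs_x[of "x / 2"] by (simp only: abs_le_square_iff)
  ultimately have "2 * (1 - cos x) \<le> x\<^sup>2"
    by (simp add: power_divide)
  with False show ?thesis
    by (simp add: fejer_def)
qed (simp add: fejer_def)

text \<open>Adding the bounds \<open>fejer x \<le> 1\<close> and
  \<open>fejer x * x\<^sup>2 \<le> 4\<close> gives the constant 5; the quadratic decay makes the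
  kernel integrable.\<close>

lemma fejer_bound: "fejer x \<le> 5 / (1 + x\<^sup>2)"
proof -
  have "fejer x * x\<^sup>2 \<le> 4"
  proof (cases "x = 0")
    case False
    then have "fejer x * x\<^sup>2 = 2 * (1 - cos x)"
      by (simp add: fejer_def)
    moreover have "2 * (1 - c) \<le> 4" if "- 1 \<le> c" for c :: real
      using that by simp
    ultimately show ?thesis
      by (metis cos_ge_minus_one)
  qed simp
  then have "fejer x * (1 + x\<^sup>2) \<le> 5"
    using fejer_le_1[of x] by (simp add: algebra_simps)
  moreover have "0 < 1 + x\<^sup>2"
    by (metis add_pos_nonneg zero_le_power2 zero_less_one)
  ultimately show ?thesis
    by (simp add: pos_le_divide_eq)
qed

lemma integrable_fejer: "integrable lborel fejer"
proof (rule Bochner_Integration.integrable_bound)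
  have "integrable lborel (\<lambda>x::real. inverse (1 + x\<^sup>2))"
    using integrable_inverse_1_plus_square
    by (simp add: interval_lebesgue_integrable_def einterval_def set_integrable_def)
  then show "integrable lborel (\<lambda>x::real. 5 * inverse (1 + x\<^sup>2))"
    by (rule integrable_mult_right)
  show "AE x in lborel. norm (fejer x) \<le> norm (5 * inverse (1 + x\<^sup>2))"
    using fejer_bound fejer_nonneg by (auto simp: abs_mult divide_inverse intro!: AE_I2)
qed measurable

text \<open>Compact support: the product is dominated by a multiple of the indicator of
  [-1, 1].\<close>

lemma integrable_tri_bounded:
  fixes f :: "real \<Rightarrow> complex"
  assumes [measurable]: "f \<in> borel_measurable borel" and b: "\<And>v. norm (f v) \<le> C"
  shows "integrable lborel (\<lambda>v. of_real (tri v) * f v)"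
proof (rule Bochner_Integration.integrable_bound)
  show "integrable lborel (\<lambda>v::real. C * indicator {-1..1} v :: real)"
    by simp
  have "norm (of_real (tri v) * f v) \<le> norm (C * indicator {-1..1} v)" for v
  proof (cases "v \<in> {-1..1}")
    case True
    have "tri v * norm (f v) \<le> 1 * C"
      using b[of v] norm_ge_zero[of "f v"] tri_nonneg[of v] tri_le_1[of v] by (intro mult_mono) auto
    with True show ?thesis
      by (simp add: norm_mult abs_of_nonneg[OF tri_nonneg])
  qed (auto simp: tri_def)
  then show "AE v in lborel. norm (of_real (tri v) * f v) \<le> norm (C * indicator {-1..1} v)"
    by simp
qed measurable

text \<open>Integration by parts on [0, 1], with \<open>G\<close> as antiderivative, gives half of
  the value and reflection the other half. The case \<open>x = 0\<close> needs its own
  antiderivative.\<close>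

lemma integral_tri_cos: "(\<integral>v. tri v * cos (v * x) \<partial>lborel) = fejer x"
proof -
  define G where "G v = (if x = 0 then v - v\<^sup>2 / 2 else (1 - v) * sin (v * x) / x - cos (v * x) / x\<^sup>2)" for v
  have 1: "has_bochner_integral lborel (\<lambda>v. (1 - v) * cos (v * x) * indicator {0..1} v) (G 1 - G 0)"
  proof (rule has_bochner_integral_FTC_Icc_real)
    show "DERIV G v :> (1 - v) * cos (v * x)" if "0 \<le> v" "v \<le> 1" for v
      unfolding G_def
      by (cases "x = 0") (auto intro!: derivative_eq_intros simp: field_simps power2_eq_square)
  qed (auto intro!: continuous_intros)
  have 2: "G 1 - G 0 = fejer x / 2"
    by (auto simp: G_def fejer_def field_simps)
  have "has_bochner_integral lborel (\<lambda>v. (1 - (0 + (-1) * v)) * cos ((0 + (-1) * v) * x) * indicator {0..1} (0 + (-1) * v)) ((G 1 - G 0) /\<^sub>R \<bar>-1\<bar>)"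
    by (rule lborel_has_bochner_integral_real_affine_iff[THEN iffD1, OF _ 1]) auto
  from has_bochner_integral_add[OF 1 this]
  have 3: "has_bochner_integral lborel (\<lambda>v. (1 - v) * cos (v * x) * indicator {0..1} v +
      (1 + v) * cos (v * x) * indicator {0..1} (- v)) (fejer x)"
    by (simp add: 2)
  \<comment> \<open>At \<open>v = 0\<close> both indicators are 1, so the identity holds only almost
    everywhere.\<close>
  have "AE v in lborel. (1 - v) * cos (v * x) * indicator {0..1} v +
      (1 + v) * cos (v * x) * indicator {0..1} (- v) = tri v * cos (v * x)"
    using AE_lborel_singleton[of "0::real"]
    by eventually_elim (auto simp: tri_def indicator_def)
  then have "has_bochner_integral lborel (\<lambda>v. tri v * cos (v * x)) (fejer x)"
    by (subst has_bochner_integral_cong_AE[OF _ _ AE_symmetric]) (use 3 in auto)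
  then show ?thesis
    by (rule has_bochner_integral_integral_eq)
qed

lemma integral_tri_iexp: "(CLBINT v. of_real (tri v) * iexp (v * x)) = of_real (fejer x)"
proof (rule complex_eqI)
  have int: "integrable lborel (\<lambda>v. of_real (tri v) * iexp (v * x))"
    by (rule integrable_tri_bounded[where C = 1]) auto
  have Re: "Re (of_real (tri v) * iexp (v * x)) = tri v * cos (v * x)"
    and Im: "Im (of_real (tri v) * iexp (v * x)) = tri v * sin (v * x)" for v
    by (auto simp: Re_exp Im_exp)
  show "Re (CLBINT v. of_real (tri v) * iexp (v * x)) = Re (of_real (fejer x))"
    unfolding integral_Re[OF int, symmetric] Re by (simp add: integral_tri_cos)
  \<comment> \<open>The sine part is odd, hence equal to its own negative.\<close>
  have "(\<integral>v. tri v * sin (v * x) \<partial>lborel) = (\<integral>v. tri (- v) * sin (- v * x) \<partial>lborel)"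
    using lborel_integral_real_affine[of "-1" "\<lambda>v. tri v * sin (v * x)" 0] by simp
  also have "\<dots> = - (\<integral>v. tri v * sin (v * x) \<partial>lborel)"
    by (simp add: tri_minus)
  finally show "Im (CLBINT v. of_real (tri v) * iexp (v * x)) = Im (of_real (fejer x))"
    unfolding integral_Im[OF int, symmetric] Im by simp
qed

text \<open>The Fejer kernel has zeros; adding a translate by \<open>\<pi>\<close> makes it bounded below by a multiple of
  \<open>1 / (1 + x\<^sup>2)\<close>, while its Fourier transform \<open>kern_ft\<close> is still supported in \<open>[-1, 1]\<close>.\<close>

definition kern :: "real \<Rightarrow> real" where
  "kern x = fejer x + fejer (x - pi)"

definition kern_ft :: "real \<Rightarrow> complex" where
  "kern_ft v = of_real (tri v) * (1 + iexp (- pi * v))"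

lemma kern_measurable [measurable]: "kern \<in> borel_measurable borel"
  unfolding kern_def by measurable

lemma kern_ft_measurable [measurable]: "kern_ft \<in> borel_measurable borel"
  unfolding kern_ft_def by measurable

lemma kern_nonneg: "0 \<le> kern x" and kern_le_2: "kern x \<le> 2"
  using fejer_nonneg[of x] fejer_nonneg[of "x - pi"] fejer_le_1[of x] fejer_le_1[of "x - pi"]
  by (auto simp: kern_def)

text \<open>Since \<open>cos (x - pi) = - cos x\<close>, the two numerators are
  \<open>2 * (1 - cos x)\<close> and \<open>2 * (1 + cos x)\<close>, with sum 4. Both denominators
  are at most \<open>20 + 2 * x\<^sup>2\<close>, because
  \<open>(x - pi)\<^sup>2 \<le> 2 * x\<^sup>2 + 2 * pi\<^sup>2\<close> and
  \<open>pi\<^sup>2 \<le> 10\<close>. This bound is what lets \<open>kern\<close> dominate the test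
  functions.\<close>

lemma kern_lower: "4 / (20 + 2 * x\<^sup>2) \<le> kern x"
proof -
  have pi: "pi\<^sup>2 \<le> 10"
    using pi_less_4 pi_approx by (auto simp: power2_eq_square intro!: order_trans[OF mult_mono[of pi "3.15" pi "3.15"]])
  have sq: "(x - pi)\<^sup>2 \<le> 20 + 2 * x\<^sup>2"
    using pi zero_le_power2[of "x + pi"] by (simp add: power2_eq_square algebra_simps)
  have pos: "0 < 20 + 2 * x\<^sup>2"
    using zero_le_power2[of x] by linarith
  consider "x = 0" | "x = pi" | "x \<noteq> 0" "x \<noteq> pi"
    by auto
  then show ?thesis
  proof cases
    case 1
    then show ?thesis
      using fejer_nonneg[of "- pi"] by (simp add: kern_def fejer_def)
  next
    case 2
    have "4 / (20 + 2 * x\<^sup>2) \<le> 1"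
      using zero_le_power2[of x] pos by (subst pos_divide_le_eq) auto
    moreover have "fejer (x - pi) = 1"
      using 2 by (simp add: fejer_def)
    ultimately show ?thesis
      using fejer_nonneg[of x] by (simp only: kern_def)
  next
    case 3
    have "2 * (1 - cos x) / (20 + 2 * x\<^sup>2) \<le> fejer x"
      unfolding fejer_def using 3 zero_le_power2[of x] pos
      by (auto intro!: divide_left_mono mult_pos_pos)
    moreover have "2 * (1 + cos x) / (20 + 2 * x\<^sup>2) \<le> fejer (x - pi)"
      unfolding fejer_def using 3 sq pos cos_ge_minus_one[of x]
      by (auto intro!: divide_left_mono mult_pos_pos simp: cos_diff simp del: cos_ge_minus_one)
    ultimately show ?thesis
      unfolding kern_def by (simp add: field_simps add_divide_distrib diff_divide_distrib)
  qed
qed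

lemma kern_pos: "0 < kern x"
  using kern_lower[of x] zero_le_power2[of x]
  by (smt (verit) divide_pos_pos)

lemma integrable_kern: "integrable lborel kern"
proof -
  have "integrable lborel (\<lambda>x. fejer (- pi + 1 * x))"
    by (intro lborel_integrable_real_affine integrable_fejer) auto
  with integrable_fejer show ?thesis
    unfolding kern_def by simp
qed

lemma kern_ft_bound: "norm (kern_ft v) \<le> 2"
proof -
  have "norm (1 + iexp (- pi * v)) \<le> 2"
    by (rule order_trans[OF norm_triangle_ineq]) (use norm_exp_i_times[of "- pi * v"] in simp)
  then have "tri v * norm (1 + iexp (- pi * v)) \<le> 1 * 2"
    using tri_nonneg[of v] tri_le_1[of v] by (intro mult_mono) auto
  then show ?thesis
    unfolding kern_ft_def by (simp add: norm_mult abs_of_nonneg[OF tri_nonneg])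
qed

lemma kern_ft_eq_0: "1 \<le> \<bar>v\<bar> \<Longrightarrow> kern_ft v = 0"
  by (simp add: kern_ft_def tri_eq_0)

lemma kern_ft_0: "kern_ft 0 = 2"
  by (simp add: kern_ft_def tri_0)

lemma isCont_kern_ft: "isCont kern_ft v"
proof -
  have "continuous_on UNIV kern_ft"
    unfolding kern_ft_def by (intro continuous_intros)
  then show ?thesis
    by (simp add: continuous_on_eq_continuous_at)
qed

lemma integrable_kern_ft_bounded:
  fixes f :: "real \<Rightarrow> complex"
  assumes [measurable]: "f \<in> borel_measurable borel" and b: "\<And>v. norm (f v) \<le> C"
  shows "integrable lborel (\<lambda>v. kern_ft v * f v)"
proof -
  have "norm ((1 + iexp (- pi * v)) * f v) \<le> 2 * C" for v
  proof -
    have "norm (1 + iexp (- pi * v)) \<le> 2"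
      by (rule order_trans[OF norm_triangle_ineq]) (use norm_exp_i_times[of "- pi * v"] in simp)
    then show ?thesis
      unfolding norm_mult using b[of v] by (intro mult_mono) auto
  qed
  then have "integrable lborel (\<lambda>v. of_real (tri v) * ((1 + iexp (- pi * v)) * f v))"
    by (intro integrable_tri_bounded) auto
  then show ?thesis
    by (simp add: kern_ft_def mult.assoc)
qed

text \<open>A translation by pi in space is a factor \<open>iexp (- pi * v)\<close> in frequency,
  which is the origin of the second summand of \<open>kern_ft\<close>.\<close>

lemma integral_kern_ft_iexp: "(CLBINT v. kern_ft v * iexp (v * x)) = of_real (kern x)"
proof -
  have int: "integrable lborel (\<lambda>v. of_real (tri v) * iexp (v * y))" for y
    by (rule integrable_tri_bounded[where C = 1]) auto
  have "kern_ft v * iexp (v * x) = of_real (tri v) * iexp (v * x) + of_real (tri v) * iexp (v * (x - pi))" for v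
    by (simp add: kern_ft_def algebra_simps flip: exp_add)
  then show ?thesis
    using int by (simp only: Bochner_Integration.integral_add[OF int int] integral_tri_iexp kern_def of_real_add)
qed

section \<open>A local limit theorem\<close>

lemma integrable_gaussian: "0 < c \<Longrightarrow> integrable lborel (\<lambda>s::real. exp (- c * s\<^sup>2))"
proof -
  assume c: "0 < c"
  have "integrable lborel (\<lambda>s. sqrt (pi / c) * normal_density 0 (sqrt (1 / (2 * c))) s)"
    using c by (intro integrable_mult_right integrable_normal_density) simp
  moreover have "sqrt (pi / c) * normal_density 0 (sqrt (1 / (2 * c))) s = exp (- c * s\<^sup>2)" for s
    using c by (simp add: normal_density_def real_sqrt_divide field_simps)
  ultimately show ?thesis
    by simp
qed

text \<open>Scaling the variable by \<sigma> turns this into the characteristic function of the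
  standard normal law at \<open>- \<rho> / \<sigma>\<close>.\<close>

lemma gaussian_integral:
  assumes "0 < \<sigma>"
  shows "(CLBINT s. exp (- of_real (\<sigma>\<^sup>2 * s\<^sup>2 / 2)) * iexp (- s * \<rho>)) =
    of_real (sqrt (2 * pi) / \<sigma> * exp (- \<rho>\<^sup>2 / (2 * \<sigma>\<^sup>2)))"
proof -
  have "char std_normal_distribution (- \<rho> / \<sigma>) = of_real (exp (- (- \<rho> / \<sigma>)\<^sup>2 / 2))"
    by (simp add: char_std_normal_distribution)
  also have "char std_normal_distribution (- \<rho> / \<sigma>) =
    (CLBINT x. std_normal_density x *\<^sub>R iexp (- \<rho> / \<sigma> * x))"
    unfolding char_def by (subst integral_density) (auto simp: normal_density_nonneg)
  also have "\<dots> = \<bar>\<sigma>\<bar> *\<^sub>R (CLBINT s. std_normal_density (0 + \<sigma> * s) *\<^sub>R iexp (- \<rho> / \<sigma> * (0 + \<sigma> * s)))"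
    using assms by (intro lborel_integral_real_affine) auto
  also have "(\<lambda>s. std_normal_density (0 + \<sigma> * s) *\<^sub>R iexp (- \<rho> / \<sigma> * (0 + \<sigma> * s))) =
    (\<lambda>s. of_real (1 / sqrt (2 * pi)) * (exp (- of_real (\<sigma>\<^sup>2 * s\<^sup>2 / 2)) * iexp (- s * \<rho>)))"
    using assms by (auto simp: std_normal_density_def fun_eq_iff scaleR_conv_of_real power_mult_distrib mult_ac
        simp flip: exp_of_real)
  finally have "of_real \<bar>\<sigma>\<bar> * (of_real (1 / sqrt (2 * pi)) * (CLBINT s. exp (- of_real (\<sigma>\<^sup>2 * s\<^sup>2 / 2)) * iexp (- s * \<rho>))) =
      complex_of_real (exp (- (- \<rho> / \<sigma>)\<^sup>2 / 2))"
    unfolding scaleR_conv_of_real by (simp only: integral_mult_right_zero)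
  then show ?thesis
    using assms by (simp add: field_simps power_divide del: of_real_power)
qed

text \<open>Parseval's identity: insert the Fourier representation of \<open>kern\<close> and
  exchange the integrals. Because \<open>kern_ft\<close> vanishes outside [-1, 1], only values of
  the characteristic function at distance less than 1 from \<theta> enter.\<close>

lemma (in real_distribution) integral_kern_iexp:
  "(CLINT x|M. of_real (kern x) * iexp (\<theta> * x)) = (CLBINT v. kern_ft (v - \<theta>) * char M v)"
proof -
  have fin: "emeasure (lborel \<Otimes>\<^sub>M M) ({-1..1::real} \<times> UNIV) < \<infinity>"
    by (subst emeasure_pair_measure_Times) (auto simp: emeasure_eq_measure ennreal_mult_less_top)
  interpret pair_sigma_finite lborel M
    by (intro pair_sigma_finite.intro lborel.sigma_finite_measure_axioms sigma_finite_measure_axioms)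
  have meas [measurable]: "(\<lambda>v. kern_ft (v - \<theta>)) \<in> borel_measurable lborel"
    by measurable
  have int: "integrable (lborel \<Otimes>\<^sub>M M) (\<lambda>(v, x). kern_ft v * iexp ((v + \<theta>) * x))"
  proof (rule Bochner_Integration.integrable_bound)
    show "integrable (lborel \<Otimes>\<^sub>M M) (\<lambda>(v, x). 2 * indicator {-1..1::real} v :: real)"
    proof -
      have "integrable (lborel \<Otimes>\<^sub>M M) (\<lambda>z. 2 * indicator ({-1..1::real} \<times> UNIV) z :: real)"
        using fin by (intro integrable_mult_right integrable_real_indicator) auto
      also have "(\<lambda>z. 2 * indicator ({-1..1::real} \<times> UNIV) z :: real) = (\<lambda>(v, x). 2 * indicator {-1..1::real} v)"
        by (auto simp: indicator_def fun_eq_iff)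
      finally show ?thesis .
    qed
    show "(\<lambda>(v, x). kern_ft v * iexp ((v + \<theta>) * x)) \<in> borel_measurable (lborel \<Otimes>\<^sub>M M)"
      by measurable
    have "norm (kern_ft v * iexp ((v + \<theta>) * x)) \<le> norm (2 * indicat_real {-1..1} v)" for v x
      unfolding norm_mult[of "kern_ft v"] norm_exp_i_times
      using kern_ft_bound[of v] kern_ft_eq_0[of v] by (auto simp: indicator_def)
    then show "AE z in lborel \<Otimes>\<^sub>M M. norm (case z of (v, x) \<Rightarrow> kern_ft v * iexp ((v + \<theta>) * x)) \<le>
        norm (case z of (v, x) \<Rightarrow> 2 * indicat_real {-1..1} v)"
      by (intro AE_I2) (auto simp only: split: prod.split)
  qed
  have "(CLINT x|M. of_real (kern x) * iexp (\<theta> * x)) =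
      (CLINT x|M. (CLBINT v. kern_ft v * iexp ((v + \<theta>) * x)))"
    by (simp only: integral_kern_ft_iexp[symmetric] flip: integral_mult_left_zero)
       (simp add: mult.assoc algebra_simps flip: exp_add)
  also have "\<dots> = (CLBINT v. (CLINT x|M. kern_ft v * iexp ((v + \<theta>) * x)))"
    using Fubini_integral[OF int] by simp
  also have "\<dots> = (CLBINT v. kern_ft v * char M (v + \<theta>))"
    by (simp add: char_def)
  also have "\<dots> = \<bar>1\<bar> *\<^sub>R (CLBINT v. kern_ft (- \<theta> + 1 * v) * char M ((- \<theta> + 1 * v) + \<theta>))"
    by (rule lborel_integral_real_affine) simp
  finally show ?thesis
    by (simp add: add.commute)
qed


text \<open>What the local limit theorem uses of a characteristic function: the central limit
  scaling at 0, and a Gaussian bound on every bounded range of frequencies, with a constant that may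
  depend on the range. It is instantiated by the tilted step law and by the Gaussian itself.\<close>

locale llt_char =
  fixes \<psi> :: "real \<Rightarrow> complex" and \<sigma> :: real
  assumes psi_measurable [measurable]: "\<psi> \<in> borel_measurable borel"
    and sigma_pos: "0 < \<sigma>"
    and psi_clt: "\<And>s. (\<lambda>n. \<psi> (s / sqrt (real n)) ^ n) \<longlonglongrightarrow> exp (- of_real (\<sigma>\<^sup>2 * s\<^sup>2 / 2))"
    and psi_gauss: "\<And>A. \<exists>c>0. \<forall>\<theta>. \<bar>\<theta>\<bar> \<le> A \<longrightarrow> norm (\<psi> \<theta>) \<le> exp (- c * \<theta>\<^sup>2)"
begin

text \<open>With \<open>v = s / sqrt l\<close> the kernel factor freezes at
  \<open>kern_ft (- \<theta>)\<close>, the power tends to a Gaussian and the phase to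
  \<open>iexp (- \<rho> * s)\<close>. Here \<open>\<zeta>\<close> is the offset of the centre, of
  order \<open>sqrt l\<close>. The frequency \<theta> is kept because the limits for all \<theta>
  together identify a weak limit.\<close>

lemma kern_limit:
  fixes Q :: "nat \<Rightarrow> real measure" and l :: "nat \<Rightarrow> nat"
  assumes Q: "\<And>n. real_distribution (Q n)"
    and char: "\<And>n \<theta>. char (Q n) \<theta> = \<psi> \<theta> ^ l n * iexp (- \<zeta> n * \<theta>)"
    and l: "filterlim l at_top sequentially"
    and \<zeta>: "(\<lambda>n. \<zeta> n / sqrt (real (l n))) \<longlonglongrightarrow> \<rho>"
  shows "(\<lambda>n. of_real (sqrt (real (l n))) * (CLINT x|Q n. of_real (kern x) * iexp (\<theta> * x)))
    \<longlonglongrightarrow> kern_ft (- \<theta>) * of_real (sqrt (2 * pi) / \<sigma> * exp (- \<rho>\<^sup>2 / (2 * \<sigma>\<^sup>2)))"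
proof -
  define r where "r n = sqrt (real (l n))" for n
  \<comment> \<open>The value 0 at \<open>l n = 0\<close> makes the majorant valid for every
    \<open>n\<close>, not only eventually.\<close>
  define F where "F n s = (if l n = 0 then 0 else
    kern_ft (s / r n - \<theta>) * (\<psi> (s / r n) ^ l n * iexp (- \<zeta> n / r n * s)))" for n s
  \<comment> \<open>The range \<open>1 + \<bar>\<theta>\<bar>\<close> contains the support of the
    shifted kernel transform.\<close>
  obtain c where c: "c > 0" and cb: "\<And>v. \<bar>v\<bar> \<le> 1 + \<bar>\<theta>\<bar> \<Longrightarrow> norm (\<psi> v) \<le> exp (- c * v\<^sup>2)"
    using psi_gauss[of "1 + \<bar>\<theta>\<bar>"] by auto
  have ev: "eventually (\<lambda>n. 0 < l n) sequentially"
    using l unfolding filterlim_at_top by (auto dest!: spec[of _ 1] elim!: eventually_mono)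
  have eq: "of_real (r n) * (CLINT x|Q n. of_real (kern x) * iexp (\<theta> * x)) = (CLBINT s. F n s)" if "0 < l n" for n
  proof -
    interpret real_distribution "Q n" by (rule Q)
    have r: "r n > 0"
      using that by (simp add: r_def)
    have "(CLINT x|Q n. of_real (kern x) * iexp (\<theta> * x)) =
      (CLBINT v. kern_ft (v - \<theta>) * (\<psi> v ^ l n * iexp (- \<zeta> n * v)))"
      by (simp only: integral_kern_iexp char)
    also have "\<dots> = \<bar>1 / r n\<bar> *\<^sub>R (CLBINT s. kern_ft (0 + 1 / r n * s - \<theta>) *
        (\<psi> (0 + 1 / r n * s) ^ l n * iexp (- \<zeta> n * (0 + 1 / r n * s))))"
      using r by (intro lborel_integral_real_affine) auto
    finally show ?thesis
      using r that by (simp add: F_def scaleR_conv_of_real)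
  qed
  have "(\<lambda>n. CLBINT s. F n s) \<longlonglongrightarrow>
    (CLBINT s. kern_ft (- \<theta>) * (exp (- of_real (\<sigma>\<^sup>2 * s\<^sup>2 / 2)) * iexp (- s * \<rho>)))"
  proof (rule integral_dominated_convergence)
    show "integrable lborel (\<lambda>s. 2 * exp (- c * s\<^sup>2))"
      using c by (intro integrable_mult_right integrable_gaussian)
    show "AE s in lborel. (\<lambda>n. F n s) \<longlonglongrightarrow> kern_ft (- \<theta>) * (exp (- of_real (\<sigma>\<^sup>2 * s\<^sup>2 / 2)) * iexp (- s * \<rho>))"
    proof (rule AE_I2)
      fix s
      have rt: "filterlim r at_top sequentially"
        unfolding r_def using l
        by (intro filterlim_compose[OF sqrt_at_top] filterlim_compose[OF filterlim_real_sequentially])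
      have "(\<lambda>n. s / r n - \<theta>) \<longlonglongrightarrow> 0 - \<theta>"
        by (intro tendsto_diff tendsto_const real_tendsto_divide_at_top[OF tendsto_const rt])
      then have "(\<lambda>n. kern_ft (s / r n - \<theta>)) \<longlonglongrightarrow> kern_ft (- \<theta>)"
        using isCont_tendsto_compose[OF isCont_kern_ft] by fastforce
      moreover have "(\<lambda>n. \<psi> (s / r n) ^ l n) \<longlonglongrightarrow> exp (- of_real (\<sigma>\<^sup>2 * s\<^sup>2 / 2))"
        unfolding r_def using filterlim_compose[OF psi_clt l, of s] .
      moreover have "(\<lambda>n. iexp (- (\<zeta> n / r n) * s)) \<longlonglongrightarrow> iexp (- \<rho> * s)"
        using \<zeta> unfolding r_def by (intro tendsto_intros)
      ultimately show "(\<lambda>n. F n s) \<longlonglongrightarrow> kern_ft (- \<theta>) * (exp (- of_real (\<sigma>\<^sup>2 * s\<^sup>2 / 2)) * iexp (- s * \<rho>))"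
        by (intro Lim_transform_eventually[OF tendsto_mult[OF _ tendsto_mult]])
           (use ev in \<open>auto simp: F_def mult.commute elim!: eventually_mono\<close>)
    qed
    show "AE s in lborel. norm (F n s) \<le> 2 * exp (- c * s\<^sup>2)" for n
    proof (rule AE_I2)
      fix s
      show "norm (F n s) \<le> 2 * exp (- c * s\<^sup>2)"
      proof (cases "l n > 0 \<and> \<bar>s / r n - \<theta>\<bar> < 1")
        case True
        have "norm (\<psi> (s / r n)) ^ l n \<le> exp (- c * (s / r n)\<^sup>2) ^ l n"
          using True by (intro power_mono cb) auto
        also have "\<dots> = exp (- c * s\<^sup>2)"
          using True by (simp add: r_def power_divide flip: exp_of_nat_mult)
        finally have "norm (kern_ft (s / r n - \<theta>)) * norm (\<psi> (s / r n) ^ l n * iexp (- \<zeta> n / r n * s)) \<le> 2 * exp (- c * s\<^sup>2)"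
          by (intro mult_mono kern_ft_bound) (auto simp: norm_mult norm_power)
        then show ?thesis
          using True by (simp add: F_def norm_mult)
      qed (auto simp: F_def kern_ft_eq_0)
    qed
  qed (auto simp: F_def)
  then have "(\<lambda>n. CLBINT s. F n s) \<longlonglongrightarrow> kern_ft (- \<theta>) * of_real (sqrt (2 * pi) / \<sigma> * exp (- \<rho>\<^sup>2 / (2 * \<sigma>\<^sup>2)))"
    by (simp only: integral_mult_right_zero gaussian_integral[OF sigma_pos])
  then show ?thesis
    by (rule Lim_transform_eventually) (use ev eq in \<open>auto simp: r_def elim!: eventually_mono\<close>)
qed


text \<open>The same inversion integral with absolute values inside: the phase disappears, so
  \<open>K\<close> depends neither on \<open>l\<close> nor on \<open>\<zeta>\<close>.\<close>

lemma kern_bound: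
  "\<exists>K. \<forall>Q l \<zeta>. real_distribution Q \<longrightarrow> (\<forall>\<theta>. char Q \<theta> = \<psi> \<theta> ^ l * iexp (- \<zeta> * \<theta>)) \<longrightarrow>
    sqrt (real l) * (\<integral>x. kern x \<partial>Q) \<le> K"
proof -
  obtain c where c: "c > 0" and cb: "\<And>v. \<bar>v\<bar> \<le> 1 \<Longrightarrow> norm (\<psi> v) \<le> exp (- c * v\<^sup>2)"
    using psi_gauss[of 1] by auto
  define K where "K = (\<integral>s. 2 * exp (- c * s\<^sup>2) \<partial>lborel)"
  have K0: "0 \<le> K"
    unfolding K_def by (intro integral_nonneg_AE) auto
  have "sqrt (real l) * (\<integral>x. kern x \<partial>Q) \<le> K"
    if Q: "real_distribution Q" and char: "\<And>\<theta>. char Q \<theta> = \<psi> \<theta> ^ l * iexp (- \<zeta> * \<theta>)" for Q l \<zeta>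
  proof (cases "l = 0")
    case False
    interpret real_distribution Q by (rule Q)
    define r where "r = sqrt (real l)"
    have r: "0 < r"
      using False by (simp add: r_def)
    have int: "integrable lborel (\<lambda>v. 2 * exp (- (c * real l) * v\<^sup>2))"
      using c False by (intro integrable_mult_right integrable_gaussian) simp
    have "(\<integral>x. kern x \<partial>Q) = norm (CLINT x|Q. of_real (kern x) * iexp (0 * x))"
      using Bochner_Integration.integral_nonneg[of Q kern] kern_nonneg
      by (simp add: integral_complex_of_real)
    also have "\<dots> = norm (CLBINT v. kern_ft v * (\<psi> v ^ l * iexp (- \<zeta> * v)))"
      by (simp only: integral_kern_iexp char diff_zero)
    also have "\<dots> \<le> (\<integral>v. 2 * exp (- (c * real l) * v\<^sup>2) \<partial>lborel)"
    proof (rule order_trans[OF integral_norm_bound integral_mono])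
      show "norm (kern_ft v * (\<psi> v ^ l * iexp (- \<zeta> * v))) \<le> 2 * exp (- (c * real l) * v\<^sup>2)" for v
      proof (cases "\<bar>v\<bar> < 1")
        case True
        have "norm (\<psi> v) ^ l \<le> exp (- c * v\<^sup>2) ^ l"
          using True by (intro power_mono cb) auto
        also have "\<dots> = exp (- (c * real l) * v\<^sup>2)"
          by (simp add: mult_ac flip: exp_of_nat_mult)
        finally show ?thesis
          unfolding norm_mult[of "kern_ft v"]
          by (intro mult_mono kern_ft_bound) (auto simp: norm_mult norm_power)
      qed (auto simp: kern_ft_eq_0)
      show "integrable lborel (\<lambda>v. norm (kern_ft v * (\<psi> v ^ l * iexp (- \<zeta> * v))))"
        unfolding char[symmetric]
        by (intro integrable_norm integrable_kern_ft_bounded[OF _ cmod_char_le_1]) simp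
    qed (rule int)
    also have "\<dots> = \<bar>1 / r\<bar> *\<^sub>R (\<integral>s. 2 * exp (- (c * real l) * (0 + 1 / r * s)\<^sup>2) \<partial>lborel)"
      using r by (intro lborel_integral_real_affine) auto
    also have "\<dots> = K / r"
      using r by (simp add: K_def r_def power_divide)
    finally show ?thesis
      using r by (simp add: r_def field_simps)
  qed (use K0 in simp)
  then show ?thesis
    by blast
qed

end

lemma char_normal:
  assumes "0 < s"
  shows "char (density lborel (normal_density 0 s)) \<theta> = exp (- of_real (s\<^sup>2 * \<theta>\<^sup>2 / 2))"
proof -
  have "char (density lborel (normal_density 0 s)) \<theta> =
    (CLBINT x. normal_density 0 s x *\<^sub>R iexp (\<theta> * x))"
    unfolding char_def by (subst integral_density) (auto simp: normal_density_nonneg)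
  also have "\<dots> = \<bar>s\<bar> *\<^sub>R (CLBINT x. normal_density 0 s (0 + s * x) *\<^sub>R iexp (\<theta> * (0 + s * x)))"
    using assms by (intro lborel_integral_real_affine) auto
  also have "\<dots> = (CLBINT x. \<bar>s\<bar> *\<^sub>R normal_density 0 s (0 + s * x) *\<^sub>R iexp (\<theta> * (0 + s * x)))"
    by (simp only: integral_scaleR_right)
  also have "(\<lambda>x. \<bar>s\<bar> *\<^sub>R normal_density 0 s (0 + s * x) *\<^sub>R iexp (\<theta> * (0 + s * x))) =
    (\<lambda>x. std_normal_density x *\<^sub>R iexp (\<theta> * s * x))"
    using assms by (auto simp: fun_eq_iff normal_density_def power_mult_distrib real_sqrt_mult mult_ac)
  also have "(CLBINT x. std_normal_density x *\<^sub>R iexp (\<theta> * s * x)) = char std_normal_distribution (\<theta> * s)"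
    unfolding char_def by (subst integral_density) (auto simp: normal_density_nonneg)
  finally show ?thesis
    by (simp add: char_std_normal_distribution power_mult_distrib mult_ac flip: exp_of_real)
qed

text \<open>The Gaussian instance serves to invert the Fourier transform of \<open>kern\<close>,
  where the test measures have explicit densities.\<close>

interpretation gaussian: llt_char "\<lambda>\<theta>. exp (- of_real (\<theta>\<^sup>2 / 2))" 1
proof
  show "(\<lambda>n. exp (- complex_of_real ((s / sqrt (real n))\<^sup>2 / 2)) ^ n) \<longlonglongrightarrow> exp (- of_real (1\<^sup>2 * s\<^sup>2 / 2))" for s
    by (rule tendsto_eventually, rule eventually_mono[OF eventually_gt_at_top[of 0]])
       (simp add: power_divide flip: exp_of_nat_mult)
  show "\<exists>c>0. \<forall>\<theta>. \<bar>\<theta>\<bar> \<le> A \<longrightarrow> norm (exp (- complex_of_real (\<theta>\<^sup>2 / 2))) \<le> exp (- c * \<theta>\<^sup>2)" for A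
    by (rule exI[of _ "1/2"]) (simp flip: of_real_minus exp_of_real)
qed simp_all

text \<open>Fourier inversion for the kernel: evaluate \<open>\<integral> kern x * iexp (\<theta> * x)\<close> against centred Gaussians of
  growing variance in two ways.\<close>

lemma kern_fourier: "(CLBINT x. of_real (kern x) * iexp (\<theta> * x)) = 2 * pi * kern_ft (- \<theta>)"
proof -
  define Q where "Q n = density lborel (normal_density 0 (sqrt (real (Suc n))))" for n
  define I where "I = (CLBINT x. of_real (kern x) * iexp (\<theta> * x))"
  define c where "c = 1 / sqrt (2 * pi)"
  have Qr: "real_distribution (Q n)" for n
    unfolding Q_def real_distribution_def real_distribution_axioms_def
    by (auto intro!: prob_space_normal_density)
  have "(\<lambda>n. of_real (sqrt (real (Suc n))) * (CLINT x|Q n. of_real (kern x) * iexp (\<theta> * x)))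
    \<longlonglongrightarrow> kern_ft (- \<theta>) * of_real (sqrt (2 * pi) / 1 * exp (- 0\<^sup>2 / (2 * 1\<^sup>2)))"
  proof (rule gaussian.kern_limit[where \<zeta> = "\<lambda>_. 0"])
    show "char (Q n) \<theta> = exp (- complex_of_real (\<theta>\<^sup>2 / 2)) ^ Suc n * iexp (- 0 * \<theta>)" for n \<theta>
      unfolding Q_def by (subst char_normal) (simp_all add: exp_of_nat_mult[symmetric] del: power_Suc of_nat_Suc)
  qed (auto simp: Qr filterlim_Suc)
  \<comment> \<open>The second evaluation: multiplied by the standard deviation, the density
    increases to the constant \<open>c\<close>, so the integrals tend to \<open>c\<close> times the
    Lebesgue integral.\<close>
  moreover have "(\<lambda>n. of_real (sqrt (real (Suc n))) * (CLINT x|Q n. of_real (kern x) * iexp (\<theta> * x)))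
    \<longlonglongrightarrow> of_real c * I"
  proof -
    define F where "F n x = of_real (c * exp (- x\<^sup>2 / (2 * real (Suc n)))) * (of_real (kern x) * iexp (\<theta> * x))" for n x
    have eq: "of_real (sqrt (real (Suc n))) * (CLINT x|Q n. of_real (kern x) * iexp (\<theta> * x)) = (CLBINT x. F n x)" for n
    proof -
      have "(CLINT x|Q n. of_real (kern x) * iexp (\<theta> * x)) =
        (CLBINT x. normal_density 0 (sqrt (real (Suc n))) x *\<^sub>R (of_real (kern x) * iexp (\<theta> * x)))"
        unfolding Q_def by (subst integral_density) (auto simp: normal_density_nonneg)
      moreover have "c * exp (- x\<^sup>2 / (2 * real (Suc n))) =
          sqrt (real (Suc n)) * normal_density 0 (sqrt (real (Suc n))) x" for x
        by (simp add: normal_density_def c_def real_sqrt_mult del: of_nat_Suc)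
      ultimately show ?thesis
        unfolding F_def by (simp add: scaleR_conv_of_real mult.assoc del: of_nat_Suc flip: integral_mult_right_zero)
    qed
    have "(\<lambda>n. CLBINT x. F n x) \<longlonglongrightarrow> (CLBINT x. of_real c * (of_real (kern x) * iexp (\<theta> * x)))"
    proof (rule integral_dominated_convergence)
      show "integrable lborel (\<lambda>x. c * kern x)"
        by (intro integrable_mult_right integrable_kern)
      show "AE x in lborel. (\<lambda>n. F n x) \<longlonglongrightarrow> of_real c * (of_real (kern x) * iexp (\<theta> * x))"
      proof (rule AE_I2)
        fix x
        have "(\<lambda>n. c * exp (- x\<^sup>2 / (2 * real (Suc n)))) \<longlonglongrightarrow> c"
          by real_asymp
        then show "(\<lambda>n. F n x) \<longlonglongrightarrow> of_real c * (of_real (kern x) * iexp (\<theta> * x))"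
          unfolding F_def by (intro tendsto_mult tendsto_of_real tendsto_const)
      qed
      show "AE x in lborel. norm (F n x) \<le> c * kern x" for n
      proof (rule AE_I2)
        fix x
        have "c \<ge> 0"
          by (simp add: c_def)
        moreover have "exp (- x\<^sup>2 / (2 * real (Suc n))) \<le> 1"
          by simp
        ultimately have "c * exp (- x\<^sup>2 / (2 * real (Suc n))) * kern x \<le> c * 1 * kern x"
          using kern_nonneg[of x] by (intro mult_right_mono mult_left_mono) auto
        then show "norm (F n x) \<le> c * kern x"
          unfolding F_def norm_mult norm_of_real norm_exp_i_times using kern_nonneg[of x] \<open>c \<ge> 0\<close>
          by (simp add: abs_mult)
      qed
    qed (auto simp: F_def)
    then show ?thesis
      by (simp only: eq I_def integral_mult_right_zero)
  qed
  ultimately have "of_real c * I = kern_ft (- \<theta>) * of_real (sqrt (2 * pi))"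
    using LIMSEQ_unique by fastforce
  then have *: "of_real (sqrt (2 * pi)) * (of_real c * I) = of_real (sqrt (2 * pi) * sqrt (2 * pi)) * kern_ft (- \<theta>)"
    by (simp only: of_real_mult mult_ac)
  have "I = of_real (sqrt (2 * pi)) * (of_real c * I)"
    by (simp add: c_def)
  also note *
  also have "sqrt (2 * pi) * sqrt (2 * pi) = 2 * pi"
    by simp
  finally have "I = of_real (2 * pi) * kern_ft (- \<theta>)" .
  then show ?thesis
    unfolding I_def by (simp flip: of_real_mult)
qed


lemma isCont_fejer: "x \<noteq> 0 \<Longrightarrow> isCont fejer x"
proof -
  assume "x \<noteq> 0"
  then have "isCont (\<lambda>x. 2 * (1 - cos x) / x\<^sup>2) x"
    by (intro continuous_intros) auto
  moreover have "eventually (\<lambda>y. fejer y = 2 * (1 - cos y) / y\<^sup>2) (nhds x)"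
    using t1_space_nhds[OF \<open>x \<noteq> 0\<close>] by eventually_elim (simp add: fejer_def)
  ultimately show ?thesis
    by (simp add: isCont_cong)
qed

text \<open>Continuity is asserted off the two points where the case split of \<open>fejer\<close>
  intervenes; a finite exceptional set is harmless for weak convergence, being null for the limit
  law.\<close>

lemma isCont_kern: "x \<noteq> 0 \<Longrightarrow> x \<noteq> pi \<Longrightarrow> isCont kern x"
  unfolding kern_def
  by (intro continuous_intros isCont_o2[OF _ isCont_fejer] isCont_fejer) auto

lemma integral_kern: "(\<integral>x. kern x \<partial>lborel) = 4 * pi"
  using kern_fourier[of 0] by (simp add: kern_ft_0 integral_complex_of_real complex_eq_iff)

text \<open>Local limit theorem: by Levy's continuity theorem applied to the normalised measures
  \<open>kern \<cdot> Q n\<close>.\<close>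

theorem (in llt_char) local_limit:
  fixes Q :: "nat \<Rightarrow> real measure" and l :: "nat \<Rightarrow> nat" and f :: "real \<Rightarrow> real"
  assumes Q: "\<And>n. real_distribution (Q n)"
    and char: "\<And>n \<theta>. char (Q n) \<theta> = \<psi> \<theta> ^ l n * iexp (- \<zeta> n * \<theta>)"
    and l: "filterlim l at_top sequentially"
    and \<zeta>: "(\<lambda>n. \<zeta> n / sqrt (real (l n))) \<longlonglongrightarrow> \<rho>"
    and f [measurable]: "f \<in> borel_measurable borel"
    and fk: "\<And>x. \<bar>f x\<bar> \<le> C * kern x"
    and D: "finite D" "\<And>x. x \<notin> D \<Longrightarrow> isCont f x"
  shows "(\<lambda>n. sqrt (real (l n)) * (\<integral>x. f x \<partial>Q n))
    \<longlonglongrightarrow> exp (- \<rho>\<^sup>2 / (2 * \<sigma>\<^sup>2)) / (\<sigma> * sqrt (2 * pi)) * (\<integral>x. f x \<partial>lborel)"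
proof -
  define m where "m n = (\<integral>x. kern x \<partial>Q n)" for n
  define G where "G = sqrt (2 * pi) / \<sigma> * exp (- \<rho>\<^sup>2 / (2 * \<sigma>\<^sup>2))"
  have G0: "G > 0"
    using sigma_pos by (simp add: G_def)
  define P where "P n = density (Q n) (\<lambda>x. ennreal (kern x / m n))" for n
  define P' where "P' = density lborel (\<lambda>x. ennreal (kern x / (4 * pi)))"
  have setsQ [measurable_cong]: "sets (Q n) = sets borel" for n
    using Q[of n] by (simp add: real_distribution_def real_distribution_axioms_def)
  have intk: "integrable (Q n) kern" for n
  proof -
    interpret real_distribution "Q n" by (rule Q)
    show ?thesis
      by (rule integrable_const_bound[where B = 2])
         (auto simp: abs_of_nonneg[OF kern_nonneg] kern_le_2)
  qed
  have m: "m n > 0" for n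
  proof -
    interpret real_distribution "Q n" by (rule Q)
    have "m n \<noteq> 0"
    proof
      assume "m n = 0"
      then have "AE x in Q n. kern x = 0"
        using integral_nonneg_eq_0_iff_AE[OF intk[of n]] kern_nonneg by (simp add: m_def)
      then have "AE x in Q n. False"
        by eventually_elim (use kern_pos in \<open>simp add: less_imp_neq[symmetric]\<close>)
      then show False
        by simp
    qed
    moreover have "m n \<ge> 0"
      unfolding m_def by (intro Bochner_Integration.integral_nonneg kern_nonneg)
    ultimately show ?thesis
      by simp
  qed
  have intP: "(\<integral>x. g x \<partial>P n) = (\<integral>x. (kern x / m n) *\<^sub>R g x \<partial>Q n)"
    if [measurable]: "g \<in> borel_measurable borel" for g :: "real \<Rightarrow> 'c::{banach, second_countable_topology}" and n
    unfolding P_def using m[of n] kern_nonneg by (subst integral_density) auto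
  have intP': "(\<integral>x. g x \<partial>P') = (\<integral>x. (kern x / (4 * pi)) *\<^sub>R g x \<partial>lborel)"
    if [measurable]: "g \<in> borel_measurable borel" for g :: "real \<Rightarrow> 'c::{banach, second_countable_topology}"
    unfolding P'_def using kern_nonneg by (subst integral_density) auto
  have Pr: "real_distribution (P n)" for n
  proof -
    have "emeasure (P n) (space (P n)) = (\<integral>\<^sup>+x. ennreal (kern x / m n) \<partial>Q n)"
      unfolding P_def by (subst emeasure_density) (auto intro!: nn_integral_cong)
    also have "\<dots> = ennreal (\<integral>x. kern x / m n \<partial>Q n)"
      using m[of n] kern_nonneg intk[of n] by (intro nn_integral_eq_integral) auto
    also have "\<dots> = 1"
      using m[of n] by (simp add: m_def)
    finally show ?thesis
      unfolding real_distribution_def real_distribution_axioms_def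
      by (auto intro!: prob_spaceI simp: P_def setsQ)
  qed
  have Pr': "real_distribution P'"
  proof -
    have "emeasure P' (space P') = (\<integral>\<^sup>+x. ennreal (kern x / (4 * pi)) \<partial>lborel)"
      unfolding P'_def by (subst emeasure_density) (auto intro!: nn_integral_cong)
    also have "\<dots> = ennreal (\<integral>x. kern x / (4 * pi) \<partial>lborel)"
      using kern_nonneg integrable_kern by (intro nn_integral_eq_integral) auto
    also have "\<dots> = 1"
      by (simp add: integral_kern)
    finally show ?thesis
      unfolding real_distribution_def real_distribution_axioms_def
      by (auto intro!: prob_spaceI simp: P'_def)
  qed
  have lim: "(\<lambda>n. of_real (sqrt (real (l n))) * (CLINT x|Q n. of_real (kern x) * iexp (\<theta> * x)))
    \<longlonglongrightarrow> kern_ft (- \<theta>) * of_real G" for \<theta>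
    unfolding G_def by (rule kern_limit[OF Q char l \<zeta>])
  \<comment> \<open>The frequency 0 gives the asymptotics of the normalising mass, with the factor
    \<open>kern_ft 0 = 2\<close>.\<close>
  have lim0: "(\<lambda>n. sqrt (real (l n)) * m n) \<longlonglongrightarrow> 2 * G"
  proof -
    have "(\<lambda>n. complex_of_real (sqrt (real (l n)) * m n)) \<longlonglongrightarrow> complex_of_real (2 * G)"
      using lim[of 0] by (simp add: m_def kern_ft_0 integral_complex_of_real)
    from tendsto_Re[OF this] show ?thesis
      by simp
  qed
  have "weak_conv_m P P'"
  proof (rule levy_continuity[OF Pr Pr'])
    fix \<theta>
    have "char (P n) \<theta> = (CLINT x|Q n. of_real (kern x) * iexp (\<theta> * x)) / of_real (m n)" for n
      unfolding char_def integral_divide_zero[symmetric]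
      by (subst intP) (auto simp: scaleR_conv_of_real)
    moreover have "(\<lambda>n. (of_real (sqrt (real (l n))) * (CLINT x|Q n. of_real (kern x) * iexp (\<theta> * x))) / of_real (sqrt (real (l n)) * m n))
      \<longlonglongrightarrow> kern_ft (- \<theta>) * of_real G / of_real (2 * G)"
      using G0 by (intro tendsto_divide lim tendsto_of_real lim0) auto
    moreover have "eventually (\<lambda>n. 0 < l n) sequentially"
      using l unfolding filterlim_at_top by (auto dest!: spec[of _ 1] elim!: eventually_mono)
    ultimately have "(\<lambda>n. char (P n) \<theta>) \<longlonglongrightarrow> kern_ft (- \<theta>) * of_real G / of_real (2 * G)"
      by (auto elim!: Lim_transform_eventually eventually_mono)
    also have "kern_ft (- \<theta>) * of_real G / of_real (2 * G) = char P' \<theta>"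
    proof -
      have "char P' \<theta> = (CLBINT x. of_real (kern x) * iexp (\<theta> * x)) / of_real (4 * pi)"
        unfolding char_def integral_divide_zero[symmetric]
        by (subst intP') (auto simp: scaleR_conv_of_real)
      then show ?thesis
        unfolding kern_fourier using G0 by simp
    qed
    finally show "(\<lambda>n. char (P n) \<theta>) \<longlonglongrightarrow> char P' \<theta>" .
  qed
  \<comment> \<open>\<open>f / kern\<close> is bounded by \<open>C\<close> and continuous off a
    finite set, hence an admissible test function for weak convergence.\<close>
  have "(\<lambda>n. \<integral>x. f x / kern x \<partial>P n) \<longlonglongrightarrow> (\<integral>x. f x / kern x \<partial>P')"
  proof (rule weak_conv_imp_bdd_ae_continuous_conv[OF Pr Pr' \<open>weak_conv_m P P'\<close>])
    have "{x. \<not> isCont (\<lambda>x. f x / kern x) x} \<subseteq> D \<union> {0, pi}"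
      using D(2) isCont_kern kern_pos by (auto intro!: continuous_intros simp: less_imp_neq[symmetric])
    then have "finite {x. \<not> isCont (\<lambda>x. f x / kern x) x}"
      using D(1) by (auto intro: finite_subset)
    then have "{x. \<not> isCont (\<lambda>x. f x / kern x) x} \<in> null_sets lborel"
      by (rule finite_imp_null_set_lborel)
    then have "{x. \<not> isCont (\<lambda>x. f x / kern x) x} \<in> null_sets P'"
      unfolding P'_def
      by (auto simp: null_sets_density_iff dest!: AE_not_in elim!: eventually_mono)
    then show "emeasure P' {x. \<not> isCont (\<lambda>x. f x / kern x) x} = 0"
      by auto
    show "norm (f x / kern x) \<le> C" for x
      using fk[of x] kern_pos[of x] by (simp add: field_simps abs_of_pos)
  qed measurable
  moreover have "(\<integral>x. f x / kern x \<partial>P n) = (\<integral>x. f x \<partial>Q n) / m n" for n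
    unfolding integral_divide_zero[symmetric]
    by (subst intP) (auto simp: less_imp_neq[OF kern_pos, symmetric] intro!: Bochner_Integration.integral_cong)
  moreover have "(\<integral>x. f x / kern x \<partial>P') = (\<integral>x. f x \<partial>lborel) / (4 * pi)"
    unfolding integral_divide_zero[symmetric]
    by (subst intP') (auto simp: less_imp_neq[OF kern_pos, symmetric] intro!: Bochner_Integration.integral_cong)
  ultimately have "(\<lambda>n. (\<integral>x. f x \<partial>Q n) / m n) \<longlonglongrightarrow> (\<integral>x. f x \<partial>lborel) / (4 * pi)"
    by simp
  \<comment> \<open>Multiplying by the asymptotics of the mass undoes the normalisation.\<close>
  from tendsto_mult[OF lim0 this] have "(\<lambda>n. sqrt (real (l n)) * (\<integral>x. f x \<partial>Q n))
    \<longlonglongrightarrow> 2 * G * ((\<integral>x. f x \<partial>lborel) / (4 * pi))"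
    using m by (simp add: less_imp_neq[symmetric])
  also have "2 * G * ((\<integral>x. f x \<partial>lborel) / (4 * pi)) =
    exp (- \<rho>\<^sup>2 / (2 * \<sigma>\<^sup>2)) / (\<sigma> * sqrt (2 * pi)) * (\<integral>x. f x \<partial>lborel)"
  proof -
    define r where "r = sqrt (2 * pi)"
    have r: "r > 0" "2 * pi = r * r"
      by (auto simp: r_def)
    have "4 * pi = 2 * (r * r)"
      using r(2) by simp
    then show ?thesis
      using r sigma_pos by (simp add: G_def flip: r_def) (simp add: field_simps)
  qed
  finally show ?thesis .
qed

section \<open>Characteristic functions of non-lattice laws\<close>

lemma (in real_distribution) cmod_char_eq_1_imp_lattice:
  assumes \<theta>: "\<theta> \<noteq> 0" and n: "norm (char M \<theta>) = 1"
  shows "\<exists>a>0. \<exists>b. AE x in M. \<exists>z::int. x = a * real_of_int z + b"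
proof -
  obtain \<alpha> where \<alpha>: "char M \<theta> = iexp \<alpha>"
    using complex_norm_eq_1_exp[THEN iffD1, OF n] by metis
  have int: "integrable M (\<lambda>x. iexp (\<theta> * x - \<alpha>))" for \<alpha>
    by (intro integrable_iexp) auto
  have "(CLINT x|M. iexp (\<theta> * x - \<alpha>)) = (CLINT x|M. iexp (\<theta> * x) * iexp (- \<alpha>))"
    by (simp add: diff_conv_add_uminus distrib_left exp_add del: add_uminus_conv_diff)
  also have "\<dots> = iexp \<alpha> * iexp (- \<alpha>)"
    by (simp only: integral_mult_left_zero \<alpha>[symmetric] char_def)
  also have "\<dots> = 1"
    by (simp flip: exp_add)
  finally have "Re (CLINT x|M. iexp (\<theta> * x - \<alpha>)) = 1"
    by simp
  \<comment> \<open>After rotation by the phase \<alpha>, a variable bounded by 1 has mean 1; so the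
    cosine is 1 almost surely and \<open>\<theta> * x - \<alpha>\<close> is a multiple of 2
    pi.\<close>
  then have "(\<integral>x. cos (\<theta> * x - \<alpha>) \<partial>M) = 1"
    unfolding integral_Re[OF int, symmetric] by (simp add: Re_exp)
  moreover have icos: "integrable M (\<lambda>x. cos (\<theta> * x - \<alpha>))"
    by (rule integrable_const_bound[where B = 1]) auto
  ultimately have "(\<integral>x. 1 - cos (\<theta> * x - \<alpha>) \<partial>M) = 0"
    by (simp add: prob_space[unfolded space_eq_univ])
  then have "AE x in M. 1 - cos (\<theta> * x - \<alpha>) = 0"
    using icos by (subst (asm) integral_nonneg_eq_0_iff_AE) auto
  then have "AE x in M. \<exists>z::int. x = (2 * pi / \<bar>\<theta>\<bar>) * real_of_int z + \<alpha> / \<theta>"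
  proof eventually_elim
    case (elim x)
    then obtain k :: int where k: "\<theta> * x - \<alpha> = 2 * pi * k"
      using cos_one_2pi_int[of "\<theta> * x - \<alpha>"] by (auto simp: mult_ac)
    then have "x = (2 * pi / \<bar>\<theta>\<bar>) * real_of_int (if \<theta> > 0 then k else - k) + \<alpha> / \<theta>"
      using \<theta> by (auto simp: field_simps)
    then show ?case
      by blast
  qed
  moreover have "2 * pi / \<bar>\<theta>\<bar> > 0"
    using \<theta> by simp
  ultimately show ?thesis
    by blast
qed

text \<open>Near 0 the third absolute moment controls the second-order expansion, which yields both
  the central limit scaling and the bound
  \<open>exp (- (\<sigma>\<^sup>2 / 4) * \<theta>\<^sup>2)\<close>. On the rest of a bounded range
  the modulus is continuous and below 1, as equality would make the law lattice, and compactness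
  gives a factor \<open>q < 1\<close>.\<close>

lemma (in real_distribution) llt_char_char:
  assumes nonlattice: "\<not> (\<exists>a>0. \<exists>b. AE x in M. \<exists>z::int. x = a * real_of_int z + b)"
    and i1: "integrable M (\<lambda>x. x)" and m1: "expectation (\<lambda>x. x) = 0"
    and i2: "integrable M (\<lambda>x. x\<^sup>2)" and m2: "expectation (\<lambda>x. x\<^sup>2) = \<sigma>\<^sup>2"
    and i3: "integrable M (\<lambda>x. \<bar>x\<bar> ^ 3)" and \<sigma>: "0 < \<sigma>"
  shows "llt_char (char M) \<sigma>"
proof
  define K where "K = expectation (\<lambda>x. \<bar>x\<bar> ^ 3) / 6"
  have K: "K \<ge> 0"
    by (auto simp: K_def intro!: Bochner_Integration.integral_nonneg)
  have approx: "norm (char M \<theta> - of_real (1 - \<theta>\<^sup>2 * \<sigma>\<^sup>2 / 2)) \<le> K * \<bar>\<theta>\<bar> ^ 3" for \<theta>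
  proof -
    have "norm (char M \<theta> - (1 - \<theta>\<^sup>2 * \<sigma>\<^sup>2 / 2)) \<le>
        (\<theta>\<^sup>2 / 6) * expectation (\<lambda>x. min (6 * x\<^sup>2) (\<bar>\<theta>\<bar> * \<bar>x\<bar> ^ 3))"
      using m1 m2 by (intro char_approx3 i1 m1 i2) simp
    also have "\<dots> \<le> (\<theta>\<^sup>2 / 6) * expectation (\<lambda>x. \<bar>\<theta>\<bar> * \<bar>x\<bar> ^ 3)"
      using i2 i3 by (intro mult_left_mono integral_mono) auto
    also have "\<dots> = K * \<bar>\<theta>\<bar> ^ 3"
    proof -
      have "\<bar>\<theta>\<bar> ^ 3 = \<theta>\<^sup>2 * \<bar>\<theta>\<bar>"
        by (simp add: power3_eq_cube power2_eq_square)
      then show ?thesis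
        by (simp add: K_def)
    qed
    finally show ?thesis
      by simp
  qed
  show "0 < \<sigma>" by fact
  show "char M \<in> borel_measurable borel" by simp
  show "(\<lambda>n. char M (s / sqrt (real n)) ^ n) \<longlonglongrightarrow> exp (- of_real (\<sigma>\<^sup>2 * s\<^sup>2 / 2))" for s
  proof -
    define w where "w n = 1 + (- (\<sigma>\<^sup>2 * s\<^sup>2 / 2)) / real n" for n
    have "(\<lambda>n. w n ^ n) \<longlonglongrightarrow> exp (- (\<sigma>\<^sup>2 * s\<^sup>2 / 2))"
      unfolding w_def by (rule tendsto_exp_limit_sequentially)
    then have 1: "(\<lambda>n. complex_of_real (w n) ^ n) \<longlonglongrightarrow> exp (- of_real (\<sigma>\<^sup>2 * s\<^sup>2 / 2))"
      by (simp only: of_real_power[symmetric] of_real_minus[symmetric] exp_of_real tendsto_of_real_iff)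
    \<comment> \<open>For numbers of modulus at most 1, the n-th powers differ by at most n times
      the difference of the bases, which is here of order n^(-3/2).\<close>
    have "(\<lambda>n. char M (s / sqrt (real n)) ^ n - complex_of_real (w n) ^ n) \<longlonglongrightarrow> 0"
    proof (rule Lim_null_comparison)
      have "w \<longlonglongrightarrow> 1"
        unfolding w_def by real_asymp
      then have "eventually (\<lambda>n. w n > 0) sequentially"
        by (rule order_tendstoD) simp
      then show "eventually (\<lambda>n. norm (char M (s / sqrt (real n)) ^ n - complex_of_real (w n) ^ n)
          \<le> real n * (K * \<bar>s / sqrt (real n)\<bar> ^ 3)) sequentially"
        using eventually_gt_at_top[of 0]
      proof eventually_elim
        case (elim n)
        have "\<bar>w n\<bar> \<le> 1"
          using elim by (auto simp: w_def)
        then have "norm (char M (s / sqrt (real n)) ^ n - complex_of_real (w n) ^ n)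
          \<le> n * norm (char M (s / sqrt (real n)) - complex_of_real (w n))"
          by (intro norm_power_diff cmod_char_le_1) simp
        also have "\<dots> \<le> real n * (K * \<bar>s / sqrt (real n)\<bar> ^ 3)"
        proof (rule mult_left_mono)
          have "w n = 1 - (s / sqrt (real n))\<^sup>2 * \<sigma>\<^sup>2 / 2"
            using elim by (simp add: w_def power_divide mult_ac)
          then show "norm (char M (s / sqrt (real n)) - complex_of_real (w n)) \<le> K * \<bar>s / sqrt (real n)\<bar> ^ 3"
            using approx[of "s / sqrt (real n)"] by simp
        qed simp
        finally show ?case .
      qed
      have "(\<lambda>n. 1 / sqrt (real n)) \<longlonglongrightarrow> 0"
        by real_asymp
      then have "(\<lambda>n. K * \<bar>s\<bar> ^ 3 * (1 / sqrt (real n))) \<longlonglongrightarrow> 0"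
        by (rule tendsto_mult_right_zero)
      moreover have "K * \<bar>s\<bar> ^ 3 * (1 / sqrt (real n)) = real n * (K * \<bar>s / sqrt (real n)\<bar> ^ 3)" for n
        by (cases "n = 0") (simp_all add: power3_eq_cube abs_mult field_simps)
      ultimately show "(\<lambda>n. real n * (K * \<bar>s / sqrt (real n)\<bar> ^ 3)) \<longlonglongrightarrow> 0"
        by simp
    qed
    from tendsto_add[OF this 1] show ?thesis
      by simp
  qed
  show "\<exists>c>0. \<forall>\<theta>. \<bar>\<theta>\<bar> \<le> A \<longrightarrow> norm (char M \<theta>) \<le> exp (- c * \<theta>\<^sup>2)" for A
  proof -
    \<comment> \<open>The first bound makes the cubic error at most half of the quadratic term, the
      second keeps \<open>1 - \<theta>\<^sup>2 * \<sigma>\<^sup>2 / 2\<close> nonnegative;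
      \<open>K + 1\<close> avoids division by 0.\<close>
    define \<delta> where "\<delta> = min (\<sigma>\<^sup>2 / (4 * (K + 1))) (1 / \<sigma>)"
    have \<delta>: "0 < \<delta>" "\<delta> \<le> \<sigma>\<^sup>2 / (4 * (K + 1))" "\<delta> \<le> 1 / \<sigma>"
      using \<sigma> K by (auto simp: \<delta>_def)
    have near: "norm (char M \<theta>) \<le> exp (- (\<sigma>\<^sup>2 / 4) * \<theta>\<^sup>2)" if "\<bar>\<theta>\<bar> \<le> \<delta>" for \<theta>
    proof -
      have "\<bar>\<theta>\<bar> * \<sigma> \<le> 1 / \<sigma> * \<sigma>"
        using that \<delta>(3) \<sigma> by (intro mult_right_mono) auto
      then have "\<bar>\<theta>\<bar> * \<sigma> \<le> 1"
        using \<sigma> by simp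
      then have "\<theta>\<^sup>2 * \<sigma>\<^sup>2 \<le> 1"
        using \<sigma> power_mono[of "\<bar>\<theta>\<bar> * \<sigma>" 1 2] by (simp add: power_mult_distrib)
      then have "norm (complex_of_real (1 - \<theta>\<^sup>2 * \<sigma>\<^sup>2 / 2)) = 1 - \<theta>\<^sup>2 * \<sigma>\<^sup>2 / 2"
        unfolding norm_of_real by simp
      then have "norm (char M \<theta>) \<le> 1 - \<theta>\<^sup>2 * \<sigma>\<^sup>2 / 2 + K * \<bar>\<theta>\<bar> ^ 3"
        using approx[of \<theta>] norm_triangle_sub[of "char M \<theta>" "of_real (1 - \<theta>\<^sup>2 * \<sigma>\<^sup>2 / 2)"] by linarith
      also have "K * \<bar>\<theta>\<bar> ^ 3 \<le> \<theta>\<^sup>2 * \<sigma>\<^sup>2 / 4"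
      proof -
        have "(K + 1) * \<bar>\<theta>\<bar> \<le> (K + 1) * (\<sigma>\<^sup>2 / (4 * (K + 1)))"
          using that \<delta>(2) K by (intro mult_left_mono) auto
        moreover have "k * (\<sigma>\<^sup>2 / (4 * k)) = \<sigma>\<^sup>2 / 4" if "k \<noteq> 0" for k :: real
          using that by simp
        from this[of "K + 1"] have "(K + 1) * (\<sigma>\<^sup>2 / (4 * (K + 1))) = \<sigma>\<^sup>2 / 4"
          using K by linarith
        ultimately have "(K + 1) * \<bar>\<theta>\<bar> \<le> \<sigma>\<^sup>2 / 4"
          by (rule ord_le_eq_trans)
        then have "K * \<bar>\<theta>\<bar> \<le> \<sigma>\<^sup>2 / 4"
          by (simp add: distrib_right)
        then have "K * \<bar>\<theta>\<bar> * \<theta>\<^sup>2 \<le> \<sigma>\<^sup>2 / 4 * \<theta>\<^sup>2"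
          by (rule mult_right_mono) simp
        then show ?thesis
          by (simp add: power3_eq_cube power2_eq_square mult_ac)
      qed
      also have "1 - \<theta>\<^sup>2 * \<sigma>\<^sup>2 / 2 + \<theta>\<^sup>2 * \<sigma>\<^sup>2 / 4 = 1 + (- (\<sigma>\<^sup>2 / 4) * \<theta>\<^sup>2)"
        by simp
      also have "\<dots> \<le> exp (- (\<sigma>\<^sup>2 / 4) * \<theta>\<^sup>2)"
        by (rule exp_ge_add_one_self)
      finally show ?thesis by simp
    qed
    have lt1: "norm (char M \<theta>) < 1" if "\<theta> \<noteq> 0" for \<theta>
      using cmod_char_eq_1_imp_lattice[OF that] nonlattice cmod_char_le_1[of \<theta>] by fastforce
    define I where "I = {\<theta>. \<delta> \<le> \<bar>\<theta>\<bar> \<and> \<bar>\<theta>\<bar> \<le> A}"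
    obtain q where q: "0 < q" "q < 1" and qb: "\<And>\<theta>. \<theta> \<in> I \<Longrightarrow> norm (char M \<theta>) \<le> q"
    proof (cases "I = {}")
      case True
      then show ?thesis
        using that[of "1/2"] by auto
    next
      case False
      have "I = {-A..A} \<inter> {\<theta>. \<delta> \<le> \<bar>\<theta>\<bar>}"
        by (auto simp: I_def)
      moreover have "closed {\<theta>::real. \<delta> \<le> \<bar>\<theta>\<bar>}"
        by (intro closed_Collect_le continuous_intros)
      ultimately have "compact I"
        by auto
      moreover have "continuous_on I (\<lambda>\<theta>. norm (char M \<theta>))"
        by (intro continuous_intros continuous_at_imp_continuous_on ballI isCont_char)
      ultimately obtain \<theta>0 where \<theta>0: "\<theta>0 \<in> I" "\<And>\<theta>. \<theta> \<in> I \<Longrightarrow> norm (char M \<theta>) \<le> norm (char M \<theta>0)"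
        using continuous_attains_sup[of I] False by blast
      have "\<theta>0 \<noteq> 0"
        using \<theta>0(1) \<delta>(1) by (auto simp: I_def)
      from lt1[OF this] \<theta>0(2) show ?thesis
        by (intro that[of "max (norm (char M \<theta>0)) (1/2)"]) (auto simp: le_max_iff_disj)
    qed
    \<comment> \<open>The second term ensures \<open>q \<le> exp (- c * \<theta>\<^sup>2)\<close>
      for \<open>\<bar>\<theta>\<bar> \<le> A\<close>; its logarithm is the reason for requiring
      \<open>0 < q\<close>.\<close>
    define c where "c = min (\<sigma>\<^sup>2 / 4) (- ln q / (A\<^sup>2 + 1))"
    have c_le: "c \<le> \<sigma>\<^sup>2 / 4" "c \<le> - ln q / (A\<^sup>2 + 1)"
      unfolding c_def by (rule min.cobounded1 min.cobounded2)+
    have A: "0 < A\<^sup>2 + 1"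
      by (simp add: add_nonneg_pos)
    have "c > 0"
      using q \<sigma> A by (auto simp: c_def intro!: divide_neg_pos)
    moreover have "norm (char M \<theta>) \<le> exp (- c * \<theta>\<^sup>2)" if "\<bar>\<theta>\<bar> \<le> A" for \<theta>
    proof (cases "\<bar>\<theta>\<bar> \<le> \<delta>")
      case True
      have "c * \<theta>\<^sup>2 \<le> \<sigma>\<^sup>2 / 4 * \<theta>\<^sup>2"
        by (intro mult_right_mono c_le) simp
      then show ?thesis
        using near[OF True] by (elim order_trans) simp
    next
      case False
      then have "norm (char M \<theta>) \<le> q"
        using qb[of \<theta>] that by (simp add: I_def)
      also have "q = exp (ln q)"
        using q by simp
      also have "exp (ln q) \<le> exp (- c * \<theta>\<^sup>2)"
      proof -
        have "\<theta>\<^sup>2 \<le> A\<^sup>2"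
          using that abs_le_square_iff[of \<theta> A] by auto
        then have "c * \<theta>\<^sup>2 \<le> c * (A\<^sup>2 + 1)"
          using \<open>c > 0\<close> by (intro mult_left_mono) auto
        also have "\<dots> \<le> (- ln q / (A\<^sup>2 + 1)) * (A\<^sup>2 + 1)"
          using A by (intro mult_right_mono c_le) simp
        also have "\<dots> = - ln q"
          using A by simp
        finally show ?thesis
          by simp
      qed
      finally show ?thesis .
    qed
    ultimately show ?thesis
      by blast
  qed
qed

section \<open>Exponential tilting\<close>

text \<open>A single term of the exponential series is at most its sum; the two exponentials on the
  right replace the absolute value in the exponent.\<close>

lemma abs_power_le_exp:
  fixes x :: real
  assumes "0 < \<delta>"
  shows "\<bar>x\<bar> ^ k \<le> fact k / \<delta> ^ k * (exp (\<delta> * x) + exp (- \<delta> * x))"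
proof -
  have "(\<delta> * \<bar>x\<bar>) ^ k / fact k \<le> exp (\<delta> * \<bar>x\<bar>)"
    using sum_le_suminf[OF summable_exp_generic[of "\<delta> * \<bar>x\<bar>"], of "{k}"] assms
    by (simp add: exp_def scaleR_conv_of_real divide_inverse mult.commute)
  also have "\<dots> \<le> exp (\<delta> * x) + exp (- \<delta> * x)"
    by (cases "x \<ge> 0") auto
  finally have "(\<delta> * \<bar>x\<bar>) ^ k \<le> fact k * (exp (\<delta> * x) + exp (- \<delta> * x))"
    by (simp add: field_simps)
  then show ?thesis
    using assms by (simp add: power_mult_distrib field_simps)
qed

text \<open>Lagrange remainder of order 2; the symmetric factor bounds the exponential at the
  unknown intermediate point, whatever the sign of \<open>y\<close>.\<close>

lemma exp_remainder_bound:
  fixes y :: real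
  shows "\<bar>exp y - 1 - y\<bar> \<le> y\<^sup>2 * (exp y + exp (- y))"
proof -
  obtain t where t: "\<bar>t\<bar> \<le> \<bar>y\<bar>" "exp y = (\<Sum>m<2. y ^ m / fact m) + exp t / fact 2 * y ^ 2"
    using Maclaurin_exp_le[of y 2] by auto
  have "exp t \<le> exp \<bar>y\<bar>"
    using t(1) by simp
  also have "\<dots> \<le> exp y + exp (- y)"
    by (cases "y \<ge> 0") auto
  finally have "exp t * y\<^sup>2 \<le> (exp y + exp (- y)) * y\<^sup>2"
    by (rule mult_right_mono) simp
  moreover have "\<bar>exp y - 1 - y\<bar> = exp t / 2 * y\<^sup>2"
    using t(2) by (simp add: numeral_2_eq_2 abs_mult)
  moreover have "0 \<le> exp t * y\<^sup>2"
    by simp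
  ultimately show ?thesis
    by (simp only: mult.commute[of "y\<^sup>2"])
qed

text \<open>\<open>t\<close> is the fixed tilting parameter. Exponential moments enter for
  nonnegative parameters, so derivatives of the cumulant function are taken at
  \<open>s > 0\<close>.\<close>

locale iid_walk = prob_space M for M :: "'a measure" +
  fixes X :: "nat \<Rightarrow> 'a \<Rightarrow> real" and t :: real
  assumes rv [measurable]: "\<And>k. X k \<in> borel_measurable M"
    and indep: "indep_vars (\<lambda>_. borel) X UNIV"
    and ident: "\<And>k. distr M borel (X k) = distr M borel (X 0)"
    and nonlattice: "\<not> (\<exists>a>0. \<exists>b. AE \<omega> in M. \<exists>z::int. X 0 \<omega> = a * real_of_int z + b)"
    and t_pos: "0 < t"
    and mgf: "\<And>s. 0 \<le> s \<Longrightarrow> integrable M (\<lambda>\<omega>. exp (s * X 0 \<omega>))"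
begin

abbreviation \<phi> where "\<phi> \<equiv> cgf M (X 0)"

lemma integrable_ident:
  fixes f :: "real \<Rightarrow> 'c::{banach, second_countable_topology}"
  assumes [measurable]: "f \<in> borel_measurable borel"
  shows "integrable M (\<lambda>\<omega>. f (X k \<omega>)) \<longleftrightarrow> integrable M (\<lambda>\<omega>. f (X 0 \<omega>))"
  using integrable_distr_eq[of "X k" M borel f] integrable_distr_eq[of "X 0" M borel f] ident[of k]
  by simp

lemma expectation_ident:
  fixes f :: "real \<Rightarrow> 'c::{banach, second_countable_topology}"
  assumes [measurable]: "f \<in> borel_measurable borel"
  shows "(\<integral>\<omega>. f (X k \<omega>) \<partial>M) = (\<integral>\<omega>. f (X 0 \<omega>) \<partial>M)"
  using integral_distr[of "X k" M borel f] integral_distr[of "X 0" M borel f] ident[of k]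
  by simp

text \<open>The k-th derivative of the moment generating function, written as an integral.\<close>

definition mom :: "nat \<Rightarrow> real \<Rightarrow> real" where
  "mom k s = (\<integral>\<omega>. X 0 \<omega> ^ k * exp (s * X 0 \<omega>) \<partial>M)"

lemma not_AE_const: "\<not> (AE \<omega> in M. X 0 \<omega> = c)"
proof
  assume "AE \<omega> in M. X 0 \<omega> = c"
  then have "AE \<omega> in M. \<exists>z::int. X 0 \<omega> = 1 * real_of_int z + c"
    by eventually_elim (auto intro: exI[of _ 0])
  with nonlattice show False
    by (metis zero_less_one)
qed

lemma mom_0_pos:
  assumes "0 \<le> s" shows "0 < mom 0 s"
proof -
  have "mom 0 s \<noteq> 0"
  proof
    assume "mom 0 s = 0"
    then have "AE \<omega> in M. exp (s * X 0 \<omega>) = 0"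
      using integral_nonneg_eq_0_iff_AE[OF mgf[OF assms]] by (simp add: mom_def)
    then show False
      by simp
  qed
  moreover have "mom 0 s \<ge> 0"
    by (auto simp: mom_def intro!: Bochner_Integration.integral_nonneg)
  ultimately show ?thesis
    by simp
qed

lemma exp_cgf: "0 \<le> s \<Longrightarrow> exp (\<phi> s) = mom 0 s"
  using mom_0_pos[of s] by (simp add: cgf_def mom_def)

lemma integrable_exp_X: "0 \<le> s \<Longrightarrow> integrable M (\<lambda>\<omega>. exp (s * X k \<omega>))"
  using integrable_ident[of "\<lambda>x. exp (s * x)"] mgf by simp

lemma expectation_exp_X: "0 \<le> s \<Longrightarrow> (\<integral>\<omega>. exp (s * X k \<omega>) \<partial>M) = exp (\<phi> s)"
  using expectation_ident[of "\<lambda>x. exp (s * x)"] by (simp add: exp_cgf mom_def)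

text \<open>Applying the exponential bound with parameter \<open>s\<close> itself leaves the
  exponents 2 s and 0, both nonnegative.\<close>

lemma integrable_abs_power_exp:
  assumes "0 < s"
  shows "integrable M (\<lambda>\<omega>. \<bar>X 0 \<omega>\<bar> ^ k * exp (s * X 0 \<omega>))"
proof (rule Bochner_Integration.integrable_bound)
  define C where "C = fact k / s ^ k"
  have C: "C > 0" using assms by (simp add: C_def)
  show "integrable M (\<lambda>\<omega>. C * (exp (2 * s * X 0 \<omega>) + 1))"
    using mgf[of "2 * s"] assms by (intro integrable_mult_right Bochner_Integration.integrable_add) auto
  show "AE \<omega> in M. norm (\<bar>X 0 \<omega>\<bar> ^ k * exp (s * X 0 \<omega>)) \<le> norm (C * (exp (2 * s * X 0 \<omega>) + 1))"
  proof (rule AE_I2)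
    fix \<omega>
    have "\<bar>X 0 \<omega>\<bar> ^ k * exp (s * X 0 \<omega>) \<le> C * (exp (s * X 0 \<omega>) + exp (- s * X 0 \<omega>)) * exp (s * X 0 \<omega>)"
      using abs_power_le_exp[OF assms, of "X 0 \<omega>" k] by (intro mult_right_mono) (auto simp: C_def)
    also have "\<dots> = C * (exp (2 * s * X 0 \<omega>) + 1)"
      by (simp add: distrib_right mult.assoc flip: exp_add)
    finally show "norm (\<bar>X 0 \<omega>\<bar> ^ k * exp (s * X 0 \<omega>)) \<le> norm (C * (exp (2 * s * X 0 \<omega>) + 1))"
      using C by (simp add: abs_mult)
  qed
qed measurable

lemma integrable_power_exp:
  assumes "0 < s"
  shows "integrable M (\<lambda>\<omega>. X 0 \<omega> ^ k * exp (s * X 0 \<omega>))"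
  by (rule Bochner_Integration.integrable_bound[OF integrable_abs_power_exp[OF assms, of k]])
     (auto simp: abs_mult power_abs)

text \<open>The second-order remainder of \<open>exp (h * X 0 \<omega>)\<close>, integrated against
  the weight, is at most \<open>h\<^sup>2\<close> times a constant uniform in
  \<open>\<bar>h\<bar> \<le> s / 2\<close>; on this range the exponents stay between s / 2 and 3 s /
  2, hence positive.\<close>

lemma DERIV_mom:
  assumes s: "0 < s"
  shows "(mom k has_field_derivative mom (Suc k) s) (at s)"
proof -
  define W where "W h \<omega> = \<bar>X 0 \<omega>\<bar> ^ (k + 2) * (exp ((s + h) * X 0 \<omega>) + exp ((s - h) * X 0 \<omega>))" for h \<omega>
  define C where "C = (\<integral>\<omega>. W (s / 2) \<omega> \<partial>M)"
  have intW: "integrable M (W h)" if "\<bar>h\<bar> < s" for h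
  proof -
    have "W h = (\<lambda>\<omega>. \<bar>X 0 \<omega>\<bar> ^ (k + 2) * exp ((s + h) * X 0 \<omega>) + \<bar>X 0 \<omega>\<bar> ^ (k + 2) * exp ((s - h) * X 0 \<omega>))"
      by (auto simp: W_def fun_eq_iff algebra_simps)
    then show ?thesis
      using that by (simp only:) (intro Bochner_Integration.integrable_add integrable_abs_power_exp; linarith)
  qed
  have bound: "\<bar>mom k (s + h) - mom k s - h * mom (Suc k) s\<bar> \<le> h\<^sup>2 * C" if h: "\<bar>h\<bar> \<le> s / 2" for h
  proof -
    let ?r = "\<lambda>\<omega>. X 0 \<omega> ^ k * exp ((s + h) * X 0 \<omega>) - X 0 \<omega> ^ k * exp (s * X 0 \<omega>) - h * (X 0 \<omega> ^ Suc k * exp (s * X 0 \<omega>))"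
    have int: "integrable M (\<lambda>\<omega>. X 0 \<omega> ^ k * exp ((s + h) * X 0 \<omega>))"
      "integrable M (\<lambda>\<omega>. X 0 \<omega> ^ k * exp (s * X 0 \<omega>))"
      "integrable M (\<lambda>\<omega>. X 0 \<omega> ^ Suc k * exp (s * X 0 \<omega>))"
      using s h by (auto intro!: integrable_power_exp simp del: power_Suc)
    have hb: "has_bochner_integral M ?r (mom k (s + h) - mom k s - h * mom (Suc k) s)"
      unfolding mom_def
      by (intro has_bochner_integral_diff has_bochner_integral_mult_right has_bochner_integral_integrable int)
    have "\<bar>mom k (s + h) - mom k s - h * mom (Suc k) s\<bar> \<le> (\<integral>\<omega>. \<bar>?r \<omega>\<bar> \<partial>M)"
      unfolding has_bochner_integral_integral_eq[OF hb, symmetric] by (rule integral_abs_bound)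
    also have "\<dots> \<le> (\<integral>\<omega>. h\<^sup>2 * W (s / 2) \<omega> \<partial>M)"
    proof (rule integral_mono)
      show "integrable M (\<lambda>\<omega>. \<bar>?r \<omega>\<bar>)"
        by (rule integrable_abs[OF has_bochner_integral_iff[THEN iffD1, OF hb, THEN conjunct1]])
      show "integrable M (\<lambda>\<omega>. h\<^sup>2 * W (s / 2) \<omega>)"
        using s by (intro integrable_mult_right intW) auto
      fix \<omega>
      let ?x = "X 0 \<omega>"
      have "?r \<omega> = ?x ^ k * exp (s * ?x) * (exp (h * ?x) - 1 - h * ?x)"
        by (simp add: algebra_simps exp_add)
      also have "\<bar>\<dots>\<bar> = \<bar>?x\<bar> ^ k * exp (s * ?x) * \<bar>exp (h * ?x) - 1 - h * ?x\<bar>"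
        by (simp add: abs_mult power_abs)
      also have "\<dots> \<le> \<bar>?x\<bar> ^ k * exp (s * ?x) * ((h * ?x)\<^sup>2 * (exp (h * ?x) + exp (- (h * ?x))))"
        by (intro mult_left_mono exp_remainder_bound) auto
      also have "(h * ?x)\<^sup>2 = h\<^sup>2 * \<bar>?x\<bar>\<^sup>2"
        by (simp add: power_mult_distrib)
      also have "\<bar>?x\<bar> ^ k * exp (s * ?x) * (h\<^sup>2 * \<bar>?x\<bar>\<^sup>2 * (exp (h * ?x) + exp (- (h * ?x)))) =
          h\<^sup>2 * (\<bar>?x\<bar> ^ (k + 2) * (exp (s * ?x) * (exp (h * ?x) + exp (- (h * ?x)))))"
        by (simp add: power_add power2_eq_square mult_ac)
      also have "\<dots> \<le> h\<^sup>2 * (\<bar>?x\<bar> ^ (k + 2) * (exp (s * ?x) * (exp (s / 2 * ?x) + exp (- (s / 2 * ?x)))))"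
      proof -
        \<comment> \<open>The hyperbolic cosine is even and increasing on the positive axis, so
          \<open>h\<close> may be replaced by s / 2.\<close>
        have "exp y + exp (- y) \<le> exp z + exp (- z)" if "\<bar>y\<bar> \<le> \<bar>z\<bar>" for y z :: real
        proof -
          have "exp \<bar>v\<bar> + exp (- \<bar>v\<bar>) = exp v + exp (- v)" for v :: real
            by (simp add: abs_if)
          from this[of y] this[of z] show ?thesis
            using cosh_real_nonneg_le_iff[of "\<bar>y\<bar>" "\<bar>z\<bar>"] that by (simp add: cosh_def)
        qed
        moreover have "\<bar>h * ?x\<bar> \<le> \<bar>s / 2 * ?x\<bar>"
          unfolding abs_mult using h s by (intro mult_right_mono) auto
        ultimately show ?thesis
          by (intro mult_left_mono) auto
      qed
      also have "\<dots> = h\<^sup>2 * W (s / 2) \<omega>"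
        unfolding W_def distrib_left[of "exp (s * ?x)"] exp_add[symmetric]
        by (simp only: distrib_right left_diff_distrib add_uminus_conv_diff)
      finally show "\<bar>?r \<omega>\<bar> \<le> h\<^sup>2 * W (s / 2) \<omega>" .
    qed
    also have "\<dots> = h\<^sup>2 * C"
      by (simp add: C_def)
    finally show ?thesis .
  qed
  have "((\<lambda>h. (mom k (s + h) - mom k s) / h - mom (Suc k) s) \<longlongrightarrow> 0) (at 0)"
  proof (rule Lim_null_comparison)
    have "eventually (\<lambda>h. \<bar>h\<bar> \<le> s / 2) (at (0::real))"
      using s by (auto simp: eventually_at dist_real_def intro!: exI[of _ "s/2"])
    moreover have "eventually (\<lambda>h. h \<noteq> 0) (at (0::real))"
      by (auto simp: eventually_at_filter)
    ultimately show "eventually (\<lambda>h. norm ((mom k (s + h) - mom k s) / h - mom (Suc k) s) \<le> \<bar>h\<bar> * C) (at 0)"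
    proof eventually_elim
      case (elim h)
      have "(mom k (s + h) - mom k s) / h - mom (Suc k) s = (mom k (s + h) - mom k s - h * mom (Suc k) s) / h"
        using elim by (simp add: field_simps)
      also have "norm \<dots> \<le> h\<^sup>2 * C / \<bar>h\<bar>"
        using bound[OF elim(1)] by (simp add: divide_right_mono)
      also have "\<dots> = \<bar>h\<bar> * C"
        using elim by (simp add: power2_eq_square field_simps abs_if)
      finally show ?case .
    qed
    show "((\<lambda>h. \<bar>h\<bar> * C) \<longlongrightarrow> 0) (at 0)"
      by (rule tendsto_eq_intros refl | simp)+
  qed
  then show ?thesis
    unfolding DERIV_def by (rule LIM_zero_cancel)
qed

text \<open>Mean and variance of one step under the tilted law, identified below with the first two
  derivatives of \<phi> at \<open>t\<close>.\<close>

definition \<mu> where "\<mu> = mom 1 t / mom 0 t"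
definition \<sigma>2 where "\<sigma>2 = mom 2 t / mom 0 t - \<mu>\<^sup>2"
definition \<sigma> where "\<sigma> = sqrt \<sigma>2"

lemma DERIV_cgf:
  assumes "0 < s"
  shows "(\<phi> has_field_derivative mom 1 s / mom 0 s) (at s)"
proof -
  have "((\<lambda>s. ln (mom 0 s)) has_field_derivative mom 1 s / mom 0 s) (at s)"
    using DERIV_mom[OF assms, of 0] mom_0_pos[of s] assms
    by (auto intro!: derivative_eq_intros simp: divide_inverse)
  then show ?thesis
    by (simp add: cgf_def[abs_def] mom_def[of 0])
qed

lemma deriv_cgf: "deriv \<phi> t = \<mu>"
  unfolding \<mu>_def by (rule DERIV_imp_deriv[OF DERIV_cgf[OF t_pos]])

lemma deriv_deriv_cgf: "deriv (deriv \<phi>) t = \<sigma>2"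
proof -
  have "((\<lambda>s. mom 1 s / mom 0 s) has_field_derivative \<sigma>2) (at t)"
    using DERIV_mom[OF t_pos, of 0] DERIV_mom[OF t_pos, of 1] mom_0_pos[of t] t_pos
    by (auto intro!: derivative_eq_intros simp: \<sigma>2_def \<mu>_def field_simps power2_eq_square numeral_2_eq_2)
  moreover have "eventually (\<lambda>s. deriv \<phi> s = mom 1 s / mom 0 s) (nhds t)"
    using eventually_nhds_in_open[of "{0<..}" t] t_pos
    by (auto elim!: eventually_mono intro!: DERIV_imp_deriv DERIV_cgf simp del: One_nat_def)
  ultimately have "(deriv \<phi> has_field_derivative \<sigma>2) (at t)"
    by (subst DERIV_cong_ev[OF refl _ refl])
  then show ?thesis
    by (rule DERIV_imp_deriv)
qed


text \<open>Arbitrary index sets instead of intervals, because symmetric differences of intervals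
  and permuted windows occur below.\<close>

definition isum :: "nat set \<Rightarrow> 'a \<Rightarrow> real" where
  "isum A \<omega> = (\<Sum>i\<in>A. X i \<omega>)"

lemma isum_measurable [measurable]: "isum A \<in> borel_measurable M"
  unfolding isum_def[abs_def] by measurable

lemma indep_exp: "finite A \<Longrightarrow> indep_vars (\<lambda>_. borel) (\<lambda>i \<omega>. f (X i \<omega>)) A"
  if "f \<in> borel_measurable borel" for f :: "real \<Rightarrow> 'c::{real_normed_field, banach, second_countable_topology}"
  by (rule indep_vars_compose2[OF indep_vars_subset[OF indep subset_UNIV]]) (use that in auto)

lemma
  assumes "finite A" "0 \<le> s"
  shows integrable_exp_isum: "integrable M (\<lambda>\<omega>. exp (s * isum A \<omega>))"
    and expectation_exp_isum: "(\<integral>\<omega>. exp (s * isum A \<omega>) \<partial>M) = exp (real (card A) * \<phi> s)"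
proof -
  have eq: "(\<lambda>\<omega>. exp (s * isum A \<omega>)) = (\<lambda>\<omega>. \<Prod>i\<in>A. exp (s * X i \<omega>))"
    using assms by (simp add: isum_def sum_distrib_left exp_sum)
  note I = assms(1) indep_exp[of "\<lambda>x. exp (s * x)", OF _ assms(1)] integrable_exp_X[OF assms(2)]
  show "integrable M (\<lambda>\<omega>. exp (s * isum A \<omega>))"
    unfolding eq by (intro indep_vars_integrable I) simp
  have "(\<integral>\<omega>. exp (s * isum A \<omega>) \<partial>M) = (\<Prod>i\<in>A. \<integral>\<omega>. exp (s * X i \<omega>) \<partial>M)"
    unfolding eq by (intro indep_vars_lebesgue_integral I) simp
  then show "(\<integral>\<omega>. exp (s * isum A \<omega>) \<partial>M) = exp (real (card A) * \<phi> s)"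
    using assms by (simp add: expectation_exp_X exp_of_nat_mult)
qed

text \<open>The tilted law of the sum, recentred at the level \<open>z\<close>: the threshold then
  sits at 0 and a single test function serves all levels.\<close>

definition tilt :: "nat set \<Rightarrow> real \<Rightarrow> real measure" where
  "tilt A z = distr (density M (\<lambda>\<omega>. ennreal (exp (t * isum A \<omega> - real (card A) * \<phi> t)))) borel (\<lambda>\<omega>. isum A \<omega> - z)"

lemma integral_tilt:
  fixes f :: "real \<Rightarrow> 'c::{banach, second_countable_topology}"
  assumes [measurable]: "f \<in> borel_measurable borel"
  shows "(\<integral>x. f x \<partial>tilt A z) = (\<integral>\<omega>. exp (t * isum A \<omega> - real (card A) * \<phi> t) *\<^sub>R f (isum A \<omega> - z) \<partial>M)"
  unfolding tilt_def by (simp add: integral_distr integral_density)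

lemma integrable_tilt:
  fixes f :: "real \<Rightarrow> 'c::{banach, second_countable_topology}"
  assumes [measurable]: "f \<in> borel_measurable borel"
  shows "integrable (tilt A z) f \<longleftrightarrow> integrable M (\<lambda>\<omega>. exp (t * isum A \<omega> - real (card A) * \<phi> t) *\<^sub>R f (isum A \<omega> - z))"
  unfolding tilt_def by (simp add: integrable_distr_eq integrable_density)

lemma real_distribution_tilt:
  assumes "finite A"
  shows "real_distribution (tilt A z)"
proof -
  have t0: "0 \<le> t"
    using t_pos by simp
  have eq: "exp (t * isum A \<omega> - real (card A) * \<phi> t) = exp (t * isum A \<omega>) * exp (- (real (card A) * \<phi> t))" for \<omega>
    by (simp flip: exp_add)
  have "emeasure (tilt A z) (space (tilt A z)) = (\<integral>\<^sup>+\<omega>. ennreal (exp (t * isum A \<omega> - real (card A) * \<phi> t)) \<partial>M)"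
    unfolding tilt_def by (subst emeasure_distr) (auto simp: emeasure_density intro!: nn_integral_cong)
  also have "\<dots> = ennreal (\<integral>\<omega>. exp (t * isum A \<omega> - real (card A) * \<phi> t) \<partial>M)"
    unfolding eq using integrable_exp_isum[OF assms t0] by (intro nn_integral_eq_integral) auto
  also have "(\<integral>\<omega>. exp (t * isum A \<omega> - real (card A) * \<phi> t) \<partial>M) = 1"
    unfolding eq integral_mult_left_zero expectation_exp_isum[OF assms t0] by (simp flip: exp_add)
  finally show ?thesis
    unfolding real_distribution_def real_distribution_axioms_def
    by (auto intro!: prob_spaceI simp: tilt_def)
qed

abbreviation \<psi> where "\<psi> \<equiv> char (tilt {0} \<mu>)"

text \<open>The increments remain independent and identically distributed under the tilted measure.
  Recentring each one at \<mu> leaves the phase of \<open>z - real (card A) * \<mu>\<close>, the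
  offset called \<open>\<zeta>\<close> in the local limit theorem.\<close>

lemma char_tilt:
  assumes "finite A"
  shows "char (tilt A z) \<theta> = \<psi> \<theta> ^ card A * iexp (- (z - real (card A) * \<mu>) * \<theta>)"
proof -
  define g where "g x = of_real (exp (t * x - \<phi> t)) * iexp (\<theta> * (x - \<mu>))" for x
  have g [measurable]: "g \<in> borel_measurable borel"
    unfolding g_def by measurable
  have \<psi>: "\<psi> \<theta> = (\<integral>\<omega>. g (X 0 \<omega>) \<partial>M)"
    unfolding char_def by (subst integral_tilt) (auto simp: g_def isum_def scaleR_conv_of_real)
  have int: "integrable M (\<lambda>\<omega>. g (X i \<omega>))" for i
  proof (rule Bochner_Integration.integrable_bound)
    show "integrable M (\<lambda>\<omega>. exp (t * X i \<omega>) * exp (- \<phi> t))"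
      using integrable_exp_X[of t] t_pos by auto
    have "norm (g x) = exp (t * x) * exp (- \<phi> t)" for x
      unfolding g_def norm_mult norm_exp_i_times by (simp flip: exp_add)
    then show "AE \<omega> in M. norm (g (X i \<omega>)) \<le> norm (exp (t * X i \<omega>) * exp (- \<phi> t))"
      by simp
  qed simp
  have "exp (t * isum A \<omega> - real (card A) * \<phi> t) *\<^sub>R iexp (\<theta> * (isum A \<omega> - z)) =
      (\<Prod>i\<in>A. g (X i \<omega>)) * iexp (- (z - real (card A) * \<mu>) * \<theta>)" for \<omega>
  proof -
    have "(\<Prod>i\<in>A. g (X i \<omega>)) = exp (\<Sum>i\<in>A. of_real (t * X i \<omega> - \<phi> t) + \<i> * of_real (\<theta> * (X i \<omega> - \<mu>)))"
      using assms by (simp add: exp_sum g_def exp_add flip: exp_of_real)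
    also have "(\<Sum>i\<in>A. of_real (t * X i \<omega> - \<phi> t) + \<i> * of_real (\<theta> * (X i \<omega> - \<mu>))) =
        of_real (t * isum A \<omega> - real (card A) * \<phi> t) + \<i> * of_real (\<theta> * (isum A \<omega> - real (card A) * \<mu>))"
      by (simp add: isum_def sum.distrib sum_subtractf sum_distrib_left algebra_simps)
    finally have P: "(\<Prod>i\<in>A. g (X i \<omega>)) = exp (of_real (t * isum A \<omega> - real (card A) * \<phi> t) +
        \<i> * of_real (\<theta> * (isum A \<omega> - real (card A) * \<mu>)))" .
    show ?thesis
      unfolding P scaleR_conv_of_real exp_of_real[symmetric] exp_add[symmetric] by (simp add: algebra_simps)
  qed
  then have "char (tilt A z) \<theta> = (\<integral>\<omega>. (\<Prod>i\<in>A. g (X i \<omega>)) \<partial>M) * iexp (- (z - real (card A) * \<mu>) * \<theta>)"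
    unfolding char_def integral_mult_left_zero[symmetric] by (subst integral_tilt) simp_all
  also have "(\<integral>\<omega>. (\<Prod>i\<in>A. g (X i \<omega>)) \<partial>M) = (\<Prod>i\<in>A. \<integral>\<omega>. g (X i \<omega>) \<partial>M)"
    by (rule indep_vars_lebesgue_integral[OF assms indep_exp[OF g assms] int])
  also have "\<dots> = \<psi> \<theta> ^ card A"
  proof -
    have "(\<integral>\<omega>. g (X i \<omega>) \<partial>M) = \<psi> \<theta>" for i
      unfolding \<psi> by (rule expectation_ident[OF g])
    then show ?thesis
      by simp
  qed
  finally show ?thesis .
qed

lemma AE_tilt: "(AE x in tilt {0} \<mu>. P x) \<longleftrightarrow> (AE \<omega> in M. P (X 0 \<omega> - \<mu>))"
  if [measurable]: "Measurable.pred borel P" for P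
  unfolding tilt_def by (simp add: AE_distr_iff AE_density isum_def)

text \<open>The exponential bound is used with parameter t / 2, so that the exponents t + t / 2 and
  t - t / 2 stay positive.\<close>

lemma tilt_integrable_abs_power: "integrable (tilt {0} \<mu>) (\<lambda>x. \<bar>x\<bar> ^ k)"
proof -
  have "integrable M (\<lambda>\<omega>. exp (- \<phi> t) * (\<bar>X 0 \<omega> - \<mu>\<bar> ^ k * exp (t * X 0 \<omega>)))"
  proof (rule integrable_mult_right, rule Bochner_Integration.integrable_bound)
    define C where "C = fact k / (t / 2) ^ k * (exp (- t / 2 * \<mu>) + exp (t / 2 * \<mu>))"
    have C: "C > 0"
      unfolding C_def using t_pos by (intro mult_pos_pos add_pos_pos divide_pos_pos) auto
    show "integrable M (\<lambda>\<omega>. C * (exp (3 * t / 2 * X 0 \<omega>) + exp (t / 2 * X 0 \<omega>)))"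
      using t_pos by (intro integrable_mult_right Bochner_Integration.integrable_add mgf) auto
    show "AE \<omega> in M. norm (\<bar>X 0 \<omega> - \<mu>\<bar> ^ k * exp (t * X 0 \<omega>)) \<le>
        norm (C * (exp (3 * t / 2 * X 0 \<omega>) + exp (t / 2 * X 0 \<omega>)))"
    proof (rule AE_I2)
      fix \<omega>
      let ?x = "X 0 \<omega>"
      have "\<bar>?x - \<mu>\<bar> ^ k * exp (t * ?x) \<le>
          fact k / (t / 2) ^ k * (exp (t / 2 * (?x - \<mu>)) + exp (- (t / 2) * (?x - \<mu>))) * exp (t * ?x)"
        using t_pos by (intro mult_right_mono abs_power_le_exp) auto
      also have "\<dots> = fact k / (t / 2) ^ k * (exp (- t / 2 * \<mu>) * exp (3 * t / 2 * ?x) + exp (t / 2 * \<mu>) * exp (t / 2 * ?x))"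
      proof -
        have "exp (t / 2 * (?x - \<mu>)) * exp (t * ?x) = exp (- t / 2 * \<mu>) * exp (3 * t / 2 * ?x)"
          "exp (- (t / 2) * (?x - \<mu>)) * exp (t * ?x) = exp (t / 2 * \<mu>) * exp (t / 2 * ?x)"
          unfolding exp_add[symmetric] by (rule arg_cong[where f = exp], simp add: field_simps)+
        then show ?thesis
          by (simp only: mult.assoc distrib_right)
      qed
      also have "\<dots> \<le> C * (exp (3 * t / 2 * ?x) + exp (t / 2 * ?x))"
      proof -
        have "a * b + c * d \<le> (a + c) * (b + d)" if "0 \<le> a" "0 \<le> b" "0 \<le> c" "0 \<le> d" for a b c d :: real
          using that by (simp add: distrib_left distrib_right)
        then show ?thesis
          unfolding C_def mult.assoc using t_pos by (intro mult_left_mono) auto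
      qed
      finally show "norm (\<bar>?x - \<mu>\<bar> ^ k * exp (t * ?x)) \<le>
        norm (C * (exp (3 * t / 2 * ?x) + exp (t / 2 * ?x)))"
        using C by (simp add: abs_mult)
    qed
  qed measurable
  then show ?thesis
    by (subst integrable_tilt) (simp_all add: isum_def exp_diff exp_minus divide_inverse mult_ac)
qed

lemma tilt_integrable_power: "integrable (tilt {0} \<mu>) (\<lambda>x. x ^ k)"
  by (rule Bochner_Integration.integrable_bound[OF tilt_integrable_abs_power[of k]])
     (auto simp: power_abs tilt_def)

lemma
  shows tilt_mean: "(\<integral>x. x \<partial>tilt {0} \<mu>) = 0"
    and tilt_square: "(\<integral>x. x\<^sup>2 \<partial>tilt {0} \<mu>) = \<sigma>2"
proof -
  have E: "exp (t * x - \<phi> t) = exp (t * x) / mom 0 t" for x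
    using t_pos by (simp add: exp_diff exp_cgf)
  note int = integrable_power_exp[OF t_pos]
  have i0: "integrable M (\<lambda>\<omega>. exp (t * X 0 \<omega>))" and i1: "integrable M (\<lambda>\<omega>. X 0 \<omega> * exp (t * X 0 \<omega>))"
    and i2: "integrable M (\<lambda>\<omega>. (X 0 \<omega>)\<^sup>2 * exp (t * X 0 \<omega>))"
    using int[of 0] int[of 1] int[of 2] by auto
  have m0: "mom 0 t \<noteq> 0"
    using mom_0_pos[of t] t_pos by simp
  have "(\<integral>x. x \<partial>tilt {0} \<mu>) = (\<integral>\<omega>. (1 / mom 0 t) * (X 0 \<omega> * exp (t * X 0 \<omega>) - \<mu> * exp (t * X 0 \<omega>)) \<partial>M)"
    by (subst integral_tilt) (auto simp: isum_def E field_simps)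
  also have "\<dots> = (1 / mom 0 t) * (mom 1 t - \<mu> * mom 0 t)"
    using i0 i1 by (subst integral_mult_right_zero, subst Bochner_Integration.integral_diff) (auto simp: mom_def)
  also have "\<dots> = 0"
    using m0 by (simp add: \<mu>_def)
  finally show "(\<integral>x. x \<partial>tilt {0} \<mu>) = 0" .
  have "(\<integral>x. x\<^sup>2 \<partial>tilt {0} \<mu>) = (\<integral>\<omega>. (1 / mom 0 t) * ((X 0 \<omega>)\<^sup>2 * exp (t * X 0 \<omega>) -
      2 * \<mu> * (X 0 \<omega> * exp (t * X 0 \<omega>)) + \<mu>\<^sup>2 * exp (t * X 0 \<omega>)) \<partial>M)"
    by (subst integral_tilt) (auto simp: isum_def E field_simps power2_eq_square)
  also have "\<dots> = (1 / mom 0 t) * (mom 2 t - 2 * \<mu> * mom 1 t + \<mu>\<^sup>2 * mom 0 t)"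
    using i0 i1 i2 by (subst integral_mult_right_zero, subst Bochner_Integration.integral_add,
        auto simp: mom_def Bochner_Integration.integral_diff)
  also have "\<dots> = \<sigma>2"
    using m0 by (simp add: \<mu>_def \<sigma>2_def field_simps power2_eq_square)
  finally show "(\<integral>x. x\<^sup>2 \<partial>tilt {0} \<mu>) = \<sigma>2" .
qed

lemma \<sigma>2_pos: "0 < \<sigma>2"
proof -
  have "\<sigma>2 \<ge> 0"
    unfolding tilt_square[symmetric] by (intro Bochner_Integration.integral_nonneg) simp
  moreover have "\<sigma>2 \<noteq> 0"
  proof
    assume "\<sigma>2 = 0"
    then have "AE x in tilt {0} \<mu>. x\<^sup>2 = 0"
      using tilt_square integral_nonneg_eq_0_iff_AE[OF tilt_integrable_power[of 2]] by simp
    then have "AE \<omega> in M. X 0 \<omega> = \<mu>"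
      by (subst (asm) AE_tilt) auto
    then show False
      using not_AE_const by blast
  qed
  ultimately show ?thesis
    by simp
qed

lemma \<sigma>_pos: "0 < \<sigma>" and \<sigma>_square: "\<sigma>\<^sup>2 = \<sigma>2"
  using \<sigma>2_pos by (auto simp: \<sigma>_def)

text \<open>The tilting density is positive, so a lattice carrying the tilted law would, after
  translation by \<mu>, carry the original law as well.\<close>

lemma llt: "llt_char \<psi> \<sigma>"
proof -
  interpret T: real_distribution "tilt {0} \<mu>"
    by (rule real_distribution_tilt) simp
  show ?thesis
  proof (rule T.llt_char_char)
    show "\<not> (\<exists>a>0. \<exists>b. AE x in tilt {0} \<mu>. \<exists>z::int. x = a * real_of_int z + b)"
    proof
      assume "\<exists>a>0. \<exists>b. AE x in tilt {0} \<mu>. \<exists>z::int. x = a * real_of_int z + b"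
      then obtain a b where a: "a > 0" and "AE x in tilt {0} \<mu>. \<exists>z::int. x = a * real_of_int z + b"
        by auto
      then have "AE \<omega> in M. \<exists>z::int. X 0 \<omega> - \<mu> = a * real_of_int z + b"
        by (subst (asm) AE_tilt) auto
      then have "AE \<omega> in M. \<exists>z::int. X 0 \<omega> = a * real_of_int z + (b + \<mu>)"
        by eventually_elim (auto simp: algebra_simps)
      with a nonlattice show False
        by blast
    qed
  qed (use tilt_integrable_power[of 1] tilt_integrable_power[of 2] tilt_integrable_abs_power[of 3]
      tilt_mean tilt_square \<sigma>_pos \<sigma>_square in auto)
qed

section \<open>Tails of sums\<close>

definition tail_fun :: "real \<Rightarrow> real" where
  "tail_fun x = exp (- t * x) * indicator {0<..} x"

lemma tail_fun_measurable [measurable]: "tail_fun \<in> borel_measurable borel"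
  unfolding tail_fun_def by measurable

text \<open>For positive \<open>x\<close> the denominator \<open>20 + 2 * x\<^sup>2\<close> of the
  lower bound for \<open>kern\<close> is at most \<open>(20 + 4 / t\<^sup>2) * exp (t * x)\<close>;
  division by 4 gives the constant.\<close>

lemma tail_fun_le_kern: "\<bar>tail_fun x\<bar> \<le> (5 + 1 / t\<^sup>2) * kern x"
proof (cases "x > 0")
  case True
  have "1 \<le> exp (t * x)"
    using True t_pos by simp
  moreover have "(t * x)\<^sup>2 / 2 \<le> exp (t * x)"
    using exp_lower_Taylor_quadratic[of "t * x"] True t_pos by (smt (verit) mult_pos_pos)
  then have "2 * x\<^sup>2 \<le> 4 / t\<^sup>2 * exp (t * x)"
    using t_pos by (simp add: field_simps)
  ultimately have "20 + 2 * x\<^sup>2 \<le> (20 + 4 / t\<^sup>2) * exp (t * x)"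
    unfolding distrib_right by linarith
  then have "exp (- t * x) \<le> (5 + 1 / t\<^sup>2) * (4 / (20 + 2 * x\<^sup>2))"
    using zero_le_power2[of x] by (simp add: exp_minus field_simps add_pos_nonneg)
  also have "\<dots> \<le> (5 + 1 / t\<^sup>2) * kern x"
    by (intro mult_left_mono kern_lower) auto
  finally show ?thesis
    using True by (simp add: tail_fun_def)
qed (use kern_nonneg[of x] in \<open>simp add: tail_fun_def\<close>)

lemma integral_tail_fun: "(\<integral>x. tail_fun x \<partial>lborel) = 1 / t"
proof -
  have "(\<integral>x. tail_fun x \<partial>lborel) = (\<integral>x. exponential_density t x / t \<partial>lborel)"
    using AE_lborel_singleton[of "0::real"] t_pos
    by (intro integral_cong_AE) (auto simp: tail_fun_def exponential_density_def elim!: eventually_mono)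
  also have "(\<integral>x. exponential_density t x \<partial>lborel) = 1"
  proof -
    interpret E: prob_space "density lborel (exponential_density t)"
      by (rule prob_space_exponential_density[OF t_pos])
    have "(\<integral>\<^sup>+x. ennreal (exponential_density t x) \<partial>lborel) = 1"
      using E.emeasure_space_1 by (simp add: emeasure_density)
    then show ?thesis
      using exponential_density_nonneg[OF t_pos] by (subst integral_eq_nn_integral) auto
  qed
  then have "(\<integral>x. exponential_density t x / t \<partial>lborel) = 1 / t"
    by simp
  finally show ?thesis .
qed

text \<open>Change of measure: undoing the density on the event leaves the weight
  \<open>exp (- t * (S - z))\<close>, that is, \<open>tail_fun\<close> at the recentred sum.\<close>

lemma prob_isum_gt:
  "prob {\<omega> \<in> space M. z < isum A \<omega>} = exp (real (card A) * \<phi> t - t * z) * (\<integral>x. tail_fun x \<partial>tilt A z)"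
proof -
  have "exp (t * s - c) *\<^sub>R tail_fun (s - z) = exp (t * z - c) * indicator {z<..} s" for s c
    by (auto simp: tail_fun_def algebra_simps split: split_indicator simp flip: exp_add)
  then have "(\<integral>x. tail_fun x \<partial>tilt A z) = exp (t * z - real (card A) * \<phi> t) * (\<integral>\<omega>. indicator {z<..} (isum A \<omega>) \<partial>M)"
    by (simp add: integral_tilt)
  also have "(\<integral>\<omega>. indicator {z<..} (isum A \<omega>) \<partial>M) = (\<integral>\<omega>. indicator {\<omega> \<in> space M. z < isum A \<omega>} \<omega> \<partial>M)"
    by (intro Bochner_Integration.integral_cong) (auto simp: indicator_def)
  finally show ?thesis
    by (simp flip: exp_add mult.assoc)
qed

text \<open>A Bahadur-Rao estimate that also covers levels at distance of order
  \<open>sqrt l\<close> from the tilted mean: the offset \<rho> contributes the Gaussian factor, and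
  1 / t is the integral of \<open>tail_fun\<close>.\<close>

theorem tail_asymp:
  assumes A: "\<And>n. finite (A n)" and cA: "filterlim (\<lambda>n. card (A n)) at_top sequentially"
    and z: "(\<lambda>n. (z n - real (card (A n)) * \<mu>) / sqrt (real (card (A n)))) \<longlonglongrightarrow> \<rho>"
  shows "(\<lambda>n. sqrt (real (card (A n))) * exp (t * z n - real (card (A n)) * \<phi> t) *
      prob {\<omega> \<in> space M. z n < isum (A n) \<omega>}) \<longlonglongrightarrow> exp (- \<rho>\<^sup>2 / (2 * \<sigma>2)) / (\<sigma> * sqrt (2 * pi) * t)"
proof -
  interpret llt_char \<psi> \<sigma> by (rule llt)
  have cont: "isCont tail_fun x" if "x \<notin> {0}" for x
    unfolding tail_fun_def using that
    by (intro continuous_intros) (auto simp: isCont_indicator frontier_def interior_open)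
  have "(\<lambda>n. sqrt (real (card (A n))) * (\<integral>x. tail_fun x \<partial>tilt (A n) (z n))) \<longlonglongrightarrow>
      exp (- \<rho>\<^sup>2 / (2 * \<sigma>\<^sup>2)) / (\<sigma> * sqrt (2 * pi)) * (\<integral>x. tail_fun x \<partial>lborel)"
    by (rule local_limit[where \<zeta> = "\<lambda>n. z n - real (card (A n)) * \<mu>" and D = "{0}",
          OF real_distribution_tilt[OF A] char_tilt[OF A] cA z _ tail_fun_le_kern])
       (auto intro: cont)
  then show ?thesis
    by (simp add: prob_isum_gt integral_tail_fun \<sigma>_square flip: exp_add mult.assoc)
       (simp add: mult.assoc flip: exp_add)
qed

text \<open>Uniform in the index set and in the level, however far \<open>z\<close> is from the
  tilted mean; it supplies the majorants below.\<close>

theorem tail_bound: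
  "\<exists>K>0. \<forall>A z. finite A \<longrightarrow> sqrt (real (card A)) * prob {\<omega> \<in> space M. z < isum A \<omega>} \<le> K * exp (real (card A) * \<phi> t - t * z)"
proof -
  interpret llt_char \<psi> \<sigma> by (rule llt)
  obtain K where K: "\<And>Q l \<zeta>. real_distribution Q \<Longrightarrow> (\<And>\<theta>. char Q \<theta> = \<psi> \<theta> ^ l * iexp (- \<zeta> * \<theta>)) \<Longrightarrow>
    sqrt (real l) * (\<integral>x. kern x \<partial>Q) \<le> K"
    using kern_bound by blast
  define C where "C = 5 + 1 / t\<^sup>2"
  have C: "C > 0"
    by (simp add: C_def add_pos_nonneg)
  have "sqrt (real (card A)) * prob {\<omega> \<in> space M. z < isum A \<omega>} \<le> (C * \<bar>K\<bar> + 1) * exp (real (card A) * \<phi> t - t * z)"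
    if A: "finite A" for A z
  proof -
    interpret Q: real_distribution "tilt A z"
      by (rule real_distribution_tilt[OF A])
    have ik: "integrable (tilt A z) (\<lambda>x. C * kern x)"
      by (intro integrable_mult_right Q.integrable_const_bound[where B = 2])
         (auto simp: abs_of_nonneg[OF kern_nonneg] kern_le_2)
    have "(\<integral>x. tail_fun x \<partial>tilt A z) \<le> (\<integral>x. C * kern x \<partial>tilt A z)"
      using tail_fun_le_kern
      by (intro integral_mono Bochner_Integration.integrable_bound[OF ik])
         (auto simp: C_def[symmetric] intro: order_trans[OF abs_ge_self] order_trans[OF _ abs_ge_self])
    then have "sqrt (real (card A)) * (\<integral>x. tail_fun x \<partial>tilt A z) \<le> sqrt (real (card A)) * (C * (\<integral>x. kern x \<partial>tilt A z))"
      by (intro mult_left_mono) auto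
    also have "\<dots> = C * (sqrt (real (card A)) * (\<integral>x. kern x \<partial>tilt A z))"
      by simp
    also have "\<dots> \<le> C * K"
      using C by (intro mult_left_mono K[OF real_distribution_tilt[OF A] char_tilt[OF A]]) auto
    also have "\<dots> \<le> C * \<bar>K\<bar> + 1"
      using C by (simp add: add_increasing2)
    finally have "sqrt (real (card A)) * (\<integral>x. tail_fun x \<partial>tilt A z) * exp (real (card A) * \<phi> t - t * z) \<le> (C * \<bar>K\<bar> + 1) * exp (real (card A) * \<phi> t - t * z)"
      by (intro mult_right_mono) auto
    then show ?thesis
      by (simp add: prob_isum_gt mult_ac)
  qed
  moreover have "C * \<bar>K\<bar> + 1 > 0"
    using C by (simp add: add_nonneg_pos)
  ultimately show ?thesis
    by blast
qed

end

section \<open>Pairs of exceedances and cells\<close>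

lemma tendsto_Max_image:
  fixes f :: "nat \<Rightarrow> 'i \<Rightarrow> real"
  assumes "finite I" "I \<noteq> {}" and lim: "\<And>i. i \<in> I \<Longrightarrow> (\<lambda>n. f n i) \<longlonglongrightarrow> g i"
  shows "(\<lambda>n. Max (f n ` I)) \<longlonglongrightarrow> Max (g ` I)"
  using assms
proof (induction I rule: finite_ne_induct)
  case (insert i I)
  then have "(\<lambda>n. max (f n i) (Max (f n ` I))) \<longlonglongrightarrow> max (g i) (Max (g ` I))"
    by (intro tendsto_max) auto
  with insert show ?case
    by simp
qed simp

text \<open>Maximisers can be chosen separately in the two coordinates; this separates the left end
  of a cell from the right end.\<close>

lemma Max_add_Max:
  fixes f g :: "'i \<Rightarrow> real"
  assumes "finite I" "I \<noteq> {}" "finite J" "J \<noteq> {}"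
  shows "Max ((\<lambda>(i, j). f i + g j) ` (I \<times> J)) = Max (f ` I) + Max (g ` J)"
proof (rule Max_eqI)
  have "Max (f ` I) \<in> f ` I" "Max (g ` J) \<in> g ` J"
    using assms by (auto intro!: Max_in)
  then obtain i j where i: "i \<in> I" "Max (f ` I) = f i" and j: "j \<in> J" "Max (g ` J) = g j"
    by (elim imageE)
  show "Max (f ` I) + Max (g ` J) \<in> (\<lambda>(i, j). f i + g j) ` (I \<times> J)"
    unfolding i(2) j(2) using i(1) j(1) by (intro image_eqI[of _ _ "(i, j)"]) simp_all
  show "y \<le> Max (f ` I) + Max (g ` J)" if "y \<in> (\<lambda>(i, j). f i + g j) ` (I \<times> J)" for y
    using that assms by (auto intro!: add_mono)
qed (use assms in auto)

context prob_space
begin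

text \<open>Conditioning on \<open>Y\<close>, expressed by Fubini's theorem for the product of the
  two laws.\<close>

lemma prob_less_indep:
  fixes C Y :: "'a \<Rightarrow> real"
  assumes "indep_var borel Y borel C"
  shows "prob {\<omega> \<in> space M. Y \<omega> < C \<omega>} = (\<integral>\<omega>. prob {\<omega>' \<in> space M. Y \<omega> < C \<omega>'} \<partial>M)"
proof -
  have Y [measurable]: "Y \<in> borel_measurable M" and C [measurable]: "C \<in> borel_measurable M"
    using indep_var_rv1[OF assms] indep_var_rv2[OF assms] by auto
  interpret dY: prob_space "distr M borel Y" by (rule prob_space_distr) simp
  interpret dC: prob_space "distr M borel C" by (rule prob_space_distr) simp
  interpret P: pair_prob_space "distr M borel Y" "distr M borel C" ..
  have D: "distr M borel Y \<Otimes>\<^sub>M distr M borel C = distr M (borel \<Otimes>\<^sub>M borel) (\<lambda>\<omega>. (Y \<omega>, C \<omega>))"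
    using assms by (simp add: indep_var_distribution_eq)
  define f where "f = (\<lambda>(y::real, c::real). if y < c then 1 else 0 :: real)"
  have f [measurable]: "f \<in> borel_measurable (borel \<Otimes>\<^sub>M borel)"
    unfolding f_def by measurable
  have int: "integrable (distr M borel Y \<Otimes>\<^sub>M distr M borel C) f"
    by (rule P.P.integrable_const_bound[where B = 1]) (auto simp: f_def)
  have "prob {\<omega> \<in> space M. Y \<omega> < C \<omega>} = (\<integral>\<omega>. indicator {\<omega> \<in> space M. Y \<omega> < C \<omega>} \<omega> \<partial>M)"
    by simp
  also have "\<dots> = (\<integral>\<omega>. f (Y \<omega>, C \<omega>) \<partial>M)"
    by (intro Bochner_Integration.integral_cong) (auto simp: f_def indicator_def)
  also have "\<dots> = (\<integral>z. f z \<partial>(distr M borel Y \<Otimes>\<^sub>M distr M borel C))"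
    unfolding D by (subst integral_distr) auto
  also have "\<dots> = (\<integral>y. (\<integral>c. f (y, c) \<partial>distr M borel C) \<partial>distr M borel Y)"
    using P.integral_fst'[OF int] by simp
  also have "\<dots> = (\<integral>\<omega>. (\<integral>\<omega>'. f (Y \<omega>, C \<omega>') \<partial>M) \<partial>M)"
    by (subst integral_distr, simp, measurable) (subst integral_distr, auto)
  also have "\<dots> = (\<integral>\<omega>. prob {\<omega>' \<in> space M. Y \<omega> < C \<omega>'} \<partial>M)"
  proof (intro Bochner_Integration.integral_cong refl)
    fix \<omega>
    have "(\<integral>\<omega>'. f (Y \<omega>, C \<omega>') \<partial>M) = (\<integral>\<omega>'. indicator {\<omega>' \<in> space M. Y \<omega> < C \<omega>'} \<omega>' \<partial>M)"
      by (intro Bochner_Integration.integral_cong) (auto simp: f_def indicator_def)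
    then show "(\<integral>\<omega>'. f (Y \<omega>, C \<omega>') \<partial>M) = prob {\<omega>' \<in> space M. Y \<omega> < C \<omega>'}"
      by simp
  qed
  finally show ?thesis .
qed

lemma prob_less_indep_le:
  fixes C Y :: "'a \<Rightarrow> real"
  assumes ind: "indep_var borel Y borel C"
    and le: "\<And>y. prob {\<omega>' \<in> space M. y < C \<omega>'} \<le> F y" and int: "integrable M (\<lambda>\<omega>. F (Y \<omega>))"
  shows "prob {\<omega> \<in> space M. Y \<omega> < C \<omega>} \<le> (\<integral>\<omega>. F (Y \<omega>) \<partial>M)"
proof -
  have "0 \<le> F y" for y
    using le[of y] measure_nonneg order_trans by blast
  then show ?thesis
    unfolding prob_less_indep[OF ind]
    by (intro integral_mono_AE' int AE_I2 le)
qed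

lemma union_bound:
  assumes "finite I" "\<And>i. i \<in> I \<Longrightarrow> E i \<in> events" "A \<subseteq> (\<Union>i\<in>I. E i)" and le: "\<And>i. i \<in> I \<Longrightarrow> prob (E i) \<le> q"
  shows "prob A \<le> real (card I) * q"
proof -
  have "prob A \<le> prob (\<Union>i\<in>I. E i)"
    using assms by (intro finite_measure_mono) auto
  also have "\<dots> \<le> (\<Sum>i\<in>I. prob (E i))"
    using assms by (intro finite_measure_subadditive_finite) auto
  also have "\<dots> \<le> real (card I) * q"
    using sum_bounded_above[of I "\<lambda>i. prob (E i)" q] le by simp
  finally show ?thesis .
qed

text \<open>The correction runs over ordered pairs and counts each intersection twice, which costs
  only a constant and keeps the double sum symmetric.\<close>

lemma bonferroni:
  assumes "finite I" "\<And>i. i \<in> I \<Longrightarrow> E i \<in> events"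
  shows "(\<Sum>i\<in>I. prob (E i)) - (\<Sum>i\<in>I. \<Sum>j\<in>I - {i}. prob (E i \<inter> E j)) \<le> prob (\<Union>i\<in>I. E i)"
  using assms
proof (induction I rule: finite_induct)
  case (insert k I)
  have U: "(\<Union>i\<in>I. E i) \<in> events" and Ek: "E k \<in> events"
    using insert by auto
  have "prob (E k \<inter> (\<Union>i\<in>I. E i)) \<le> prob (\<Union>i\<in>I. E k \<inter> E i)"
    using insert by (intro finite_measure_mono) auto
  also have "\<dots> \<le> (\<Sum>i\<in>I. prob (E k \<inter> E i))"
    using insert by (intro finite_measure_subadditive_finite) auto
  finally have 1: "prob (E k \<inter> (\<Union>i\<in>I. E i)) \<le> (\<Sum>i\<in>I. prob (E k \<inter> E i))" .
  have 2: "prob (E k \<union> (\<Union>i\<in>I. E i)) = prob (E k) + prob (\<Union>i\<in>I. E i) - prob (E k \<inter> (\<Union>i\<in>I. E i))"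
    using measure_Un3[of "E k" M "\<Union>i\<in>I. E i"] U Ek by (simp add: fmeasurable_eq_sets)
  have 3: "(\<Sum>i\<in>insert k I. \<Sum>j\<in>insert k I - {i}. prob (E i \<inter> E j)) \<ge>
    (\<Sum>j\<in>I. prob (E k \<inter> E j)) + (\<Sum>i\<in>I. \<Sum>j\<in>I - {i}. prob (E i \<inter> E j))"
  proof -
    have "(\<Sum>i\<in>I. \<Sum>j\<in>I - {i}. prob (E i \<inter> E j)) \<le> (\<Sum>i\<in>I. \<Sum>j\<in>insert k I - {i}. prob (E i \<inter> E j))"
      using insert by (intro sum_mono sum_mono2) auto
    then show ?thesis
      using insert(1,2) by simp
  qed
  show ?case
    using insert 1 2 3 by (simp add: sum.insert)
qed simp

end

context iid_walk
begin

text \<open>The form in which independence is used: two variables that factor through disjoint sets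
  of coordinates.\<close>

lemma indep_var_functions:
  assumes "A \<inter> B = {}"
    and f [measurable]: "f \<in> borel_measurable (Pi\<^sub>M A (\<lambda>_. borel))"
    and g [measurable]: "g \<in> borel_measurable (Pi\<^sub>M B (\<lambda>_. borel))"
    and F: "\<And>\<omega>. F \<omega> = f (\<lambda>i\<in>A. X i \<omega>)" and G: "\<And>\<omega>. G \<omega> = g (\<lambda>i\<in>B. X i \<omega>)"
  shows "indep_var borel F borel G"
proof -
  have "indep_var borel (f \<circ> (\<lambda>\<omega>. \<lambda>i\<in>A. X i \<omega>)) borel (g \<circ> (\<lambda>\<omega>. \<lambda>i\<in>B. X i \<omega>))"
    by (rule indep_var_compose[OF indep_var_restrict[OF indep assms(1)] f g]) auto
  moreover have "F = f \<circ> (\<lambda>\<omega>. \<lambda>i\<in>A. X i \<omega>)" "G = g \<circ> (\<lambda>\<omega>. \<lambda>i\<in>B. X i \<omega>)"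
    by (auto simp: F G fun_eq_iff)
  ultimately show ?thesis
    by simp
qed

lemma sum_measurable_PiM [measurable]:
  "I \<subseteq> A \<Longrightarrow> (\<lambda>x. \<Sum>i\<in>I. x i) \<in> borel_measurable (Pi\<^sub>M A (\<lambda>_. borel :: real measure))"
  by (intro borel_measurable_sum measurable_component_singleton) auto

text \<open>Both sides are the infinite product of the common step law. Injectivity suffices, so
  shifts, reversals and permutations are covered alike.\<close>

lemma distr_reindex:
  assumes "inj f"
  shows "distr M (Pi\<^sub>M UNIV (\<lambda>_. borel)) (\<lambda>\<omega> i. X (f i) \<omega>) = distr M (Pi\<^sub>M UNIV (\<lambda>_. borel)) (\<lambda>\<omega> i. X i \<omega>)"
proof -
  define D where "D = distr M borel (X 0)"
  interpret D: prob_space D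
    unfolding D_def by (rule prob_space_distr) simp
  have X: "distr M (Pi\<^sub>M UNIV (\<lambda>_. borel)) (\<lambda>\<omega> i. X i \<omega>) = Pi\<^sub>M UNIV (\<lambda>_. D)"
  proof -
    have "(\<lambda>i. distr M borel (X i)) = (\<lambda>_. D)"
      unfolding D_def by (rule ext) (rule ident)
    then show ?thesis
      using indep_vars_iff_distr_eq_PiM[of UNIV X "\<lambda>_. borel"] indep by (simp add: restrict_UNIV)
  qed
  have "distr M (Pi\<^sub>M UNIV (\<lambda>_. borel)) (\<lambda>\<omega> i. X (f i) \<omega>) =
    distr (distr M (Pi\<^sub>M UNIV (\<lambda>_. borel)) (\<lambda>\<omega> i. X i \<omega>)) (Pi\<^sub>M UNIV (\<lambda>_. borel)) (\<lambda>x i. x (f i))"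
    by (subst distr_distr) (auto simp: comp_def intro!: measurable_PiM_single')
  also have "\<dots> = distr (Pi\<^sub>M UNIV (\<lambda>_. D)) (Pi\<^sub>M UNIV (\<lambda>_. D)) (\<lambda>x. \<lambda>i\<in>UNIV. x (f i))"
    unfolding X by (intro distr_cong refl sets_PiM_cong) (auto simp: D_def)
  also have "\<dots> = Pi\<^sub>M UNIV (\<lambda>_. D)"
    using distr_PiM_reindex[of UNIV "\<lambda>_. D" f UNIV] D.prob_space_axioms assms by auto
  finally show ?thesis
    by (simp add: X)
qed

lemma prob_reindex:
  assumes "inj f" and [measurable]: "Measurable.pred (Pi\<^sub>M UNIV (\<lambda>_. borel)) P"
  shows "prob {\<omega> \<in> space M. P (\<lambda>i. X (f i) \<omega>)} = prob {\<omega> \<in> space M. P (\<lambda>i. X i \<omega>)}"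
proof -
  let ?S = "{x \<in> space (Pi\<^sub>M UNIV (\<lambda>_. borel)). P x}"
  have [measurable]: "?S \<in> sets (Pi\<^sub>M UNIV (\<lambda>_. borel))"
    by (rule predE[OF assms(2)])
  then have S: "{x. P x} \<in> sets (Pi\<^sub>M UNIV (\<lambda>_. borel))"
    by (simp add: space_PiM)
  have *: "prob {\<omega> \<in> space M. P (\<lambda>i. X (g i) \<omega>)} = measure (distr M (Pi\<^sub>M UNIV (\<lambda>_. borel)) (\<lambda>\<omega> i. X (g i) \<omega>)) ?S" for g
    by (subst measure_distr) (auto intro!: measurable_PiM_single' arg_cong[where f = prob] simp: space_PiM S)
  show ?thesis
    using *[of f] *[of "\<lambda>i. i"] distr_reindex[OF assms(1)] by simp
qed

lemma expectation_reindex: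
  fixes F :: "(nat \<Rightarrow> real) \<Rightarrow> real"
  assumes "inj f" and [measurable]: "F \<in> borel_measurable (Pi\<^sub>M UNIV (\<lambda>_. borel))"
  shows "(\<integral>\<omega>. F (\<lambda>i. X (f i) \<omega>) \<partial>M) = (\<integral>\<omega>. F (\<lambda>i. X i \<omega>) \<partial>M)"
proof -
  have *: "(\<integral>\<omega>. F (\<lambda>i. X (g i) \<omega>) \<partial>M) = (\<integral>x. F x \<partial>distr M (Pi\<^sub>M UNIV (\<lambda>_. borel)) (\<lambda>\<omega> i. X (g i) \<omega>))" for g
    by (subst integral_distr) (auto intro!: measurable_PiM_single')
  show ?thesis
    using *[of f] *[of "\<lambda>i. i"] distr_reindex[OF assms(1)] by simp
qed

lemma isum_eq_restrict: "I \<subseteq> A \<Longrightarrow> isum I \<omega> = (\<Sum>i\<in>I. (\<lambda>i\<in>A. X i \<omega>) i)"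
  unfolding isum_def by (intro sum.cong) auto

lemma isum_Un: "finite I \<Longrightarrow> finite J \<Longrightarrow> I \<inter> J = {} \<Longrightarrow> isum (I \<union> J) \<omega> = isum I \<omega> + isum J \<omega>"
  unfolding isum_def by (rule sum.union_disjoint)

lemma indep_isum: "A \<inter> B = {} \<Longrightarrow> indep_var borel (isum A) borel (isum B)"
  by (rule indep_var_functions[of A B "\<lambda>x. \<Sum>i\<in>A. x i" "\<lambda>x. \<Sum>i\<in>B. x i"]) (auto simp: isum_def)

text \<open>As \<open>\<phi> 0 = 0\<close>, this is the height of the chord of \<phi> over [0, t]
  above the graph at the midpoint.\<close>

definition gap :: real where "gap = \<phi> t / 2 - \<phi> (t / 2)"

text \<open>The variance of \<open>exp (t / 2 * X 0 \<omega>)\<close> equals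
  \<open>mom 0 t - (mom 0 (t / 2))\<^sup>2\<close>, and it is positive because \<open>X 0\<close> is
  not almost surely constant.\<close>

lemma gap_pos: "0 < gap"
proof -
  define e where "e = mom 0 (t / 2)"
  have e0: "0 < e"
    using mom_0_pos[of "t / 2"] t_pos by (simp add: e_def)
  have sq: "(exp (t / 2 * X 0 \<omega>) - e)\<^sup>2 = exp (t * X 0 \<omega>) - 2 * e * exp (t / 2 * X 0 \<omega>) + e\<^sup>2" for \<omega>
    by (simp add: power2_diff mult_ac flip: exp_add exp_of_nat_mult exp_double)
  have i1: "integrable M (\<lambda>\<omega>. exp (t * X 0 \<omega>))" and i2: "integrable M (\<lambda>\<omega>. exp (t / 2 * X 0 \<omega>))"
    using mgf[of t] mgf[of "t / 2"] t_pos by auto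
  have int: "integrable M (\<lambda>\<omega>. (exp (t / 2 * X 0 \<omega>) - e)\<^sup>2)"
    unfolding sq using i1 i2 by auto
  have "(\<integral>\<omega>. (exp (t / 2 * X 0 \<omega>) - e)\<^sup>2 \<partial>M) = mom 0 t - 2 * e * e + e\<^sup>2"
  proof -
    have "has_bochner_integral M (\<lambda>\<omega>. exp (t * X 0 \<omega>) - 2 * e * exp (t / 2 * X 0 \<omega>) + e\<^sup>2) (mom 0 t - 2 * e * e + e\<^sup>2)"
    proof (intro has_bochner_integral_add has_bochner_integral_diff has_bochner_integral_mult_right)
      show "has_bochner_integral M (\<lambda>\<omega>. exp (t * X 0 \<omega>)) (mom 0 t)"
        "has_bochner_integral M (\<lambda>\<omega>. exp (t / 2 * X 0 \<omega>)) e"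
        using has_bochner_integral_integrable[OF i1] has_bochner_integral_integrable[OF i2] by (simp_all add: mom_def e_def)
      show "has_bochner_integral M (\<lambda>_. e\<^sup>2) (e\<^sup>2)"
        by (simp add: has_bochner_integral_iff prob_space)
    qed
    then show ?thesis
      unfolding sq by (rule has_bochner_integral_integral_eq)
  qed
  moreover have "(\<integral>\<omega>. (exp (t / 2 * X 0 \<omega>) - e)\<^sup>2 \<partial>M) \<noteq> 0"
  proof
    assume "(\<integral>\<omega>. (exp (t / 2 * X 0 \<omega>) - e)\<^sup>2 \<partial>M) = 0"
    then have "AE \<omega> in M. (exp (t / 2 * X 0 \<omega>) - e)\<^sup>2 = 0"
      using integral_nonneg_eq_0_iff_AE[OF int] by simp
    then have "AE \<omega> in M. X 0 \<omega> = ln e / (t / 2)"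
    proof eventually_elim
      case (elim \<omega>)
      then have "ln e = ln (exp (t / 2 * X 0 \<omega>))"
        by simp
      then show ?case
        using t_pos by (simp add: field_simps)
    qed
    then show False
      using not_AE_const by blast
  qed
  moreover have "(\<integral>\<omega>. (exp (t / 2 * X 0 \<omega>) - e)\<^sup>2 \<partial>M) \<ge> 0"
    by (intro Bochner_Integration.integral_nonneg) simp
  ultimately have "e\<^sup>2 < mom 0 t"
    by (simp add: power2_eq_square)
  then have "exp (2 * \<phi> (t / 2)) < exp (\<phi> t)"
    using t_pos by (simp add: exp_double exp_cgf e_def)
  then show ?thesis
    by (simp add: gap_def)
qed

text \<open>On the intersection, the common part exceeds the average of the two remaining requirements;
  each point of the symmetric difference then costs a factor \<open>exp (- gap)\<close>.\<close>

lemma pair_bound: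
  "\<exists>K>0. \<forall>I J a b. finite I \<longrightarrow> finite J \<longrightarrow>
    sqrt (real (card (I \<inter> J))) * prob {\<omega> \<in> space M. a < isum I \<omega> \<and> b < isum J \<omega>} \<le>
    K * exp ((real (card I) * \<phi> t - t * a) / 2 + (real (card J) * \<phi> t - t * b) / 2 - gap * real (card (I - J) + card (J - I)))"
proof -
  obtain K where K: "K > 0" and Kb: "\<And>A z. finite A \<Longrightarrow>
      sqrt (real (card A)) * prob {\<omega> \<in> space M. z < isum A \<omega>} \<le> K * exp (real (card A) * \<phi> t - t * z)"
    using tail_bound by auto
  have "sqrt (real (card (I \<inter> J))) * prob {\<omega> \<in> space M. a < isum I \<omega> \<and> b < isum J \<omega>} \<le>
    K * exp ((real (card I) * \<phi> t - t * a) / 2 + (real (card J) * \<phi> t - t * b) / 2 - gap * real (card (I - J) + card (J - I)))"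
    if fin: "finite I" "finite J" for I J a b
  proof (cases "card (I \<inter> J) = 0")
    case False
    define c where "c = real (card (I \<inter> J))"
    have c: "c > 0"
      using False by (simp add: c_def)
    define U where "U = (I - J) \<union> (J - I)"
    have "card U = card (I - J) + card (J - I)"
      unfolding U_def using fin by (intro card_Un_disjoint) auto
    then have U: "finite U" "card U = card (I - J) + card (J - I)" "U \<inter> (I \<inter> J) = {}"
      using fin by (auto simp: U_def)
    define Y where "Y \<omega> = (a + b - isum U \<omega>) / 2" for \<omega>
    have "indep_var borel Y borel (isum (I \<inter> J))"
      by (rule indep_var_functions[of U "I \<inter> J" "\<lambda>x. (a + b - (\<Sum>i\<in>U. x i)) / 2" "\<lambda>x. \<Sum>i\<in>I \<inter> J. x i"])
         (use U in \<open>auto simp: isum_def Y_def\<close>)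
    have eqI: "isum I \<omega> = isum (I - J) \<omega> + isum (I \<inter> J) \<omega>" for \<omega>
    proof -
      have "I = (I - J) \<union> (I \<inter> J)" by auto
      then show ?thesis
        using fin isum_Un[of "I - J" "I \<inter> J" \<omega>] by auto
    qed
    have eqJ: "isum J \<omega> = isum (J - I) \<omega> + isum (I \<inter> J) \<omega>" for \<omega>
    proof -
      have "J = (J - I) \<union> (I \<inter> J)" by auto
      then show ?thesis
        using fin isum_Un[of "J - I" "I \<inter> J" \<omega>] by auto
    qed
    have eqU: "isum U \<omega> = isum (I - J) \<omega> + isum (J - I) \<omega>" for \<omega>
      unfolding U_def using fin by (intro isum_Un) auto
    \<comment> \<open>The factor 1/2 in \<open>Y\<close> turns the tilt \<open>t\<close> into t / 2
      on the symmetric difference, where each point contributes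
      \<open>exp (\<phi> (t / 2))\<close>.\<close>
    have eF: "K / sqrt c * exp (c * \<phi> t - t * Y \<omega>) = K / sqrt c * exp (c * \<phi> t - t * (a + b) / 2) * exp (t / 2 * isum U \<omega>)" for \<omega>
      by (simp add: Y_def field_simps flip: exp_add)
    have t2: "0 \<le> t / 2"
      using t_pos by simp
    have "prob {\<omega> \<in> space M. a < isum I \<omega> \<and> b < isum J \<omega>} \<le> prob {\<omega> \<in> space M. Y \<omega> < isum (I \<inter> J) \<omega>}"
      by (intro finite_measure_mono) (auto simp: Y_def[abs_def] eqI eqJ eqU field_simps)
    also have "\<dots> \<le> (\<integral>\<omega>. K / sqrt c * exp (c * \<phi> t - t * Y \<omega>) \<partial>M)"
    proof (rule prob_less_indep_le[OF \<open>indep_var borel Y borel (isum (I \<inter> J))\<close>])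
      show "prob {\<omega>' \<in> space M. y < isum (I \<inter> J) \<omega>'} \<le> K / sqrt c * exp (c * \<phi> t - t * y)" for y
        using Kb[of "I \<inter> J" y] fin c by (simp add: c_def field_simps)
      show "integrable M (\<lambda>\<omega>. K / sqrt c * exp (c * \<phi> t - t * Y \<omega>))"
        unfolding eF by (intro integrable_mult_right integrable_exp_isum[OF U(1) t2])
    qed
    also have "\<dots> = K / sqrt c * (exp (c * \<phi> t - t * (a + b) / 2) * exp (real (card U) * \<phi> (t / 2)))"
      unfolding eF integral_mult_right_zero expectation_exp_isum[OF U(1) t2] by simp
    also have "exp (c * \<phi> t - t * (a + b) / 2) * exp (real (card U) * \<phi> (t / 2)) =
      exp ((real (card I) * \<phi> t - t * a) / 2 + (real (card J) * \<phi> t - t * b) / 2 - gap * real (card (I - J) + card (J - I)))"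
    proof -
      have "card I = card (I \<inter> J) + card (I - J)" "card J = card (I \<inter> J) + card (J - I)"
        using fin card_Int_Diff[of I J] card_Int_Diff[of J I] by (auto simp: Int_commute)
      then show ?thesis
        unfolding exp_add[symmetric] U(2) by (simp add: gap_def c_def field_simps)
    qed
    finally show ?thesis
      using c by (simp add: c_def field_simps)
  qed (use K in simp)
  with K show ?thesis
    by blast
qed

lemma prob_disjoint_pair:
  assumes "I \<inter> J = {}"
  shows "prob {\<omega> \<in> space M. a < isum I \<omega> \<and> b < isum J \<omega>} =
    prob {\<omega> \<in> space M. a < isum I \<omega>} * prob {\<omega> \<in> space M. b < isum J \<omega>}"
  using prob_indep_random_variable[OF indep_isum[OF assms], of "{a<..}" "{b<..}"] by simp


section \<open>Cells of exceedances\<close>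

definition hmax :: "nat \<Rightarrow> real" where
  "hmax B = (\<integral>\<omega>. Max ((\<lambda>k. exp (t * psum X k \<omega> - real k * \<phi> t)) ` {0..B}) \<partial>M)"

text \<open>The core is \<open>{B..<B + l}\<close>, extended by \<open>a\<close> to the left and by
  \<open>b\<close> to the right. Starting at \<open>B\<close> leaves room for the left extension
  inside the natural numbers.\<close>

definition cell :: "real \<Rightarrow> nat \<Rightarrow> nat \<Rightarrow> 'a set" where
  "cell u l B = {\<omega> \<in> space M. \<exists>a\<le>B. \<exists>b\<le>B. u * sqrt (real (l + a + b)) < isum {B - a..<B + l + b} \<omega>}"

text \<open>A maximum of finitely many positive terms is at most their sum.\<close>

lemma integrable_Max_exp:
  assumes I: "finite I" "I \<noteq> {}" and S: "\<And>k. k \<in> I \<Longrightarrow> finite (S k)"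
  shows "integrable M (\<lambda>\<omega>. Max ((\<lambda>k. exp (t * isum (S k) \<omega> - c k)) ` I))"
proof (rule Bochner_Integration.integrable_bound)
  have "integrable M (\<lambda>\<omega>. exp (t * isum (S k) \<omega>) * exp (- c k))" if "k \<in> I" for k
    using integrable_exp_isum[OF S[OF that], of t] t_pos by (intro integrable_mult_left) auto
  then show "integrable M (\<lambda>\<omega>. \<Sum>k\<in>I. exp (t * isum (S k) \<omega>) * exp (- c k))"
    by (rule Bochner_Integration.integrable_sum)
  show "(\<lambda>\<omega>. Max ((\<lambda>k. exp (t * isum (S k) \<omega> - c k)) ` I)) \<in> borel_measurable M"
    using I by (intro borel_measurable_Max) auto
  show "AE \<omega> in M. norm (Max ((\<lambda>k. exp (t * isum (S k) \<omega> - c k)) ` I)) \<le>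
      norm (\<Sum>k\<in>I. exp (t * isum (S k) \<omega>) * exp (- c k))"
  proof (rule AE_I2)
    fix \<omega>
    obtain k where k: "k \<in> I" "Max ((\<lambda>k. exp (t * isum (S k) \<omega> - c k)) ` I) = exp (t * isum (S k) \<omega> - c k)"
      using Max_in[of "(\<lambda>k. exp (t * isum (S k) \<omega> - c k)) ` I"] I by (metis (no_types, lifting) finite_imageI image_iff image_is_empty)
    have "exp (t * isum (S k) \<omega> - c k) = exp (t * isum (S k) \<omega>) * exp (- c k)"
      by (simp flip: exp_add)
    also have "\<dots> \<le> (\<Sum>k\<in>I. exp (t * isum (S k) \<omega>) * exp (- c k))"
      using I k by (intro member_le_sum) auto
    finally show "norm (Max ((\<lambda>k. exp (t * isum (S k) \<omega> - c k)) ` I)) \<le>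
      norm (\<Sum>k\<in>I. exp (t * isum (S k) \<omega>) * exp (- c k))"
      unfolding k(2) by simp
  qed
qed

lemma hmax_measurable:
  "(\<lambda>x. Max ((\<lambda>k. exp (t * (\<Sum>i<k. x i) - real k * c)) ` {0..B})) \<in> borel_measurable (Pi\<^sub>M UNIV (\<lambda>_. borel))"
  by (intro borel_measurable_Max) auto

lemma expectation_Max_right:
  "(\<integral>\<omega>. Max ((\<lambda>b. exp (t * isum {m..<m + b} \<omega> - real b * \<phi> t)) ` {0..B}) \<partial>M) = hmax B"
proof -
  have "inj (\<lambda>i::nat. i + m)"
    by (auto simp: inj_def)
  from expectation_reindex[OF this hmax_measurable[of "\<phi> t" B]] show ?thesis
    unfolding hmax_def psum_def isum_def
    by (simp add: sum.shift_bounds_nat_ivl[of _ 0 m, simplified] add.commute lessThan_atLeast0)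
qed

text \<open>Reversing the order of the first \<open>B\<close> increments turns sums ending at
  \<open>B\<close> into initial sums.\<close>

lemma expectation_Max_left:
  "(\<integral>\<omega>. Max ((\<lambda>a. exp (t * isum {B - a..<B} \<omega> - real a * \<phi> t)) ` {0..B}) \<partial>M) = hmax B"
proof -
  define f where "f i = (if i < B then B - 1 - i else i)" for i
  have "inj f"
    by (auto simp: inj_def f_def split: if_splits)
  have "(\<Sum>i<a. X (f i) \<omega>) = isum {B - a..<B} \<omega>" if "a \<le> B" for a \<omega>
    unfolding isum_def f_def using that
    by (intro sum.reindex_bij_witness[of _ "\<lambda>i. B - 1 - i" "\<lambda>i. B - 1 - i"]) auto
  then have "(\<lambda>a. exp (t * (\<Sum>i<a. X (f i) \<omega>) - real a * \<phi> t)) ` {0..B} =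
      (\<lambda>a. exp (t * isum {B - a..<B} \<omega> - real a * \<phi> t)) ` {0..B}" for \<omega>
    by (intro image_cong) auto
  with expectation_reindex[OF \<open>inj f\<close> hmax_measurable[of "\<phi> t" B]] show ?thesis
    unfolding hmax_def psum_def by simp
qed

text \<open>Permuting the coordinates moves the core of the cell away from its two ends, whose positions then
  no longer depend on \<open>l\<close>.\<close>

lemma prob_cell:
  "prob (cell u l B) = prob {\<omega> \<in> space M. \<exists>a\<le>B. \<exists>b\<le>B. u * sqrt (real (l + a + b)) <
    isum {B - a..<B} \<omega> + isum {2 * B..<2 * B + l} \<omega> + isum {B..<B + b} \<omega>}"
proof -
  \<comment> \<open>The first \<open>B\<close> indices stay, the core moves up by \<open>B\<close>,
    and the right window moves down by \<open>l\<close> into the place of the core.\<close>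
  define f where "f i = (if i < B then i else if i < B + l then i + B else if i < 2 * B + l then i - l else i)" for i
  define P where "P x \<longleftrightarrow> (\<exists>a\<le>B. \<exists>b\<le>B. u * sqrt (real (l + a + b)) < (\<Sum>i=B - a..<B + l + b. x i))" for x :: "nat \<Rightarrow> real"
  have "inj f"
    unfolding inj_def f_def by (auto split: if_splits)
  have [measurable]: "Measurable.pred (Pi\<^sub>M UNIV (\<lambda>_. borel)) P"
    unfolding P_def by measurable
  have split: "(\<Sum>i=B - a..<B + l + b. X (f i) \<omega>) = isum {B - a..<B} \<omega> + isum {2 * B..<2 * B + l} \<omega> + isum {B..<B + b} \<omega>"
    if "b \<le> B" for a b \<omega>
  proof -
    have "(\<Sum>i=B - a..<B + l + b. X (f i) \<omega>) =
      (\<Sum>i=B - a..<B. X (f i) \<omega>) + (\<Sum>i=B..<B + l. X (f i) \<omega>) + (\<Sum>i=B + l..<B + l + b. X (f i) \<omega>)"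
      by (simp add: sum.atLeastLessThan_concat)
    also have "(\<Sum>i=B - a..<B. X (f i) \<omega>) = isum {B - a..<B} \<omega>"
      unfolding isum_def by (intro sum.cong) (auto simp: f_def)
    also have "(\<Sum>i=B..<B + l. X (f i) \<omega>) = isum {2 * B..<2 * B + l} \<omega>"
    proof -
      have "(\<Sum>i=B..<B + l. X (f i) \<omega>) = (\<Sum>i=B..<B + l. X (i + B) \<omega>)"
        by (intro sum.cong) (auto simp: f_def)
      also have "\<dots> = (\<Sum>i=B + B..<B + l + B. X i \<omega>)"
        by (rule sum.shift_bounds_nat_ivl[symmetric])
      finally show ?thesis
        by (simp add: isum_def add_ac mult_2)
    qed
    also have "(\<Sum>i=B + l..<B + l + b. X (f i) \<omega>) = isum {B..<B + b} \<omega>"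
    proof -
      have "(\<Sum>i=B + l..<B + l + b. X (f i) \<omega>) = (\<Sum>i=B + l..<B + b + l. X (i - l) \<omega>)"
        using that by (intro sum.cong) (auto simp: f_def)
      also have "\<dots> = (\<Sum>i=B..<B + b. X (i + l - l) \<omega>)"
        by (rule sum.shift_bounds_nat_ivl)
      finally show ?thesis
        by (simp add: isum_def)
    qed
    finally show ?thesis .
  qed
  have "prob (cell u l B) = prob {\<omega> \<in> space M. P (\<lambda>i. X i \<omega>)}"
    by (simp add: cell_def P_def isum_def)
  also have "\<dots> = prob {\<omega> \<in> space M. P (\<lambda>i. X (f i) \<omega>)}"
    by (rule prob_reindex[OF \<open>inj f\<close>, symmetric]) measurable
  also have "{\<omega> \<in> space M. P (\<lambda>i. X (f i) \<omega>)} = {\<omega> \<in> space M. \<exists>a\<le>B. \<exists>b\<le>B. u * sqrt (real (l + a + b)) <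
    isum {B - a..<B} \<omega> + isum {2 * B..<2 * B + l} \<omega> + isum {B..<B + b} \<omega>}"
    unfolding P_def using split by (intro Collect_cong conj_cong refl ex_cong1) auto
  finally show ?thesis .
qed

text \<open>As a function of the length, the level \<open>u * sqrt l\<close> has slope
  \<open>u / (2 * sqrt l)\<close>; this supplies the limit of \<open>\<delta>\<close> in the next
  proof.\<close>

lemma sqrt_increment:
  "((\<lambda>x::real. (sqrt (x + c) - sqrt x) * (2 * sqrt x)) \<longlongrightarrow> c) at_top"
  by real_asymp

text \<open>Given the two end windows, the core must exceed \<open>Y n\<close>, the level lowered by
  the best net contribution \<open>y n\<close> of the ends. For fixed \<omega> this contribution
  converges, so the tail of the core gains the factor \<open>exp (t * y n \<omega>)\<close>; its
  limit integrates to the product of the two expected maxima. The last hypothesis says that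
  extending the core by \<open>a + b\<close> points raises the threshold by about
  \<open>(a + b) * \<phi> t / t\<close>.\<close>

theorem cell_asymp:
  fixes u :: "nat \<Rightarrow> real" and l :: "nat \<Rightarrow> nat"
  assumes u: "\<And>n. 0 \<le> u n" and l: "filterlim l at_top sequentially"
    and \<rho>: "(\<lambda>n. u n - sqrt (real (l n)) * \<mu>) \<longlonglongrightarrow> \<rho>"
    and \<kappa>: "(\<lambda>n. u n / (2 * sqrt (real (l n)))) \<longlonglongrightarrow> \<phi> t / t"
  shows "(\<lambda>n. sqrt (real (l n)) * exp (t * (u n * sqrt (real (l n))) - real (l n) * \<phi> t) * prob (cell (u n) (l n) B))
    \<longlonglongrightarrow> exp (- \<rho>\<^sup>2 / (2 * \<sigma>2)) / (\<sigma> * sqrt (2 * pi) * t) * (hmax B)\<^sup>2"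
proof -
  define C where "C = exp (- \<rho>\<^sup>2 / (2 * \<sigma>2)) / (\<sigma> * sqrt (2 * pi) * t)"
  define w where "w n = sqrt (real (l n)) * exp (t * (u n * sqrt (real (l n))) - real (l n) * \<phi> t)" for n
  define I where "I = {0..B} \<times> {0..B}"
  have I: "finite I" "I \<noteq> {}"
    by (auto simp: I_def)
  define S where "S = (\<lambda>(a, b). {B - a..<B + b})"
  define \<delta> where "\<delta> n = (\<lambda>(a, b). u n * (sqrt (real (l n + a + b)) - sqrt (real (l n))))" for n
  define y where "y n \<omega> = Max ((\<lambda>p. isum (S p) \<omega> - \<delta> n p) ` I)" for n \<omega>
  define y' where "y' \<omega> = Max ((\<lambda>(a, b). isum (S (a, b)) \<omega> - real (a + b) * (\<phi> t / t)) ` I)" for \<omega>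
  define core where "core n = isum {2 * B..<2 * B + l n}" for n
  define Y where "Y n \<omega> = u n * sqrt (real (l n)) - y n \<omega>" for n \<omega>
  have rt: "filterlim (\<lambda>n. sqrt (real (l n))) at_top sequentially"
    using l by (intro filterlim_compose[OF sqrt_at_top] filterlim_compose[OF filterlim_real_sequentially])
  have ev: "eventually (\<lambda>n. 0 < l n) sequentially"
    using l unfolding filterlim_at_top by (auto dest!: spec[of _ 1] elim!: eventually_mono)
  have Ssplit: "isum (S (a, b)) \<omega> = isum {B - a..<B} \<omega> + isum {B..<B + b} \<omega>" for a b \<omega>
    unfolding S_def isum_def by (simp add: sum.atLeastLessThan_concat)
  have \<delta>0: "0 \<le> \<delta> n p" for n p
    unfolding \<delta>_def using u by (auto split: prod.split)
  have prob: "prob (cell (u n) (l n) B) = prob {\<omega> \<in> space M. Y n \<omega> < core n \<omega>}" for n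
  proof -
    have "(\<exists>a\<le>B. \<exists>b\<le>B. u n * sqrt (real (l n + a + b)) < isum {B - a..<B} \<omega> + core n \<omega> + isum {B..<B + b} \<omega>)
      \<longleftrightarrow> Y n \<omega> < core n \<omega>" for \<omega>
    proof -
      have "Y n \<omega> < core n \<omega> \<longleftrightarrow> u n * sqrt (real (l n)) - core n \<omega> < y n \<omega>"
        by (auto simp: Y_def)
      also have "\<dots> \<longleftrightarrow> (\<exists>p\<in>I. u n * sqrt (real (l n)) - core n \<omega> < isum (S p) \<omega> - \<delta> n p)"
        unfolding y_def using I by (subst Max_gr_iff) auto
      also have "\<dots> \<longleftrightarrow> (\<exists>a\<le>B. \<exists>b\<le>B. u n * sqrt (real (l n + a + b)) < isum {B - a..<B} \<omega> + core n \<omega> + isum {B..<B + b} \<omega>)"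
        unfolding I_def by (auto simp: Ssplit \<delta>_def right_diff_distrib algebra_simps Bex_def)
      finally show ?thesis by simp
    qed
    then show ?thesis
      unfolding prob_cell core_def[symmetric] by simp
  qed
  have indY: "indep_var borel (Y n) borel (core n)" for n
  proof (rule indep_var_functions[of "{..<2 * B}" "{2 * B..<2 * B + l n}"
      "\<lambda>x. u n * sqrt (real (l n)) - Max ((\<lambda>p. (\<Sum>i\<in>S p. x i) - \<delta> n p) ` I)" "\<lambda>x. \<Sum>i=2 * B..<2 * B + l n. x i"])
    have sub: "S p \<subseteq> {..<2 * B}" if "p \<in> I" for p
      using that by (auto simp: S_def I_def)
    show "(\<lambda>x. u n * sqrt (real (l n)) - Max ((\<lambda>p. (\<Sum>i\<in>S p. x i) - \<delta> n p) ` I)) \<in> borel_measurable (Pi\<^sub>M {..<2 * B} (\<lambda>_. borel))"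
      using sub I(1) by (intro borel_measurable_diff borel_measurable_const borel_measurable_Max sum_measurable_PiM) auto
    have "(\<lambda>p. isum (S p) \<omega> - \<delta> n p) ` I = (\<lambda>p. (\<Sum>i\<in>S p. (\<lambda>i\<in>{..<2 * B}. X i \<omega>) i) - \<delta> n p) ` I" for \<omega>
      using sub by (intro image_cong refl arg_cong2[where f = minus] isum_eq_restrict)
    then show "Y n \<omega> = u n * sqrt (real (l n)) - Max ((\<lambda>p. (\<Sum>i\<in>S p. (\<lambda>i\<in>{..<2 * B}. X i \<omega>) i) - \<delta> n p) ` I)" for \<omega>
      unfolding Y_def y_def by simp
    show "core n \<omega> = (\<Sum>i=2 * B..<2 * B + l n. (\<lambda>i\<in>{2 * B..<2 * B + l n}. X i \<omega>) i)" for \<omega>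
      unfolding core_def by (rule isum_eq_restrict) simp
  qed auto
  define G where "G n \<omega> = w n * prob {\<omega>' \<in> space M. Y n \<omega> < core n \<omega>'}" for n \<omega>
  have Y_meas [measurable]: "Y n \<in> borel_measurable M" for n
    using indep_var_rv1[OF indY] .
  \<comment> \<open>Measurability is obtained from monotonicity in the level.\<close>
  have prob_meas [measurable]: "(\<lambda>y. prob {\<omega>' \<in> space M. y < core n \<omega>'}) \<in> borel_measurable borel" for n
  proof -
    have "antimono (\<lambda>y. prob {\<omega>' \<in> space M. y < core n \<omega>'})"
      unfolding core_def by (intro antimonoI finite_measure_mono) auto
    then have "mono (\<lambda>y. - prob {\<omega>' \<in> space M. y < core n \<omega>'})"
      by (auto simp: antimono_def mono_def)
    then have "(\<lambda>y. - prob {\<omega>' \<in> space M. y < core n \<omega>'}) \<in> borel_measurable borel"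
      by (rule borel_measurable_mono)
    then show ?thesis
      by simp
  qed
  \<comment> \<open>The contribution of the ends is split off; what remains is the normalised tail
    of the core at the level \<open>Y n \<omega>\<close>.\<close>
  have eqG: "G n \<omega> = exp (t * y n \<omega>) * (sqrt (real (l n)) * exp (t * Y n \<omega> - real (l n) * \<phi> t) * prob {\<omega>' \<in> space M. Y n \<omega> < core n \<omega>'})" for n \<omega>
    unfolding G_def w_def Y_def by (simp add: algebra_simps flip: exp_add)
  obtain K where K: "K > 0" and Kb: "\<And>A z. finite A \<Longrightarrow>
      sqrt (real (card A)) * prob {\<omega> \<in> space M. z < isum A \<omega>} \<le> K * exp (real (card A) * \<phi> t - t * z)"
    using tail_bound by auto
  \<comment> \<open>Dropping the nonnegative \<open>\<delta>\<close> gives a majorant independent of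
    \<open>n\<close>; it is integrable since only finitely many windows occur.\<close>
  define W where "W \<omega> = Max ((\<lambda>p. exp (t * isum (S p) \<omega> - 0)) ` I) * K" for \<omega>
  have lim: "(\<lambda>n. \<integral>\<omega>. G n \<omega> \<partial>M) \<longlonglongrightarrow> (\<integral>\<omega>. exp (t * y' \<omega>) * C \<partial>M)"
  proof (rule integral_dominated_convergence[where w = W])
    show "integrable M W"
      unfolding W_def by (intro integrable_mult_left integrable_Max_exp I) (auto simp: S_def)
    show "G n \<in> borel_measurable M" for n
      unfolding G_def by measurable
    show "(\<lambda>\<omega>. exp (t * y' \<omega>) * C) \<in> borel_measurable M"
      unfolding y'_def using I
      by (intro borel_measurable_times borel_measurable_exp[THEN measurable_compose_rev] borel_measurable_const borel_measurable_Max) auto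
    show "AE \<omega> in M. norm (G n \<omega>) \<le> W \<omega>" for n
    proof (rule AE_I2)
      fix \<omega>
      have "exp (t * y n \<omega>) \<le> Max ((\<lambda>p. exp (t * isum (S p) \<omega> - 0)) ` I)"
      proof -
        obtain p where p: "p \<in> I" "y n \<omega> = isum (S p) \<omega> - \<delta> n p"
          using Max_in[of "(\<lambda>p. isum (S p) \<omega> - \<delta> n p) ` I"] I unfolding y_def
          by (metis (no_types, lifting) finite_imageI image_iff image_is_empty)
        have "exp (t * y n \<omega>) \<le> exp (t * isum (S p) \<omega> - 0)"
          using t_pos \<delta>0[of n p] by (simp add: p)
        also have "\<dots> \<le> Max ((\<lambda>p. exp (t * isum (S p) \<omega> - 0)) ` I)"
          using I p by (intro Max_ge) auto
        finally show ?thesis .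
      qed
      moreover have "sqrt (real (l n)) * exp (t * Y n \<omega> - real (l n) * \<phi> t) * prob {\<omega>' \<in> space M. Y n \<omega> < core n \<omega>'} \<le> K"
      proof -
        have "sqrt (real (l n)) * prob {\<omega>' \<in> space M. Y n \<omega> < core n \<omega>'} \<le> K * exp (real (l n) * \<phi> t - t * Y n \<omega>)"
          using Kb[of "{2 * B..<2 * B + l n}" "Y n \<omega>"] by (simp add: core_def)
        then have "sqrt (real (l n)) * prob {\<omega>' \<in> space M. Y n \<omega> < core n \<omega>'} * exp (t * Y n \<omega> - real (l n) * \<phi> t)
          \<le> K * exp (real (l n) * \<phi> t - t * Y n \<omega>) * exp (t * Y n \<omega> - real (l n) * \<phi> t)"
          by (rule mult_right_mono) simp
        also have "\<dots> = K"
          by (simp add: mult.assoc flip: exp_add)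
        finally show ?thesis
          by (simp add: mult_ac)
      qed
      ultimately have "G n \<omega> \<le> W \<omega>"
        unfolding eqG W_def by (intro mult_mono) (auto intro: order_trans[OF exp_ge_zero])
      moreover have "0 \<le> G n \<omega>"
        unfolding G_def w_def by simp
      ultimately show "norm (G n \<omega>) \<le> W \<omega>"
        by simp
    qed
    show "AE \<omega> in M. (\<lambda>n. G n \<omega>) \<longlonglongrightarrow> exp (t * y' \<omega>) * C"
    proof (rule AE_I2)
      fix \<omega>
      have "(\<lambda>n. \<delta> n (a, b)) \<longlonglongrightarrow> real (a + b) * (\<phi> t / t)" for a b
      proof -
        have "(\<lambda>n. (sqrt (real (l n) + real (a + b)) - sqrt (real (l n))) * (2 * sqrt (real (l n)))) \<longlonglongrightarrow> real (a + b)"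
          by (rule filterlim_compose[OF sqrt_increment]) (rule filterlim_compose[OF filterlim_real_sequentially l])
        from tendsto_mult[OF this \<kappa>] show ?thesis
          by (rule Lim_transform_eventually) (use ev in \<open>auto simp: \<delta>_def add.assoc elim!: eventually_mono\<close>)
      qed
      then have y_lim: "(\<lambda>n. y n \<omega>) \<longlonglongrightarrow> y' \<omega>"
        unfolding y_def y'_def by (intro tendsto_Max_image I) (auto intro!: tendsto_intros)
      have "(\<lambda>n. (Y n \<omega> - real (l n) * \<mu>) / sqrt (real (l n))) \<longlonglongrightarrow> \<rho> - 0"
      proof (rule Lim_transform_eventually)
        show "(\<lambda>n. (u n - sqrt (real (l n)) * \<mu>) - y n \<omega> / sqrt (real (l n))) \<longlonglongrightarrow> \<rho> - 0"
          by (intro tendsto_diff \<rho> real_tendsto_divide_at_top[OF y_lim rt])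
        show "eventually (\<lambda>n. (u n - sqrt (real (l n)) * \<mu>) - y n \<omega> / sqrt (real (l n)) = (Y n \<omega> - real (l n) * \<mu>) / sqrt (real (l n))) sequentially"
          using ev
        proof eventually_elim
          case (elim n)
          then have "real (l n) / sqrt (real (l n)) = sqrt (real (l n))"
            by (simp add: real_div_sqrt)
          then have "real (l n) * \<mu> / sqrt (real (l n)) = sqrt (real (l n)) * \<mu>"
            by (metis times_divide_eq_left)
          with elim show ?case
            by (simp add: Y_def diff_divide_distrib)
        qed
      qed
      then have "(\<lambda>n. sqrt (real (l n)) * exp (t * Y n \<omega> - real (l n) * \<phi> t) * prob {\<omega>' \<in> space M. Y n \<omega> < core n \<omega>'}) \<longlonglongrightarrow> C"
        using tail_asymp[of "\<lambda>n. {2 * B..<2 * B + l n}" "\<lambda>n. Y n \<omega>" \<rho>] l by (simp add: core_def C_def)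
      then show "(\<lambda>n. G n \<omega>) \<longlonglongrightarrow> exp (t * y' \<omega>) * C"
        unfolding eqG by (intro tendsto_mult tendsto_exp tendsto_const y_lim)
    qed
  qed
  have intG: "(\<integral>\<omega>. G n \<omega> \<partial>M) = w n * prob (cell (u n) (l n) B)" for n
    unfolding G_def prob prob_less_indep[OF indY] by simp
  have int': "(\<integral>\<omega>. exp (t * y' \<omega>) * C \<partial>M) = C * (hmax B)\<^sup>2"
  proof -
    define f where "f \<omega> = Max ((\<lambda>a. exp (t * isum {B - a..<B} \<omega> - real a * \<phi> t)) ` {0..B})" for \<omega>
    define g where "g \<omega> = Max ((\<lambda>b. exp (t * isum {B..<B + b} \<omega> - real b * \<phi> t)) ` {0..B})" for \<omega>
    \<comment> \<open>In the limit the cost of an extension is additive in \<open>a\<close> and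
      \<open>b\<close>, so the maximum splits into a left and a right part.\<close>
    have fg: "exp (t * y' \<omega>) = f \<omega> * g \<omega>" for \<omega>
    proof -
      have "y' \<omega> = Max ((\<lambda>(a, b). (isum {B - a..<B} \<omega> - real a * (\<phi> t / t)) + (isum {B..<B + b} \<omega> - real b * (\<phi> t / t))) ` I)"
        unfolding y'_def Ssplit by (intro arg_cong[where f = Max] image_cong) (auto simp: algebra_simps add_divide_distrib)
      also have "\<dots> = Max ((\<lambda>a. isum {B - a..<B} \<omega> - real a * (\<phi> t / t)) ` {0..B}) + Max ((\<lambda>b. isum {B..<B + b} \<omega> - real b * (\<phi> t / t)) ` {0..B})"
        unfolding I_def by (rule Max_add_Max) auto
      finally have "exp (t * y' \<omega>) = exp (t * Max ((\<lambda>a. isum {B - a..<B} \<omega> - real a * (\<phi> t / t)) ` {0..B})) *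
          exp (t * Max ((\<lambda>b. isum {B..<B + b} \<omega> - real b * (\<phi> t / t)) ` {0..B}))"
        by (simp add: distrib_left exp_add)
      moreover have "exp (t * Max (F ` {0..B})) = Max ((\<lambda>a. exp (t * F a)) ` {0..B})" for F :: "nat \<Rightarrow> real"
        using mono_Max_commute[of "\<lambda>x. exp (t * x)" "F ` {0..B}"] t_pos by (simp add: mono_def image_image)
      ultimately show ?thesis
        using t_pos by (simp add: f_def g_def right_diff_distrib)
    qed
    have ind: "indep_var borel f borel g"
    proof (rule indep_var_functions[of "{..<B}" "{B..<2 * B}"
        "\<lambda>x. Max ((\<lambda>a. exp (t * (\<Sum>i=B - a..<B. x i) - real a * \<phi> t)) ` {0..B})"
        "\<lambda>x. Max ((\<lambda>b. exp (t * (\<Sum>i=B..<B + b. x i) - real b * \<phi> t)) ` {0..B})"])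
      show "(\<lambda>x. Max ((\<lambda>a. exp (t * (\<Sum>i=B - a..<B. x i) - real a * \<phi> t)) ` {0..B})) \<in> borel_measurable (Pi\<^sub>M {..<B} (\<lambda>_. borel))"
      proof (intro borel_measurable_Max)
        fix a
        have [measurable]: "(\<lambda>x. \<Sum>i=B - a..<B. x i) \<in> borel_measurable (Pi\<^sub>M {..<B} (\<lambda>_. borel :: real measure))"
          by (rule sum_measurable_PiM) auto
        show "(\<lambda>x. exp (t * (\<Sum>i=B - a..<B. x i) - real a * \<phi> t)) \<in> borel_measurable (Pi\<^sub>M {..<B} (\<lambda>_. borel))"
          by measurable
      qed simp
      show "(\<lambda>x. Max ((\<lambda>b. exp (t * (\<Sum>i=B..<B + b. x i) - real b * \<phi> t)) ` {0..B})) \<in> borel_measurable (Pi\<^sub>M {B..<2 * B} (\<lambda>_. borel))"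
      proof (intro borel_measurable_Max)
        fix b assume "b \<in> {0..B}"
        then have [measurable]: "(\<lambda>x. \<Sum>i=B..<B + b. x i) \<in> borel_measurable (Pi\<^sub>M {B..<2 * B} (\<lambda>_. borel :: real measure))"
          by (intro sum_measurable_PiM) auto
        show "(\<lambda>x. exp (t * (\<Sum>i=B..<B + b. x i) - real b * \<phi> t)) \<in> borel_measurable (Pi\<^sub>M {B..<2 * B} (\<lambda>_. borel))"
          by measurable
      qed simp
      show "f \<omega> = Max ((\<lambda>a. exp (t * (\<Sum>i=B - a..<B. (\<lambda>i\<in>{..<B}. X i \<omega>) i) - real a * \<phi> t)) ` {0..B})" for \<omega>
        unfolding f_def by (subst isum_eq_restrict[of _ "{..<B}"]) auto
      show "g \<omega> = Max ((\<lambda>b. exp (t * (\<Sum>i=B..<B + b. (\<lambda>i\<in>{B..<2 * B}. X i \<omega>) i) - real b * \<phi> t)) ` {0..B})" for \<omega>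
        unfolding g_def by (intro arg_cong[where f = Max] image_cong) (auto simp: isum_eq_restrict[of _ "{B..<2 * B}"])
    qed auto
    have "(\<integral>\<omega>. f \<omega> * g \<omega> \<partial>M) = (\<integral>\<omega>. f \<omega> \<partial>M) * (\<integral>\<omega>. g \<omega> \<partial>M)"
      by (rule indep_var_lebesgue_integral[OF ind]) (simp_all add: f_def[abs_def] g_def[abs_def] integrable_Max_exp)
    also have "(\<integral>\<omega>. f \<omega> \<partial>M) = hmax B"
      unfolding f_def by (rule expectation_Max_left)
    also have "(\<integral>\<omega>. g \<omega> \<partial>M) = hmax B"
      unfolding g_def by (rule expectation_Max_right)
    finally show ?thesis
      unfolding fg by (simp add: power2_eq_square)
  qed
  show ?thesis
    using lim unfolding intG int' unfolding w_def C_def .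
qed

end

text \<open>Two geometric series, one on each side of \<open>i\<close>.\<close>

lemma sum_power_dist_le:
  fixes x :: real
  assumes "finite F" "0 \<le> x" "x < 1"
  shows "(\<Sum>k\<in>F. x ^ nat \<bar>int i - int k\<bar>) \<le> 2 / (1 - x)"
proof -
  have geo: "(\<Sum>k\<in>G. x ^ h k) \<le> 1 / (1 - x)" if "finite G" "inj_on h G" for G :: "nat set" and h :: "nat \<Rightarrow> nat"
  proof -
    have "(\<Sum>k\<in>G. x ^ h k) = (\<Sum>k\<in>h ` G. x ^ k)"
      using that by (simp add: sum.reindex)
    also have "\<dots> \<le> (\<Sum>k. x ^ k)"
      using assms that by (intro sum_le_suminf summable_geometric) auto
    also have "\<dots> = 1 / (1 - x)"
      using assms by (intro suminf_geometric) auto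
    finally show ?thesis .
  qed
  have "(\<Sum>k\<in>F. x ^ nat \<bar>int i - int k\<bar>) =
    (\<Sum>k\<in>F \<inter> {..i}. x ^ nat \<bar>int i - int k\<bar>) + (\<Sum>k\<in>F - {..i}. x ^ nat \<bar>int i - int k\<bar>)"
    using assms(1) by (subst sum.Int_Diff[of _ _ "{..i}"]) auto
  also have "\<dots> \<le> 1 / (1 - x) + 1 / (1 - x)"
    using assms(1) by (intro add_mono geo) (auto simp: inj_on_def)
  finally show ?thesis
    by simp
qed

section \<open>Blocks, coverings and separated cells\<close>

context iid_walk
begin

definition exceed :: "real \<Rightarrow> nat \<Rightarrow> nat \<Rightarrow> 'a set" where
  "exceed u i j = {\<omega> \<in> space M. u * sqrt (real (j - i)) < isum {i..<j} \<omega>}"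

text \<open>Both end points lie between \<open>a\<close> and \<open>b\<close>, so the event depends
  only on the increments with index in \<open>{a..<b}\<close>.\<close>

definition exc :: "real \<Rightarrow> nat set \<Rightarrow> nat \<Rightarrow> nat \<Rightarrow> 'a set" where
  "exc u \<Lambda> a b = {\<omega> \<in> space M. \<exists>i j. a \<le> i \<and> i < j \<and> j \<le> b \<and> j - i \<in> \<Lambda> \<and> \<omega> \<in> exceed u i j}"

text \<open>In the plane of pairs \<open>(i, j)\<close> this is the square with \<open>i\<close> in
  [r, r + B] and \<open>j\<close> in [r + B + l, r + 2 B + l].\<close>

definition cellat :: "nat \<Rightarrow> real \<Rightarrow> nat \<Rightarrow> nat \<Rightarrow> 'a set" where
  "cellat r u l B = {\<omega> \<in> space M. \<exists>a\<le>B. \<exists>b\<le>B. u * sqrt (real (l + a + b)) < isum {r + B - a..<r + B + l + b} \<omega>}"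

lemma exceed_events [measurable]: "exceed u i j \<in> events"
  unfolding exceed_def by measurable

lemma exc_events [measurable]: "exc u \<Lambda> a b \<in> events"
  unfolding exc_def by measurable

lemma cellat_events [measurable]: "cellat r u l B \<in> events"
  unfolding cellat_def by measurable

lemma prob_exc_shift: "prob (exc u \<Lambda> a (a + N)) = prob (exc u \<Lambda> 0 N)"
proof -
  define P where "P x \<longleftrightarrow> (\<exists>i j. i < j \<and> j \<le> N \<and> j - i \<in> \<Lambda> \<and> u * sqrt (real (j - i)) < (\<Sum>k=i..<j. x k))" for x :: "nat \<Rightarrow> real"
  have [measurable]: "Measurable.pred (Pi\<^sub>M UNIV (\<lambda>_. borel)) P"
    unfolding P_def by measurable
  have "P (\<lambda>i. X (i + a) \<omega>) \<longleftrightarrow> (\<exists>i j. a \<le> i \<and> i < j \<and> j \<le> a + N \<and> j - i \<in> \<Lambda> \<and> u * sqrt (real (j - i)) < isum {i..<j} \<omega>)" for \<omega>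
  proof
    assume "P (\<lambda>i. X (i + a) \<omega>)"
    then obtain i j where "i < j" "j \<le> N" "j - i \<in> \<Lambda>" "u * sqrt (real (j - i)) < (\<Sum>k=i..<j. X (k + a) \<omega>)"
      by (auto simp: P_def)
    then show "\<exists>i j. a \<le> i \<and> i < j \<and> j \<le> a + N \<and> j - i \<in> \<Lambda> \<and> u * sqrt (real (j - i)) < isum {i..<j} \<omega>"
      by (intro exI[of _ "i + a"] exI[of _ "j + a"]) (auto simp: isum_def sum.shift_bounds_nat_ivl)
  next
    assume "\<exists>i j. a \<le> i \<and> i < j \<and> j \<le> a + N \<and> j - i \<in> \<Lambda> \<and> u * sqrt (real (j - i)) < isum {i..<j} \<omega>"
    then obtain i j where ij: "a \<le> i" "i < j" "j \<le> a + N" "j - i \<in> \<Lambda>" "u * sqrt (real (j - i)) < isum {i..<j} \<omega>"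
      by auto
    have "isum {i..<j} \<omega> = (\<Sum>k=i - a..<j - a. X (k + a) \<omega>)"
      using ij sum.shift_bounds_nat_ivl[of "\<lambda>k. X k \<omega>" "i - a" a "j - a"] by (simp add: isum_def)
    with ij show "P (\<lambda>i. X (i + a) \<omega>)"
      unfolding P_def by (intro exI[of _ "i - a"] exI[of _ "j - a"]) auto
  qed
  then have "exc u \<Lambda> a (a + N) = {\<omega> \<in> space M. P (\<lambda>i. X (i + a) \<omega>)}"
    by (auto simp: exc_def exceed_def)
  moreover have "prob {\<omega> \<in> space M. P (\<lambda>i. X (i + a) \<omega>)} = prob {\<omega> \<in> space M. P (\<lambda>i. X i \<omega>)}"
    by (rule prob_reindex) (auto simp: inj_def)
  moreover have "exc u \<Lambda> 0 N = {\<omega> \<in> space M. P (\<lambda>i. X i \<omega>)}"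
    by (auto simp: exc_def P_def isum_def exceed_def)
  ultimately show ?thesis
    by simp
qed

lemma prob_cellat: "prob (cellat r u l B) = prob (cell u l B)"
proof -
  define P where "P x \<longleftrightarrow> (\<exists>a\<le>B. \<exists>b\<le>B. u * sqrt (real (l + a + b)) < (\<Sum>i=B - a..<B + l + b. x i))" for x :: "nat \<Rightarrow> real"
  have [measurable]: "Measurable.pred (Pi\<^sub>M UNIV (\<lambda>_. borel)) P"
    unfolding P_def by measurable
  have eq: "isum {r + B - a..<r + B + l + b} \<omega> = (\<Sum>i=B - a..<B + l + b. X (i + r) \<omega>)" if "a \<le> B" for a b \<omega>
    using that sum.shift_bounds_nat_ivl[of "\<lambda>k. X k \<omega>" "B - a" r "B + l + b"] by (simp add: isum_def add_ac)
  have "cellat r u l B = {\<omega> \<in> space M. P (\<lambda>i. X (i + r) \<omega>)}"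
    unfolding cellat_def P_def using eq by (intro Collect_cong conj_cong refl ex_cong1) auto
  moreover have "prob {\<omega> \<in> space M. P (\<lambda>i. X (i + r) \<omega>)} = prob {\<omega> \<in> space M. P (\<lambda>i. X i \<omega>)}"
    by (rule prob_reindex) (auto simp: inj_def)
  moreover have "cell u l B = {\<omega> \<in> space M. P (\<lambda>i. X i \<omega>)}"
    by (simp add: cell_def P_def isum_def)
  ultimately show ?thesis
    by simp
qed

text \<open>Distinct blocks use disjoint sets of increments, and translation makes their
  probabilities equal.\<close>

lemma prob_blocks:
  "prob {\<omega> \<in> space M. \<forall>r<R. \<omega> \<notin> exc u \<Lambda> (r * N) (r * N + N)} = (1 - prob (exc u \<Lambda> 0 N)) ^ R"
proof (cases "R = 0")
  case False
  define K where "K r = {r * N..<r * N + N}" for r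
  \<comment> \<open>Intersecting with \<open>K r\<close> leaves the admissible sums unchanged and
    makes every sum, admissible or not, a measurable function on the product space of the
    block.\<close>
  define P where "P r x \<longleftrightarrow> (\<exists>i j. r * N \<le> i \<and> i < j \<and> j \<le> r * N + N \<and> j - i \<in> \<Lambda> \<and> u * sqrt (real (j - i)) < (\<Sum>k\<in>{i..<j} \<inter> K r. x k))" for r and x :: "nat \<Rightarrow> real"
  define S where "S r = {x \<in> space (Pi\<^sub>M (K r) (\<lambda>_. borel)). \<not> P r x}" for r
  have disj: "disjoint_family_on K {..<R}"
    unfolding disjoint_family_on_def
  proof (intro ballI impI)
    fix r r' :: nat assume "r \<noteq> r'"
    then have "Suc r \<le> r' \<or> Suc r' \<le> r"
      by auto
    then have "r * N + N \<le> r' * N \<or> r' * N + N \<le> r * N"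
      using mult_le_mono1[of "Suc r" r' N] mult_le_mono1[of "Suc r'" r N] by auto
    then show "K r \<inter> K r' = {}"
      by (auto simp: K_def)
  qed
  have Smeas: "S r \<in> sets (Pi\<^sub>M (K r) (\<lambda>_. borel))" for r
  proof -
    have [measurable]: "(\<lambda>x. \<Sum>k\<in>{i..<j} \<inter> K r. x k) \<in> borel_measurable (Pi\<^sub>M (K r) (\<lambda>_. borel :: real measure))" for i j
      by (rule sum_measurable_PiM) auto
    show ?thesis
      unfolding S_def P_def by measurable
  qed
  have P_iff: "P r (\<lambda>i\<in>K r. X i \<omega>) \<longleftrightarrow> \<omega> \<in> exc u \<Lambda> (r * N) (r * N + N)" if "\<omega> \<in> space M" for r \<omega>
  proof -
    have "(\<Sum>k\<in>{i..<j} \<inter> K r. (\<lambda>i\<in>K r. X i \<omega>) k) = isum {i..<j} \<omega>" if "r * N \<le> i" "j \<le> r * N + N" for i j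
    proof -
      have "{i..<j} \<inter> K r = {i..<j}"
        using that by (auto simp: K_def)
      then show ?thesis
        using isum_eq_restrict[of "{i..<j}" "K r"] by (simp add: Int_absorb2 le_iff_inf)
    qed
    note eq = this
    have "P r (\<lambda>i\<in>K r. X i \<omega>) \<longleftrightarrow> (\<exists>i j. r * N \<le> i \<and> i < j \<and> j \<le> r * N + N \<and> j - i \<in> \<Lambda> \<and> u * sqrt (real (j - i)) < isum {i..<j} \<omega>)"
      unfolding P_def by (intro ex_cong1 conj_cong refl) (simp only: eq)
    then show ?thesis
      using that by (simp add: exc_def exceed_def)
  qed
  have "indep_vars (\<lambda>j. Pi\<^sub>M (K j) (\<lambda>_. borel)) (\<lambda>j \<omega>. \<lambda>i\<in>K j. X i \<omega>) {..<R}"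
    by (rule indep_vars_restrict[OF indep _ disj]) simp
  from indep_varsD_finite[OF this, of S] have
    "prob (\<Inter>r<R. (\<lambda>\<omega>. \<lambda>i\<in>K r. X i \<omega>) -` S r \<inter> space M) = (\<Prod>r<R. prob ((\<lambda>\<omega>. \<lambda>i\<in>K r. X i \<omega>) -` S r \<inter> space M))"
    using False Smeas by auto
  moreover have vim: "(\<lambda>\<omega>. \<lambda>i\<in>K r. X i \<omega>) -` S r \<inter> space M = space M - exc u \<Lambda> (r * N) (r * N + N)" for r
    using P_iff[of _ r] by (auto simp: S_def space_PiM simp del: restrict_apply)
  moreover have "prob (space M - exc u \<Lambda> (r * N) (r * N + N)) = 1 - prob (exc u \<Lambda> 0 N)" for r
    by (simp add: prob_compl prob_exc_shift)
  moreover have "(\<Inter>r<R. space M - exc u \<Lambda> (r * N) (r * N + N)) = {\<omega> \<in> space M. \<forall>r<R. \<omega> \<notin> exc u \<Lambda> (r * N) (r * N + N)}"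
    using False by auto
  ultimately show ?thesis
    by simp
qed (simp add: prob_space)

lemma exc_mono: "a' \<le> a \<Longrightarrow> b \<le> b' \<Longrightarrow> exc u \<Lambda> a b \<subseteq> exc u \<Lambda> a' b'"
  unfolding exc_def by (auto intro: order_trans)

lemma block_upper:
  assumes "R * N \<le> n"
  shows "prob (space M - exc u \<Lambda> 0 n) \<le> (1 - prob (exc u \<Lambda> 0 N)) ^ R"
proof -
  have "exc u \<Lambda> (r * N) (r * N + N) \<subseteq> exc u \<Lambda> 0 n" if "r < R" for r
  proof (rule exc_mono)
    have "Suc r * N \<le> R * N"
      using that by (intro mult_le_mono1) simp
    with assms show "r * N + N \<le> n"
      by simp
  qed simp
  then have "space M - exc u \<Lambda> 0 n \<subseteq> {\<omega> \<in> space M. \<forall>r<R. \<omega> \<notin> exc u \<Lambda> (r * N) (r * N + N)}"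
    by auto
  then show ?thesis
    unfolding prob_blocks[symmetric] by (intro finite_measure_mono) auto
qed

text \<open>An exceedance contained in no block crosses a boundary \<open>r * N\<close>. It is
  described by \<open>r\<close>, by the distance \<open>a\<close> from its start to the boundary and
  by its length; the subtracted term is the union bound over these triples.\<close>

lemma block_lower:
  assumes n: "n \<le> R * N" and N: "0 < N" and \<Lambda>: "\<Lambda> \<subseteq> {1..lmax}"
    and q: "\<And>i j. i < j \<Longrightarrow> j - i \<in> \<Lambda> \<Longrightarrow> prob (exceed u i j) \<le> q" and q0: "0 \<le> q"
  shows "(1 - prob (exc u \<Lambda> 0 N)) ^ R - real R * real lmax * real (card \<Lambda>) * q \<le> prob (space M - exc u \<Lambda> 0 n)"
proof -
  define Z where "Z = {..<R} \<times> {1..lmax} \<times> \<Lambda>"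
  define E where "E = (\<lambda>(r, a, l). exceed u (r * N - a) (r * N - a + l))"
  have finZ: "finite Z"
    unfolding Z_def using \<Lambda> finite_subset by blast
  have sub: "{\<omega> \<in> space M. \<forall>r<R. \<omega> \<notin> exc u \<Lambda> (r * N) (r * N + N)} \<subseteq> (space M - exc u \<Lambda> 0 n) \<union> (\<Union>z\<in>Z. E z)"
  proof
    fix \<omega> assume \<omega>: "\<omega> \<in> {\<omega> \<in> space M. \<forall>r<R. \<omega> \<notin> exc u \<Lambda> (r * N) (r * N + N)}"
    show "\<omega> \<in> (space M - exc u \<Lambda> 0 n) \<union> (\<Union>z\<in>Z. E z)"
    proof (cases "\<omega> \<in> exc u \<Lambda> 0 n")
      case True
      then obtain i j where ij: "i < j" "j \<le> n" "j - i \<in> \<Lambda>" "\<omega> \<in> exceed u i j"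
        by (auto simp: exc_def)
      define r where "r = i div N"
      have r: "r * N \<le> i" "i < r * N + N"
        using N by (auto simp: r_def) (metis add.commute dividend_less_div_times mult.commute)
      have rR: "r < R"
        using r(1) ij n by (metis leD leI mult_le_mono1 order_trans)
      have "r * N + N < j"
      proof (rule ccontr)
        assume "\<not> r * N + N < j"
        then have "\<omega> \<in> exc u \<Lambda> (r * N) (r * N + N)"
          unfolding exc_def using ij r \<omega> by (intro CollectI conjI exI[of _ i] exI[of _ j]) auto
        with \<omega> rR show False
          by auto
      qed
      \<comment> \<open>The boundary that is crossed lies strictly before \<open>j\<close>, hence
        before \<open>R * N\<close>, so its number is below \<open>R\<close>.\<close>
      then have "Suc r * N < R * N"
        using ij n by simp
      then have "Suc r < R"
        by (simp only: mult_less_cancel2)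
      moreover have "r * N + N - i \<in> {1..lmax}"
      proof -
        have "j - i \<le> lmax"
          using ij(3) \<Lambda> by auto
        then show ?thesis
          using r \<open>r * N + N < j\<close> by auto
      qed
      ultimately have "(Suc r, r * N + N - i, j - i) \<in> Z"
        using ij by (auto simp: Z_def)
      moreover have "\<omega> \<in> E (Suc r, r * N + N - i, j - i)"
        using ij r by (auto simp: E_def add.commute)
      ultimately show ?thesis
        by blast
    qed (use \<omega> in auto)
  qed
  have E_le: "prob (E z) \<le> q" if "z \<in> Z" for z
  proof -
    obtain r a l where z: "z = (r, a, l)" by (cases z)
    have "l \<in> \<Lambda>" "0 < l"
      using that \<Lambda> by (auto simp: Z_def z)
    then show ?thesis
      unfolding E_def z by (auto intro!: q)
  qed
  have Eev: "E z \<in> events" for z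
    unfolding E_def by (auto split: prod.split)
  have "(1 - prob (exc u \<Lambda> 0 N)) ^ R \<le> prob ((space M - exc u \<Lambda> 0 n) \<union> (\<Union>z\<in>Z. E z))"
    unfolding prob_blocks[symmetric] using finZ Eev by (intro finite_measure_mono sub) auto
  also have "\<dots> \<le> prob (space M - exc u \<Lambda> 0 n) + prob (\<Union>z\<in>Z. E z)"
    using finZ Eev by (intro measure_Un_le) auto
  finally have "(1 - prob (exc u \<Lambda> 0 N)) ^ R \<le> prob (space M - exc u \<Lambda> 0 n) + prob (\<Union>z\<in>Z. E z)" .
  moreover have "prob (\<Union>z\<in>Z. E z) \<le> real (card Z) * q"
    by (rule union_bound[OF finZ Eev subset_refl E_le])
  moreover have "real (card Z) = real R * real lmax * real (card \<Lambda>)"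
    by (simp add: Z_def card_cartesian_product)
  ultimately show ?thesis
    by simp
qed

text \<open>Squares of side \<open>s = B + 1\<close> lattice points tile the plane of pairs:
  \<open>p\<close> numbers the window of \<open>i\<close>, and \<open>p + k\<close> that of
  \<open>j\<close>. The square \<open>(p, k)\<close> is a cell with core length
  \<open>k * s - B\<close>, and \<open>2 * B < l\<close> keeps this difference from being
  truncated.\<close>

lemma exc_le_cells:
  assumes s: "s = B + 1" and K: "finite K" and \<Lambda>: "\<And>l. l \<in> \<Lambda> \<Longrightarrow> 2 * B < l"
    and cover: "\<And>k l. l \<in> \<Lambda> \<Longrightarrow> k * s \<le> l + B \<Longrightarrow> l \<le> k * s + B \<Longrightarrow> k \<in> K"
  shows "prob (exc u \<Lambda> 0 N) \<le> real (N div s + 1) * (\<Sum>k\<in>K. prob (cell u (k * s - B) B))"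
proof -
  have "exc u \<Lambda> 0 N \<subseteq> (\<Union>(p, k)\<in>{..N div s} \<times> K. cellat (p * s) u (k * s - B) B)"
  proof
    fix \<omega> assume "\<omega> \<in> exc u \<Lambda> 0 N"
    then obtain i j where \<omega>: "\<omega> \<in> space M" and ij: "i < j" "j \<le> N" "j - i \<in> \<Lambda>" "\<omega> \<in> exceed u i j"
      by (auto simp: exc_def)
    define p where "p = i div s"
    define k where "k = j div s - p"
    have s0: "0 < s" using s by simp
    have p: "p * s \<le> i" "i \<le> p * s + B"
    proof -
      have "i mod s \<le> B" "i div s * s + i mod s = i"
        using mod_less_divisor[OF s0, of i] s div_mult_mod_eq[of i s] by linarith+
      then show "p * s \<le> i" "i \<le> p * s + B"
        unfolding p_def by linarith+
    qed
    have "p \<le> j div s"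
      unfolding p_def using ij by (intro div_le_mono) simp
    then have "j div s * s = p * s + k * s"
      by (simp add: k_def flip: distrib_right)
    then have j: "p * s + k * s \<le> j" "j \<le> p * s + k * s + B"
    proof -
      have "j mod s \<le> B" "j div s * s + j mod s = j"
        using mod_less_divisor[OF s0, of j] s div_mult_mod_eq[of j s] by linarith+
      then show "p * s + k * s \<le> j" "j \<le> p * s + k * s + B"
        using \<open>j div s * s = p * s + k * s\<close> by linarith+
    qed
    have l2: "2 * B < j - i"
      by (rule \<Lambda>[OF ij(3)])
    have kB: "B < k * s"
      using j p l2 by linarith
    have "k \<in> K"
      using p j kB by (intro cover[OF ij(3)]) linarith+
    moreover have "p \<le> N div s"
      unfolding p_def using ij by (intro div_le_mono) simp
    moreover have "\<omega> \<in> cellat (p * s) u (k * s - B) B"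
    proof -
      define a where "a = p * s + B - i"
      define b where "b = j - (p * s + k * s)"
      have "a \<le> B" "b \<le> B" "p * s + B - a = i" "p * s + B + (k * s - B) + b = j" "k * s - B + a + b = j - i"
        using p j kB by (auto simp: a_def b_def)
      moreover from this have "u * sqrt (real (k * s - B + a + b)) < isum {p * s + B - a..<p * s + B + (k * s - B) + b} \<omega>"
        using ij(4) by (simp only: exceed_def mem_Collect_eq)
      ultimately show ?thesis
        using \<omega> unfolding cellat_def by blast
    qed
    ultimately show "\<omega> \<in> (\<Union>(p, k)\<in>{..N div s} \<times> K. cellat (p * s) u (k * s - B) B)"
      by auto
  qed
  then have "prob (exc u \<Lambda> 0 N) \<le> prob (\<Union>z\<in>{..N div s} \<times> K. case z of (p, k) \<Rightarrow> cellat (p * s) u (k * s - B) B)"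
    using K by (intro finite_measure_mono sets.finite_UN) (auto split: prod.split)
  also have "\<dots> \<le> (\<Sum>z\<in>{..N div s} \<times> K. prob (case z of (p, k) \<Rightarrow> cellat (p * s) u (k * s - B) B))"
    using K by (intro finite_measure_subadditive_finite) (auto split: prod.split)
  also have "\<dots> = (\<Sum>p\<le>N div s. \<Sum>k\<in>K. prob (cell u (k * s - B) B))"
    by (simp add: sum.cartesian_product' prob_cellat)
  finally show ?thesis
    by simp
qed

text \<open>The spacing \<open>g\<close> keeps intervals from different cells at distance at least
  \<open>g\<close>, measured by adding the distances of the left and of the right end points. Half
  of the exponential decay is spent on the factor in \<open>g\<close>, the other half makes the sum
  over partners bounded. The \<open>q\<^sup>2\<close> in the pair hypothesis is meant for disjoint,
  hence independent, intervals.\<close>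

lemma exc_ge_cells:
  assumes s: "s = B + 1 + g" and K: "finite K" and \<Lambda>: "finite \<Lambda>"
    and inside: "\<And>k l. k \<in> K \<Longrightarrow> k * s \<le> l + B \<Longrightarrow> l \<le> k * s + B \<Longrightarrow> l \<in> \<Lambda>"
    and KB: "\<And>k. k \<in> K \<Longrightarrow> B < k * s"
    and KN: "\<And>p k. p < P \<Longrightarrow> k \<in> K \<Longrightarrow> p * s + k * s + B \<le> N"
    and q0: "0 \<le> q" and c: "0 < c"
    and pair: "\<And>i j i' j'. i < j \<Longrightarrow> i' < j' \<Longrightarrow> j - i \<in> \<Lambda> \<Longrightarrow> j' - i' \<in> \<Lambda> \<Longrightarrow>
      prob (exceed u i j \<inter> exceed u i' j') \<le> q * exp (- c * (\<bar>real i - real i'\<bar> + \<bar>real j - real j'\<bar>)) + q\<^sup>2"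
  shows "real P * (\<Sum>k\<in>K. prob (cell u (k * s - B) B)) -
    real (N * card \<Lambda>) * (q * ((2 / (1 - exp (- c / 2)))\<^sup>2 * exp (- c / 2 * real g)) + q\<^sup>2 * real (N * card \<Lambda>)) \<le> prob (exc u \<Lambda> 0 N)"
proof -
  define I where "I = {..<P} \<times> K"
  define C where "C = (\<lambda>(p, k). {p * s..p * s + B} \<times> {p * s + k * s..p * s + k * s + B})"
  define E where "E = (\<lambda>(p, k). cellat (p * s) u (k * s - B) B)"
  define A where "A = (\<lambda>(i, j). exceed u i j)"
  define V where "V = {(i, j). i < j \<and> j \<le> N \<and> j - i \<in> \<Lambda>}"
  define far where "far = (\<lambda>(i, j) (i', j'). real g \<le> \<bar>real i - real i'\<bar> + \<bar>real j - real j'\<bar>)"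
  have finI: "finite I"
    using K by (simp add: I_def)
  have finC: "finite (C z)" for z
    by (auto simp: C_def split: prod.split)
  have Vsub: "V \<subseteq> (\<lambda>(i, l). (i, i + l)) ` ({..<N} \<times> \<Lambda>)"
  proof
    fix v assume "v \<in> V"
    then obtain i j where "v = (i, j)" "i < j" "j \<le> N" "j - i \<in> \<Lambda>"
      by (auto simp: V_def)
    then show "v \<in> (\<lambda>(i, l). (i, i + l)) ` ({..<N} \<times> \<Lambda>)"
      by (intro image_eqI[of _ _ "(i, j - i)"]) auto
  qed
  then have finV: "finite V" and cV: "card V \<le> N * card \<Lambda>"
    using \<Lambda> surj_card_le[OF _ Vsub] by (auto intro: finite_subset simp: card_cartesian_product)
  have CV: "C z \<subseteq> V" if z: "z \<in> I" for z
  proof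
    fix v assume v: "v \<in> C z"
    obtain p k where z': "z = (p, k)" "p < P" "k \<in> K"
      using z by (auto simp: I_def)
    obtain i j where ij: "v = (i, j)" "p * s \<le> i" "i \<le> p * s + B" "p * s + k * s \<le> j" "j \<le> p * s + k * s + B"
      using v by (auto simp: C_def z')
    have kB: "B < k * s" by (rule KB[OF z'(3)])
    have "j - i \<in> \<Lambda>"
      using ij kB by (intro inside[OF z'(3)]) linarith+
    with ij kB KN[OF z'(2,3)] show "v \<in> V"
      by (auto simp: V_def)
  qed
  have Ev: "E z \<in> events" for z
    by (auto simp: E_def split: prod.split)
  have EA: "E z \<subseteq> (\<Union>v\<in>C z. A v)" if z: "z \<in> I" for z
  proof
    fix \<omega> assume \<omega>: "\<omega> \<in> E z"
    obtain p k where z': "z = (p, k)" "p < P" "k \<in> K"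
      using z by (auto simp: I_def)
    have kB: "B < k * s" by (rule KB[OF z'(3)])
    obtain a b where ab: "a \<le> B" "b \<le> B" "\<omega> \<in> space M"
      "u * sqrt (real (k * s - B + a + b)) < isum {p * s + B - a..<p * s + B + (k * s - B) + b} \<omega>"
      using \<omega> by (auto simp: E_def z' cellat_def)
    have "p * s + B + (k * s - B) + b = p * s + k * s + b" "k * s - B + a + b = (p * s + k * s + b) - (p * s + B - a)"
      using kB ab by auto
    then have "\<omega> \<in> A (p * s + B - a, p * s + k * s + b)"
      using ab by (auto simp: A_def exceed_def)
    moreover have "(p * s + B - a, p * s + k * s + b) \<in> C z"
      using ab by (auto simp: C_def z')
    ultimately show "\<omega> \<in> (\<Union>v\<in>C z. A v)"
      by blast
  qed
  have A_exc: "A v \<subseteq> exc u \<Lambda> 0 N" if "v \<in> V" for v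
    using that by (auto simp: A_def V_def exc_def exceed_def)
  have A_E: "E z \<subseteq> exc u \<Lambda> 0 N" if "z \<in> I" for z
    using EA[OF that] CV[OF that] A_exc by blast
  have dist: "real (Suc g) \<le> \<bar>real x - real y\<bar>"
    if "a \<noteq> b" "a * s \<le> x" "x \<le> a * s + B" "b * s \<le> y" "y \<le> b * s + B" for a b x y
  proof -
    have "Suc a * s \<le> b * s \<or> Suc b * s \<le> a * s"
      using that(1) by (metis Suc_leI linorder_neqE_nat mult_le_mono1)
    then have "x + Suc g \<le> y \<or> y + Suc g \<le> x"
      using that s by auto
    then show ?thesis
      by auto
  qed
  have sep: "far v w \<and> v \<noteq> w" if z: "z \<in> I" "z' \<in> I" "z \<noteq> z'" and v: "v \<in> C z" "w \<in> C z'" for z z' v w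
  proof -
    obtain p k p' k' where z': "z = (p, k)" "z' = (p', k')"
      by (cases z, cases z') auto
    obtain i j i' j' where v': "v = (i, j)" "w = (i', j')"
      by (cases v, cases w) auto
    \<comment> \<open>Different cells differ in the window of \<open>i\<close>, or else they share
      it and differ in the window of \<open>j\<close>.\<close>
    have "real (Suc g) \<le> \<bar>real i - real i'\<bar> + \<bar>real j - real j'\<bar>"
    proof (cases "p = p'")
      case True
      then have "p + k \<noteq> p' + k'"
        using z(3) z' by auto
      from dist[OF this, of j j'] show ?thesis
        using v by (auto simp: C_def z' v' distrib_right)
    next
      case False
      from dist[OF this, of i i'] show ?thesis
        using v by (auto simp: C_def z' v')
    qed
    then show ?thesis
      by (auto simp: far_def v')
  qed
  have disj: "disjoint_family_on C I"
    unfolding disjoint_family_on_def using sep by blast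
  define S where "S = 2 / (1 - exp (- c / 2))"
  have S0: "0 \<le> S"
    using c by (simp add: S_def)
  \<comment> \<open>Bound for the sum of the joint probabilities of one fixed pair with all pairs
    far from it.\<close>
  define T where "T = q * (S\<^sup>2 * exp (- c / 2 * real g)) + q\<^sup>2 * real (N * card \<Lambda>)"
  have T0: "0 \<le> T"
    using q0 by (simp add: T_def)
  have inner: "(\<Sum>w\<in>{w \<in> V. far v w}. prob (A v \<inter> A w)) \<le> T" if v: "v \<in> V" for v
  proof -
    obtain i j where v': "v = (i, j)" "i < j" "j - i \<in> \<Lambda>"
      using v by (auto simp: V_def)
    \<comment> \<open>The decay that remains after paying for the spacing is a product over the two
      coordinates, so the sum over partners factors into two geometric sums.\<close>
    define h where "h x y = exp (- c / 2) ^ nat \<bar>int x - int y\<bar>" for x y :: nat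
    have h: "h x y = exp (- c / 2 * \<bar>real x - real y\<bar>)" for x y
    proof -
      have "real (nat \<bar>int x - int y\<bar>) = \<bar>real x - real y\<bar>"
        by auto
      then show ?thesis
        unfolding h_def by (metis exp_of_nat_mult mult.commute)
    qed
    have "(\<Sum>w\<in>{w \<in> V. far v w}. prob (A v \<inter> A w)) \<le>
      (\<Sum>w\<in>{w \<in> V. far v w}. q * exp (- c / 2 * real g) * (h i (fst w) * h j (snd w)) + q\<^sup>2)"
    proof (rule sum_mono)
      fix w assume w: "w \<in> {w \<in> V. far v w}"
      obtain i' j' where w': "w = (i', j')" "i' < j'" "j' - i' \<in> \<Lambda>" and D: "real g \<le> \<bar>real i - real i'\<bar> + \<bar>real j - real j'\<bar>"
        using w by (auto simp: V_def far_def v')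
      define D where "D = \<bar>real i - real i'\<bar> + \<bar>real j - real j'\<bar>"
      have "prob (A v \<inter> A w) \<le> q * exp (- c * D) + q\<^sup>2"
        using pair[of i j i' j'] v' w' by (simp add: A_def D_def)
      also have "exp (- c * D) \<le> exp (- c / 2 * real g + - c / 2 * D)"
      proof -
        have "c * real g \<le> c * D"
          using D c by (intro mult_left_mono) (auto simp: D_def)
        then show ?thesis
          by simp
      qed
      also have "\<dots> = exp (- c / 2 * real g) * (h i i' * h j j')"
        by (simp add: h D_def distrib_left flip: exp_add)
      finally show "prob (A v \<inter> A w) \<le> q * exp (- c / 2 * real g) * (h i (fst w) * h j (snd w)) + q\<^sup>2"
        using q0 by (simp add: w' mult.assoc mult_left_mono)
    qed
    also have "\<dots> \<le> q * exp (- c / 2 * real g) * (\<Sum>w\<in>V. h i (fst w) * h j (snd w)) + real (card V) * q\<^sup>2"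
    proof -
      have "(\<Sum>w\<in>{w \<in> V. far v w}. h i (fst w) * h j (snd w)) \<le> (\<Sum>w\<in>V. h i (fst w) * h j (snd w))"
        using finV by (intro sum_mono2) (auto simp: h)
      moreover have "card {w \<in> V. far v w} \<le> card V"
        using finV by (intro card_mono) auto
      ultimately show ?thesis
        using q0 by (simp add: sum.distrib flip: sum_distrib_left) (intro add_mono mult_left_mono mult_right_mono, auto)
    qed
    also have "(\<Sum>w\<in>V. h i (fst w) * h j (snd w)) \<le> (\<Sum>w\<in>{..N} \<times> {..N}. h i (fst w) * h j (snd w))"
      by (intro sum_mono2) (auto simp: V_def h)
    also have "\<dots> = (\<Sum>x\<le>N. h i x) * (\<Sum>y\<le>N. h j y)"
      by (simp add: sum_product sum.cartesian_product')
    also have "\<dots> \<le> S * S"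
      using c S0 unfolding h_def S_def by (intro mult_mono sum_power_dist_le sum_nonneg) auto
    finally have "(\<Sum>w\<in>{w \<in> V. far v w}. prob (A v \<inter> A w)) \<le> q * exp (- c / 2 * real g) * (S * S) + real (card V) * q\<^sup>2"
      using q0 by (simp add: mult_left_mono)
    also have "\<dots> \<le> T"
      using cV q0 by (simp add: T_def power2_eq_square mult_ac) (intro mult_left_mono, auto simp flip: of_nat_mult)
    finally show ?thesis .
  qed
  have "(\<Sum>z\<in>I. \<Sum>z'\<in>I - {z}. prob (E z \<inter> E z')) \<le> (\<Sum>z\<in>I. \<Sum>v\<in>C z. T)"
  proof (rule sum_mono)
    fix z assume z: "z \<in> I"
    have "prob (E z \<inter> E z') \<le> (\<Sum>v\<in>C z. \<Sum>w\<in>C z'. prob (A v \<inter> A w))" if z': "z' \<in> I" for z'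
    proof -
      have "E z \<inter> E z' \<subseteq> (\<Union>v\<in>C z. \<Union>w\<in>C z'. A v \<inter> A w)"
        using EA[OF z] EA[OF z'] by blast
      then have "prob (E z \<inter> E z') \<le> prob (\<Union>v\<in>C z. \<Union>w\<in>C z'. A v \<inter> A w)"
        using finC by (intro finite_measure_mono sets.finite_UN sets.Int) (auto simp: A_def split: prod.split)
      also have "\<dots> \<le> (\<Sum>v\<in>C z. prob (\<Union>w\<in>C z'. A v \<inter> A w))"
        using finC by (intro finite_measure_subadditive_finite image_subsetI sets.finite_UN sets.Int) (auto simp: A_def split: prod.split)
      also have "\<dots> \<le> (\<Sum>v\<in>C z. \<Sum>w\<in>C z'. prob (A v \<inter> A w))"
        using finC by (intro sum_mono finite_measure_subadditive_finite image_subsetI sets.Int) (auto simp: A_def split: prod.split)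
      finally show ?thesis .
    qed
    then have "(\<Sum>z'\<in>I - {z}. prob (E z \<inter> E z')) \<le> (\<Sum>z'\<in>I - {z}. \<Sum>v\<in>C z. \<Sum>w\<in>C z'. prob (A v \<inter> A w))"
      by (intro sum_mono) auto
    \<comment> \<open>For fixed \<open>v\<close> the other cells are disjoint sets of far partners,
      so together they contribute at most \<open>T\<close>, however many there are.\<close>
    also have "\<dots> = (\<Sum>v\<in>C z. \<Sum>z'\<in>I - {z}. \<Sum>w\<in>C z'. prob (A v \<inter> A w))"
      by (rule sum.swap)
    also have "\<dots> \<le> (\<Sum>v\<in>C z. T)"
    proof (rule sum_mono)
      fix v assume v: "v \<in> C z"
      have "(\<Sum>z'\<in>I - {z}. \<Sum>w\<in>C z'. prob (A v \<inter> A w)) = (\<Sum>w\<in>(\<Union>z'\<in>I - {z}. C z'). prob (A v \<inter> A w))"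
        using finI finC disj by (subst sum.UNION_disjoint) (auto simp: disjoint_family_on_def)
      also have "\<dots> \<le> (\<Sum>w\<in>{w \<in> V. far v w}. prob (A v \<inter> A w))"
      proof (rule sum_mono2)
        show "(\<Union>z'\<in>I - {z}. C z') \<subseteq> {w \<in> V. far v w}"
          using sep[OF z _ _ v] CV by blast
      qed (use finV in auto)
      also have "\<dots> \<le> T"
        using CV[OF z] v by (intro inner) auto
      finally show "(\<Sum>z'\<in>I - {z}. \<Sum>w\<in>C z'. prob (A v \<inter> A w)) \<le> T" .
    qed
    finally show "(\<Sum>z'\<in>I - {z}. prob (E z \<inter> E z')) \<le> (\<Sum>v\<in>C z. T)" .
  qed
  also have "\<dots> = (\<Sum>v\<in>(\<Union>z\<in>I. C z). T)"
    using finI finC disj by (subst sum.UNION_disjoint) (auto simp: disjoint_family_on_def)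
  also have "\<dots> \<le> (\<Sum>v\<in>V. T)"
    using finV CV T0 by (intro sum_mono2) auto
  also have "\<dots> \<le> real (N * card \<Lambda>) * T"
    using cV T0 by (simp add: mult_right_mono flip: of_nat_mult)
  finally have double: "(\<Sum>z\<in>I. \<Sum>z'\<in>I - {z}. prob (E z \<inter> E z')) \<le> real (N * card \<Lambda>) * T" .
  have "(\<Sum>z\<in>I. prob (E z)) = real P * (\<Sum>k\<in>K. prob (cell u (k * s - B) B))"
    unfolding I_def E_def by (simp add: sum.cartesian_product' prob_cellat)
  moreover have "(\<Sum>z\<in>I. prob (E z)) - (\<Sum>z\<in>I. \<Sum>z'\<in>I - {z}. prob (E z \<inter> E z')) \<le> prob (\<Union>z\<in>I. E z)"
    by (rule bonferroni[OF finI]) (rule Ev)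
  ultimately have "real P * (\<Sum>k\<in>K. prob (cell u (k * s - B) B)) - real (N * card \<Lambda>) * T \<le> prob (\<Union>z\<in>I. E z)"
    using double by linarith
  also have "\<dots> \<le> prob (exc u \<Lambda> 0 N)"
    using A_E by (intro finite_measure_mono) auto
  finally show ?thesis
    by (simp add: T_def S_def)
qed

end

section \<open>Asymptotics along the strip\<close>

text \<open>Both bounds come from \<open>1 + y \<le> exp y\<close>: with \<open>y = - p\<close> from
  above, and with \<open>y = p / (1 - p)\<close>, for which \<open>1 + y\<close> is the inverse of
  \<open>1 - p\<close>, from below.\<close>

lemma power_one_minus_limit:
  fixes p :: "nat \<Rightarrow> real" and R :: "nat \<Rightarrow> nat"
  assumes p: "\<And>n. 0 \<le> p n" "p \<longlonglongrightarrow> 0" and R: "(\<lambda>n. real (R n) * p n) \<longlonglongrightarrow> z"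
  shows "(\<lambda>n. (1 - p n) ^ R n) \<longlonglongrightarrow> exp (- z)"
proof (rule tendsto_sandwich)
  have ev: "eventually (\<lambda>n. p n < 1) sequentially"
    using p(2) by (rule order_tendstoD) simp
  show "eventually (\<lambda>n. exp (- (real (R n) * p n / (1 - p n))) \<le> (1 - p n) ^ R n) sequentially"
    using ev
  proof eventually_elim
    case (elim n)
    have "1 + p n / (1 - p n) \<le> exp (p n / (1 - p n))"
      by (rule exp_ge_add_one_self)
    moreover have "1 + p n / (1 - p n) = 1 / (1 - p n)"
      using elim by (simp add: field_simps)
    ultimately have "exp (- (p n / (1 - p n))) \<le> 1 - p n"
      using elim by (simp add: exp_minus field_simps)
    then have "exp (- (p n / (1 - p n))) ^ R n \<le> (1 - p n) ^ R n"
      by (rule power_mono) simp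
    then show ?case
      by (simp flip: exp_of_nat_mult)
  qed
  show "eventually (\<lambda>n. (1 - p n) ^ R n \<le> exp (- (real (R n) * p n))) sequentially"
    using ev
  proof eventually_elim
    case (elim n)
    have "1 - p n \<le> exp (- p n)"
      using exp_ge_add_one_self[of "- p n"] by simp
    then have "(1 - p n) ^ R n \<le> exp (- p n) ^ R n"
      using elim by (intro power_mono) auto
    then show ?case
      by (simp flip: exp_of_nat_mult)
  qed
  have "(\<lambda>n. exp (- (real (R n) * p n / (1 - p n)))) \<longlonglongrightarrow> exp (- (z / (1 - 0)))"
    using R p by (intro tendsto_intros) auto
  then show "(\<lambda>n. exp (- (real (R n) * p n / (1 - p n)))) \<longlonglongrightarrow> exp (- z)"
    by simp
  show "(\<lambda>n. exp (- (real (R n) * p n))) \<longlonglongrightarrow> exp (- z)"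
    using R by (intro tendsto_intros)
qed

text \<open>\<open>B\<close> is the size of a cell and \<open>g\<close> the spacing between neighbouring cells.\<close>

lemma squeeze_cells:
  fixes a :: "nat \<Rightarrow> real" and h :: "nat \<Rightarrow> real"
  assumes J: "0 < J" and h: "\<And>B. 0 \<le> h B" and c: "0 < c" and C: "0 \<le> C"
    and U: "\<And>B \<epsilon>. 0 < \<epsilon> \<Longrightarrow> eventually (\<lambda>n. a n \<le> J * (h B / real (B + 1))\<^sup>2 + \<epsilon>) sequentially"
    and Lw: "\<And>B g \<epsilon>. 0 < \<epsilon> \<Longrightarrow> eventually (\<lambda>n. J * (h B / real (B + 1 + g))\<^sup>2 - C * exp (- c * real g) - \<epsilon> \<le> a n) sequentially"
  shows "\<exists>x. (\<lambda>B. h B / real B) \<longlonglongrightarrow> x \<and> a \<longlonglongrightarrow> J * x\<^sup>2"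
proof -
  define y where "y B = J * (h B / real (B + 1))\<^sup>2" for B
  define I where "I = (INF B. y B)"
  have y0: "0 \<le> y B" for B
    using J by (simp add: y_def)
  have bdd: "bdd_below (range y)"
    using y0 by (intro bdd_belowI2[of _ 0]) auto
  have I_le: "I \<le> y B" for B
    unfolding I_def using bdd by (intro cINF_lower) auto
  have I0: "0 \<le> I"
    unfolding I_def using y0 by (intro cINF_greatest) auto
  \<comment> \<open>Both estimates concern the same \<open>a n\<close>, so they can be compared for
    different cell sizes before \<open>a\<close> is known to converge; the infimum over the upper
    ones leaves \<open>I\<close>.\<close>
  have low: "J * (h B / real (B + 1 + g))\<^sup>2 - C * exp (- c * real g) \<le> I" for B g
    unfolding I_def
  proof (rule cINF_greatest, simp, rule field_le_epsilon)
    fix B' and e :: real assume e: "0 < e"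
    have e2: "0 < e / 2"
      using e by simp
    have "eventually (\<lambda>n. J * (h B / real (B + 1 + g))\<^sup>2 - C * exp (- c * real g) \<le> y B' + e) sequentially"
      using Lw[OF e2, of B g] U[OF e2, of B'] by eventually_elim (unfold y_def, linarith)
    then show "J * (h B / real (B + 1 + g))\<^sup>2 - C * exp (- c * real g) \<le> y B' + e"
      by simp
  qed
  have scale: "J * (h B / real (B + 1 + g))\<^sup>2 = y B * (real (B + 1) / real (B + 1 + g))\<^sup>2" for B g
    by (simp add: y_def power_divide)
  have small: "(\<lambda>g. C * exp (- c * real g)) \<longlonglongrightarrow> 0"
  proof -
    have "(\<lambda>g. exp (- c * real g)) \<longlonglongrightarrow> 0"
      using c by real_asymp
    then show ?thesis
      by (rule tendsto_mult_right_zero)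
  qed
  have ratio: "(\<lambda>B. (real (B + 1) / real (B + 1 + g))\<^sup>2) \<longlonglongrightarrow> 1" for g
    by real_asymp
  have ylim: "y \<longlonglongrightarrow> I"
  proof (rule order_tendstoI)
    fix z assume "z < I"
    then show "eventually (\<lambda>B. z < y B) sequentially"
      using I_le by (intro always_eventually allI) (rule less_le_trans)
  next
    fix z assume z: "I < z"
    \<comment> \<open>\<open>g\<close> is fixed before \<open>B\<close> grows, since the ratio
      \<open>(B + 1) / (B + 1 + g)\<close> tends to 1 only for fixed \<open>g\<close>.\<close>
    have "eventually (\<lambda>g. C * exp (- c * real g) < z - I) sequentially"
      using small z by (intro order_tendstoD(2)[OF small]) simp
    then obtain g where g: "C * exp (- c * real g) < z - I"
      by (auto simp: eventually_sequentially)
    define w where "w = I + C * exp (- c * real g)"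
    have w: "w < z"
      using g by (simp add: w_def)
    have yw: "y B * (real (B + 1) / real (B + 1 + g))\<^sup>2 \<le> w" for B
      using low[of B g] unfolding scale by (simp add: w_def)
    have "(\<lambda>B. w / (real (B + 1) / real (B + 1 + g))\<^sup>2) \<longlonglongrightarrow> w / 1"
      by (intro tendsto_divide tendsto_const ratio) simp
    then have "eventually (\<lambda>B. w / (real (B + 1) / real (B + 1 + g))\<^sup>2 < z) sequentially"
      using w by (intro order_tendstoD(2)) auto
    then show "eventually (\<lambda>B. y B < z) sequentially"
    proof eventually_elim
      case (elim B)
      have "0 < (real (B + 1) / real (B + 1 + g))\<^sup>2"
        by simp
      then have "y B \<le> w / (real (B + 1) / real (B + 1 + g))\<^sup>2"
        using yw[of B] by (simp only: pos_le_divide_eq)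
      with elim show ?case
        by simp
    qed
  qed
  \<comment> \<open>By \<open>0 < J\<close> and \<open>0 \<le> h B\<close>, the quotient
    \<open>h B / (B + 1)\<close> is recovered from \<open>y B\<close> as a square root.\<close>
  define x where "x = sqrt (I / J)"
  have xB: "sqrt (y B / J) = h B / real (B + 1)" for B
    using J h[of B] by (simp add: y_def real_sqrt_divide)
  have "(\<lambda>B. h B / real (B + 1)) \<longlonglongrightarrow> x"
    unfolding x_def xB[symmetric] using J by (intro tendsto_real_sqrt tendsto_divide ylim tendsto_const) auto
  moreover have "(\<lambda>B. real (B + 1) / real B) \<longlonglongrightarrow> 1"
    by real_asymp
  ultimately have "(\<lambda>B. h B / real (B + 1) * (real (B + 1) / real B)) \<longlonglongrightarrow> x * 1"
    by (rule tendsto_mult)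
  then have "(\<lambda>B. h B / real B) \<longlonglongrightarrow> x"
    by (simp del: of_nat_add of_nat_Suc)
  moreover have "a \<longlonglongrightarrow> I"
  proof (rule order_tendstoI)
    fix z assume z: "I < z"
    have "eventually (\<lambda>B. y B < z) sequentially"
      using ylim z by (rule order_tendstoD(2))
    then obtain B where B: "y B < z"
      by (auto simp: eventually_sequentially)
    then have "0 < (z - y B) / 2"
      by simp
    from U[OF this, of B] show "eventually (\<lambda>n. a n < z) sequentially"
    proof eventually_elim
      case (elim n)
      also have "J * (h B / real (B + 1))\<^sup>2 + (z - y B) / 2 < z"
        unfolding y_def[symmetric] using B by (simp add: field_simps)
      finally show ?case .
    qed
  next
    fix z assume z: "z < I"
    define e where "e = (I - z) / 3"
    have e: "0 < e"
      using z by (simp add: e_def)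
    have "eventually (\<lambda>g. C * exp (- c * real g) < e) sequentially"
      using e by (intro order_tendstoD(2)[OF small]) simp
    then obtain g where g: "C * exp (- c * real g) < e"
      by (auto simp: eventually_sequentially)
    have "(\<lambda>B. y B * (real (B + 1) / real (B + 1 + g))\<^sup>2) \<longlonglongrightarrow> I * 1"
      by (intro tendsto_mult ylim ratio)
    then have "eventually (\<lambda>B. I - e < y B * (real (B + 1) / real (B + 1 + g))\<^sup>2) sequentially"
      using e by (intro order_tendstoD(1)) auto
    then obtain B where B: "I - e < y B * (real (B + 1) / real (B + 1 + g))\<^sup>2"
      by (auto simp: eventually_sequentially)
    have "z = I - e - e - e"
      by (simp add: e_def field_simps)
    with B g Lw[OF e, of B g] show "eventually (\<lambda>n. z < a n) sequentially"
      unfolding scale by (auto elim!: eventually_mono)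
  qed
  moreover have "I = J * x\<^sup>2"
    using J I0 by (simp add: x_def)
  ultimately show ?thesis
    by blast
qed

lemma lnn_at_top: "filterlim (\<lambda>n. ln (real n)) at_top sequentially"
  by real_asymp

text \<open>\<open>x n\<close> plays the role of \<open>l \<phi>(t)\<close> and \<open>y n\<close> that of \<open>ln n\<close>.\<close>

lemma sqrt_diff_limit:
  fixes y x :: "nat \<Rightarrow> real"
  assumes y: "filterlim y at_top sequentially" and x: "(\<lambda>n. (x n - y n) / sqrt (y n)) \<longlonglongrightarrow> b"
  shows "(\<lambda>n. x n / y n) \<longlonglongrightarrow> 1" "(\<lambda>n. sqrt (x n) - sqrt (y n + \<tau>)) \<longlonglongrightarrow> b / 2"
proof -
  define r where "r n = 1 / sqrt (y n)" for n
  have r: "r \<longlonglongrightarrow> 0"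
    unfolding r_def by (intro real_tendsto_divide_at_top[OF tendsto_const] filterlim_compose[OF sqrt_at_top y])
  define b' where "b' n = (x n - y n) / sqrt (y n)" for n
  have ev: "eventually (\<lambda>n. 0 < y n) sequentially"
    using y by (simp add: filterlim_at_top_dense)
  have one: "(\<lambda>n. 1 + b' n * r n) \<longlonglongrightarrow> 1 + b * 0"
    using x r unfolding b'_def by (intro tendsto_intros)
  have xy: "eventually (\<lambda>n. x n / y n = 1 + b' n * r n) sequentially"
    using ev by eventually_elim (simp add: b'_def r_def field_simps)
  show lim1: "(\<lambda>n. x n / y n) \<longlonglongrightarrow> 1"
    using tendsto_cong[OF xy] one by simp
  have lim2: "(\<lambda>n. (y n + \<tau>) / y n) \<longlonglongrightarrow> 1"
  proof -
    have "(\<lambda>n. 1 + \<tau> / y n) \<longlonglongrightarrow> 1 + 0"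
      by (intro tendsto_add tendsto_const real_tendsto_divide_at_top[OF tendsto_const y])
    moreover have "eventually (\<lambda>n. 1 + \<tau> / y n = (y n + \<tau>) / y n) sequentially"
      using ev by eventually_elim (simp add: field_simps)
    ultimately show ?thesis
      using Lim_transform_eventually by fastforce
  qed
  have ev2: "eventually (\<lambda>n. 0 < x n / y n) sequentially" "eventually (\<lambda>n. 0 < (y n + \<tau>) / y n) sequentially"
    using order_tendstoD(1)[OF lim1, of 0] order_tendstoD(1)[OF lim2, of 0] by auto
  \<comment> \<open>The difference of roots is the difference of the radicands over the sum of the
    roots, here with numerator and denominator divided by \<open>sqrt (y n)\<close>; the shift by
    \<tau> becomes negligible.\<close>
  have "(\<lambda>n. (b' n - \<tau> * r n) / (sqrt (x n / y n) + sqrt ((y n + \<tau>) / y n))) \<longlonglongrightarrow> (b - \<tau> * 0) / (sqrt 1 + sqrt 1)"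
    using x r lim1 lim2 unfolding b'_def by (intro tendsto_intros) auto
  moreover have "eventually (\<lambda>n. (b' n - \<tau> * r n) / (sqrt (x n / y n) + sqrt ((y n + \<tau>) / y n)) = sqrt (x n) - sqrt (y n + \<tau>)) sequentially"
    using ev ev2
  proof eventually_elim
    case (elim n)
    define s where "s = sqrt (y n)"
    have s: "0 < s" "y n = s * s"
      using elim by (auto simp: s_def)
    have pos: "0 < x n" "0 < y n + \<tau>"
      using elim by (auto simp: zero_less_divide_iff)
    define p where "p = sqrt (x n)"
    define q where "q = sqrt (y n + \<tau>)"
    have pq: "0 < p" "0 < q" "x n = p * p" "y n + \<tau> = q * q"
      using pos by (auto simp: p_def q_def)
    have "b' n - \<tau> * r n = (p * p - q * q) / s"
      unfolding b'_def r_def s_def[symmetric] using pq(3,4) by (simp add: diff_divide_distrib[symmetric])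
    moreover have "sqrt (x n / y n) + sqrt ((y n + \<tau>) / y n) = (p + q) / s"
      unfolding real_sqrt_divide p_def[symmetric] q_def[symmetric] s_def[symmetric] by (rule add_divide_distrib[symmetric])
    moreover have "(p * p - q * q) / s / ((p + q) / s) = p - q"
    proof -
      have "p * p - q * q = (p - q) * (p + q)" "p + q \<noteq> 0"
        using pq by (simp_all add: algebra_simps)
      then show ?thesis
        using s(1) by simp
    qed
    ultimately show ?case
      by (simp add: p_def q_def)
  qed
  ultimately show "(\<lambda>n. sqrt (x n) - sqrt (y n + \<tau>)) \<longlonglongrightarrow> b / 2"
    using Lim_transform_eventually by fastforce
qed

section \<open>Exceedance probabilities in the strip\<close>

locale exceedances = iid_walk +
  fixes m \<tau> A1 A2 :: real
  assumes m_pos: "0 < m" and phi_t: "\<phi> t = m * t\<^sup>2 / 2" and mu_t: "\<mu> = m * t" and A12: "A1 < A2"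
begin

definition F :: real where "F = \<phi> t"
definition L :: "nat \<Rightarrow> real" where "L n = ln (real n)"
text \<open>Solves \<open>u\<^sup>2 / 2 = m * (L n + \<tau>)\<close>; \<open>max 0\<close> concerns
  the finitely many \<open>n\<close> for which the right side is negative.\<close>

definition u :: "nat \<Rightarrow> real" where "u n = sqrt (2 * m * max 0 (L n + \<tau>))"
definition strip :: "real \<Rightarrow> real \<Rightarrow> nat \<Rightarrow> nat set" where
  "strip a b n = {l. 0 < l \<and> L n / F + a * sqrt (L n) \<le> real l \<and> real l \<le> L n / F + b * sqrt (L n)}"
text \<open>The limit, at coordinate \<open>a\<close>, of \<open>n * sqrt (L n)\<close> times the
  probability of an exceedance by one interval. The exponent adds \<open>(F * a / 2)\<^sup>2\<close>
  from the completed square and \<open>- m * (F * a / 2)\<^sup>2 / \<sigma>2\<close> from the local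
  limit theorem.\<close>

definition \<kappa> :: "real \<Rightarrow> real" where
  "\<kappa> a = exp (- \<tau>) * (sqrt F / (\<sigma> * sqrt (2 * pi) * t)) * exp (- (F\<^sup>2 / 4 * (m / \<sigma>2 - 1) * a\<^sup>2))"

lemma F_pos: "0 < F" and F_eq: "F = m * t\<^sup>2 / 2"
  using m_pos t_pos by (simp_all add: F_def phi_t)

lemma L_at_top: "filterlim L at_top sequentially"
  unfolding L_def[abs_def] by (rule lnn_at_top)

lemma eventually_L: "eventually (\<lambda>n. c < L n) sequentially"
  using L_at_top by (simp add: filterlim_at_top_dense)

lemma eventually_sqrt_L: "eventually (\<lambda>n. c < sqrt (L n)) sequentially"
  using filterlim_compose[OF sqrt_at_top L_at_top] by (simp add: filterlim_at_top_dense)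

text \<open>\<open>F = m * t\<^sup>2 / 2\<close> gives \<open>t * sqrt (2 * m) = 2 * sqrt F\<close>,
  which completes the square.\<close>

lemma exponent:
  assumes "0 \<le> L n + \<tau>"
  shows "real l * F - t * (u n * sqrt (real l)) = - (L n + \<tau>) + (sqrt (real l * F) - sqrt (L n + \<tau>))\<^sup>2"
proof -
  have "t * sqrt (2 * m) = 2 * sqrt F"
  proof -
    have "sqrt F = sqrt (2 * m * (t / 2)\<^sup>2)"
      by (simp add: F_eq power2_eq_square)
    also have "\<dots> = sqrt (2 * m) * (t / 2)"
      unfolding real_sqrt_mult[of "2 * m"] using t_pos by simp
    finally show ?thesis
      by (simp add: mult.commute)
  qed
  then have "t * (u n * sqrt (real l)) = 2 * sqrt (real l * F) * sqrt (L n + \<tau>)"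
    using assms by (simp add: u_def real_sqrt_mult)
  then show ?thesis
    using assms F_pos by (simp add: power2_diff)
qed

text \<open>Along lengths with coordinate tending to \<open>a\<close>, the roots of
  \<open>l * F\<close> and of \<open>L n + \<tau>\<close> differ by \<open>F * a / 2\<close> in the
  limit. Since \<open>sqrt (2 * m) * sqrt F = \<mu>\<close>, the normalised distance of the level
  from the tilted mean is the same difference times \<open>- sqrt (2 * m)\<close>; this is where the
  optimality of \<open>t\<close> enters.\<close>

lemma cell_limit:
  fixes l :: "nat \<Rightarrow> nat"
  assumes l: "(\<lambda>n. (real (l n) - L n / F) / sqrt (L n)) \<longlonglongrightarrow> a"
  shows "(\<lambda>n. real n * sqrt (L n) * prob (cell (u n) (l n) B)) \<longlonglongrightarrow> \<kappa> a * (hmax B)\<^sup>2"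
proof -
  have "(\<lambda>n. (real (l n) * F - L n) / sqrt (L n)) \<longlonglongrightarrow> F * a"
  proof -
    have "(\<lambda>n. F * ((real (l n) - L n / F) / sqrt (L n))) \<longlonglongrightarrow> F * a"
      by (intro tendsto_mult tendsto_const l)
    moreover have eq: "F * ((x - y / F) / z) = (x * F - y) / z" for x y z
    proof -
      have "F * (x - y / F) = x * F - y"
        using F_pos by (simp add: right_diff_distrib)
      then show ?thesis
        by simp
    qed
    ultimately show ?thesis
      by (simp only: eq)
  qed
  note lim = sqrt_diff_limit[OF L_at_top this]
  have D: "(\<lambda>n. sqrt (real (l n) * F) - sqrt (L n + \<tau>)) \<longlonglongrightarrow> F * a / 2"
    by (rule lim(2))
  have ratio: "(\<lambda>n. real (l n) / L n) \<longlonglongrightarrow> 1 / F"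
    using tendsto_divide[OF lim(1) tendsto_const[of F]] F_pos by simp
  have sratio: "(\<lambda>n. sqrt (L n) / sqrt (real (l n))) \<longlonglongrightarrow> sqrt F"
  proof -
    have "(\<lambda>n. sqrt (1 / (real (l n) / L n))) \<longlonglongrightarrow> sqrt (1 / (1 / F))"
      using F_pos by (intro tendsto_real_sqrt tendsto_divide tendsto_const ratio) auto
    then show ?thesis
      by (simp add: real_sqrt_divide)
  qed
  have l_top: "filterlim l at_top sequentially"
  proof -
    have "filterlim (\<lambda>n. real (l n) / L n * L n) at_top sequentially"
      using F_pos by (intro filterlim_tendsto_pos_mult_at_top[OF ratio] L_at_top) simp
    then have "filterlim (\<lambda>n. real (l n)) at_top sequentially"
      by (rule filterlim_cong[THEN iffD1, rotated 3, OF _ refl refl])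
         (use eventually_L[of 0] in \<open>auto elim!: eventually_mono\<close>)
    then show ?thesis
      by (simp add: filterlim_sequentially_iff_filterlim_real)
  qed
  have ev: "eventually (\<lambda>n. 0 \<le> L n + \<tau>) sequentially"
    using eventually_L[of "- \<tau>"] by eventually_elim simp
  define Q where "Q = exp (- (- sqrt (2 * m) * (F * a / 2))\<^sup>2 / (2 * \<sigma>2)) / (\<sigma> * sqrt (2 * pi) * t) * (hmax B)\<^sup>2"
  have sF: "sqrt (2 * m) * sqrt F = m * t"
  proof -
    have "sqrt (2 * m) * sqrt F = sqrt ((m * t)\<^sup>2)"
      unfolding real_sqrt_mult[symmetric] by (rule arg_cong[where f = sqrt]) (simp add: F_eq power2_eq_square)
    then show ?thesis
      using m_pos t_pos by simp
  qed
  have "(\<lambda>n. sqrt (real (l n)) * exp (t * (u n * sqrt (real (l n))) - real (l n) * \<phi> t) * prob (cell (u n) (l n) B)) \<longlonglongrightarrow> Q"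
    unfolding Q_def
  proof (rule cell_asymp[OF _ l_top])
    show "0 \<le> u n" for n
      using m_pos by (simp add: u_def)
    have "(\<lambda>n. - sqrt (2 * m) * (sqrt (real (l n) * F) - sqrt (L n + \<tau>))) \<longlonglongrightarrow> - sqrt (2 * m) * (F * a / 2)"
      by (intro tendsto_mult tendsto_const D)
    moreover have "eventually (\<lambda>n. - sqrt (2 * m) * (sqrt (real (l n) * F) - sqrt (L n + \<tau>)) = u n - sqrt (real (l n)) * \<mu>) sequentially"
      using ev
    proof eventually_elim
      case (elim n)
      have "sqrt (2 * m) * sqrt (real (l n) * F) = sqrt (real (l n)) * \<mu>"
        unfolding mu_t sF[symmetric] by (simp add: real_sqrt_mult)
      then show ?case
        using elim by (simp add: u_def right_diff_distrib real_sqrt_mult)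
    qed
    ultimately show "(\<lambda>n. u n - sqrt (real (l n)) * \<mu>) \<longlonglongrightarrow> - sqrt (2 * m) * (F * a / 2)"
      using Lim_transform_eventually by fastforce
    have "(\<lambda>n. sqrt (2 * m) / 2 * (sqrt (L n) / sqrt (real (l n))) * sqrt (1 + \<tau> / L n)) \<longlonglongrightarrow> sqrt (2 * m) / 2 * sqrt F * sqrt (1 + 0)"
      by (intro tendsto_mult tendsto_const sratio tendsto_real_sqrt tendsto_add real_tendsto_divide_at_top[OF tendsto_const L_at_top])
    moreover have "sqrt (2 * m) / 2 * sqrt F * sqrt (1 + 0) = \<phi> t / t"
      using sF t_pos by (simp add: phi_t power2_eq_square)
    moreover have "eventually (\<lambda>n. sqrt (2 * m) / 2 * (sqrt (L n) / sqrt (real (l n))) * sqrt (1 + \<tau> / L n) = u n / (2 * sqrt (real (l n)))) sequentially"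
      using ev eventually_L[of 0]
    proof eventually_elim
      case (elim n)
      then have "L n + \<tau> = L n * (1 + \<tau> / L n)"
        by (simp add: field_simps)
      then have "sqrt (L n + \<tau>) = sqrt (L n) * sqrt (1 + \<tau> / L n)"
        by (metis real_sqrt_mult)
      with elim show ?case
        by (simp add: u_def real_sqrt_mult)
    qed
    ultimately show "(\<lambda>n. u n / (2 * sqrt (real (l n)))) \<longlonglongrightarrow> \<phi> t / t"
      using Lim_transform_eventually by fastforce
  qed
  moreover have "(\<lambda>n. exp (- \<tau> + (sqrt (real (l n) * F) - sqrt (L n + \<tau>))\<^sup>2)) \<longlonglongrightarrow> exp (- \<tau> + (F * a / 2)\<^sup>2)"
    by (intro tendsto_intros D)
  ultimately have "(\<lambda>n. sqrt (L n) / sqrt (real (l n)) * (exp (- \<tau> + (sqrt (real (l n) * F) - sqrt (L n + \<tau>))\<^sup>2) *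
     (sqrt (real (l n)) * exp (t * (u n * sqrt (real (l n))) - real (l n) * \<phi> t) * prob (cell (u n) (l n) B))))
     \<longlonglongrightarrow> sqrt F * (exp (- \<tau> + (F * a / 2)\<^sup>2) * Q)"
    by (intro tendsto_mult sratio)
  moreover have "sqrt F * (exp (- \<tau> + (F * a / 2)\<^sup>2) * Q) = \<kappa> a * (hmax B)\<^sup>2"
  proof -
    have "- (- sqrt (2 * m) * (F * a / 2))\<^sup>2 / (2 * \<sigma>2) = - (m * (F * a / 2)\<^sup>2 / \<sigma>2)"
    proof -
      have "(- sqrt (2 * m) * x)\<^sup>2 = 2 * (m * x\<^sup>2)" for x
        using m_pos by (simp add: power_mult_distrib)
      then show ?thesis
        by (simp only: minus_divide_left[symmetric] mult_divide_mult_cancel_left[OF zero_neq_numeral[symmetric]])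
    qed
    moreover have "exp (- \<tau> + (F * a / 2)\<^sup>2) * exp (- (m * (F * a / 2)\<^sup>2 / \<sigma>2)) = exp (- \<tau>) * exp (- (F\<^sup>2 / 4 * (m / \<sigma>2 - 1) * a\<^sup>2))"
      unfolding exp_add[symmetric] by (rule arg_cong[where f = exp]) (simp add: power2_eq_square field_simps)
    ultimately show ?thesis
      unfolding Q_def \<kappa>_def by (simp add: mult_ac)
  qed
  moreover have "eventually (\<lambda>n. sqrt (L n) / sqrt (real (l n)) * (exp (- \<tau> + (sqrt (real (l n) * F) - sqrt (L n + \<tau>))\<^sup>2) *
     (sqrt (real (l n)) * exp (t * (u n * sqrt (real (l n))) - real (l n) * \<phi> t) * prob (cell (u n) (l n) B))) =
     real n * sqrt (L n) * prob (cell (u n) (l n) B)) sequentially"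
  proof -
    have "eventually (\<lambda>n. 0 < l n) sequentially"
      using l_top unfolding filterlim_at_top by (auto dest!: spec[of _ 1] elim!: eventually_mono)
    with ev eventually_gt_at_top[of 0] show ?thesis
    proof eventually_elim
      case (elim n)
      \<comment> \<open>The completed square cancels the normalisation of the tail and leaves
        \<open>exp (L n)\<close>, that is \<open>n\<close>.\<close>
      have "exp (- \<tau> + (sqrt (real (l n) * F) - sqrt (L n + \<tau>))\<^sup>2) * exp (t * (u n * sqrt (real (l n))) - real (l n) * \<phi> t) = exp (L n)"
        unfolding exp_add[symmetric] using exponent[of n "l n"] elim by (simp add: F_def)
      also have "\<dots> = real n"
        using elim by (simp add: L_def)
      finally have "sqrt (L n) / sqrt (real (l n)) * sqrt (real (l n)) * (exp (- \<tau> + (sqrt (real (l n) * F) - sqrt (L n + \<tau>))\<^sup>2) * exp (t * (u n * sqrt (real (l n))) - real (l n) * \<phi> t)) * prob (cell (u n) (l n) B) =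
        sqrt (L n) * real n * prob (cell (u n) (l n) B)"
        using elim by simp
      then show ?case
        by (simp only: mult_ac)
    qed
  qed
  ultimately show ?thesis
    using Lim_transform_eventually by fastforce
qed


text \<open>\<open>sqrt (L n)\<close> is negligible against \<open>L n\<close>. The constant
  \<open>c\<close> is taken as 1/2 for single exceedances and as 3/4 for pairs.\<close>

lemma strip_lower:
  assumes "c < 1"
  shows "eventually (\<lambda>n. \<forall>l\<in>strip a b n. c * L n / F \<le> real l) sequentially"
  using eventually_sqrt_L[of "F * \<bar>a\<bar> / (1 - c)"] eventually_L[of 0]
proof eventually_elim
  case (elim n)
  define s where "s = sqrt (L n)"
  have s: "L n = s * s" "0 < s"
    using elim by (simp_all add: s_def)
  have "F * \<bar>a\<bar> < s * (1 - c)"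
    using elim(1) assms by (simp add: s_def pos_divide_less_eq)
  then have "F * \<bar>a\<bar> * s \<le> s * (1 - c) * s"
    using s by (intro mult_right_mono) auto
  then have "\<bar>a\<bar> * s \<le> (1 - c) * L n / F"
    using F_pos by (simp add: s field_simps)
  moreover have "- (\<bar>a\<bar> * s) \<le> a * s"
    using s mult_right_mono[of "- \<bar>a\<bar>" a s] by simp
  ultimately have "c * L n / F \<le> L n / F + a * s"
    by (simp add: left_diff_distrib diff_divide_distrib)
  then show ?case
    by (auto simp: strip_def s_def)
qed

text \<open>On the strip \<open>\<bar>real l * F - L n\<bar>\<close> is at most a multiple of
  \<open>sqrt (L n)\<close>, so the completed square stays bounded; the 1 next to
  \<open>F * A\<close> absorbs the effect of \<tau>.\<close>

lemma exponent_bound: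
  "\<exists>K>0. eventually (\<lambda>n. \<forall>l\<in>strip a b n. real n * exp (real l * F - t * (u n * sqrt (real l))) \<le> K) sequentially"
proof -
  define A where "A = max \<bar>a\<bar> \<bar>b\<bar>"
  define K where "K = exp (- \<tau> + (F * A + 1)\<^sup>2)"
  have A: "0 \<le> A" by (simp add: A_def)
  have "(\<lambda>n. (F * A + \<bar>\<tau>\<bar> / sqrt (L n)) / sqrt (1 + \<tau> / L n)) \<longlonglongrightarrow> (F * A + 0) / sqrt (1 + 0)"
    by (intro tendsto_divide tendsto_add tendsto_const tendsto_real_sqrt real_tendsto_divide_at_top[OF tendsto_const]
        L_at_top filterlim_compose[OF sqrt_at_top L_at_top]) simp
  then have ev: "eventually (\<lambda>n. (F * A + \<bar>\<tau>\<bar> / sqrt (L n)) / sqrt (1 + \<tau> / L n) < F * A + 1) sequentially"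
    by (rule order_tendstoD) simp
  have "eventually (\<lambda>n. \<forall>l\<in>strip a b n. real n * exp (real l * F - t * (u n * sqrt (real l))) \<le> K) sequentially"
    using ev eventually_L[of "\<bar>\<tau>\<bar>"] eventually_gt_at_top[of 0]
  proof eventually_elim
    case (elim n)
    have L0: "0 < L n" and Lt: "0 < L n + \<tau>"
      using elim(2) by auto
    show ?case
    proof
      fix l assume l: "l \<in> strip a b n"
      define s where "s = sqrt (L n)"
      define y where "y = L n + \<tau>"
      have s: "0 < s" "L n = s * s"
        using L0 by (simp_all add: s_def)
      have "a * s \<le> real l - L n / F" "real l - L n / F \<le> b * s"
        using l by (auto simp: strip_def s_def)
      moreover have "- A \<le> a" "b \<le> A"
        using max.cobounded1[of "\<bar>a\<bar>" "\<bar>b\<bar>"] max.cobounded2[of "\<bar>b\<bar>" "\<bar>a\<bar>"] unfolding A_def by linarith+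
      then have "- A * s \<le> a * s" "b * s \<le> A * s"
        using s by (intro mult_right_mono; simp)+
      ultimately have "\<bar>real l - L n / F\<bar> \<le> A * s"
        by (auto simp: abs_le_iff)
      then have "F * \<bar>real l - L n / F\<bar> \<le> F * (A * s)"
        using F_pos by (intro mult_left_mono) auto
      moreover have "F * \<bar>real l - L n / F\<bar> = \<bar>real l * F - L n\<bar>"
      proof -
        have "real l * F - L n = F * (real l - L n / F)"
          using F_pos by (simp add: right_diff_distrib)
        then show ?thesis
          using F_pos by (simp add: abs_mult)
      qed
      ultimately have d: "\<bar>real l * F - y\<bar> \<le> F * A * s + \<bar>\<tau>\<bar>"
        by (simp add: y_def)
      have y: "0 < y" "sqrt y = s * sqrt (1 + \<tau> / L n)"
      proof -
        have "y = L n * (1 + \<tau> / L n)"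
          using L0 by (simp add: y_def field_simps)
        then show "sqrt y = s * sqrt (1 + \<tau> / L n)"
          unfolding s_def by (metis real_sqrt_mult)
      qed (use Lt in \<open>simp add: y_def\<close>)
      have lF: "0 \<le> real l * F"
        using F_pos by simp
      have "\<bar>sqrt (real l * F) - sqrt y\<bar> * sqrt y \<le> \<bar>sqrt (real l * F) - sqrt y\<bar> * (sqrt (real l * F) + sqrt y)"
        using lF by (intro mult_left_mono) auto
      also have "\<dots> = \<bar>(sqrt (real l * F) - sqrt y) * (sqrt (real l * F) + sqrt y)\<bar>"
        using lF y(1) by (simp add: abs_mult)
      also have "(sqrt (real l * F) - sqrt y) * (sqrt (real l * F) + sqrt y) = real l * F - y"
        using lF y(1) by (simp add: algebra_simps)
      also have "\<bar>real l * F - y\<bar> \<le> F * A * s + \<bar>\<tau>\<bar>"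
        by (rule d)
      finally have "\<bar>sqrt (real l * F) - sqrt y\<bar> \<le> (F * A * s + \<bar>\<tau>\<bar>) / sqrt y"
        using y(1) by (simp add: pos_le_divide_eq)
      also have "\<dots> = (F * A + \<bar>\<tau>\<bar> / sqrt (L n)) / sqrt (1 + \<tau> / L n)"
        unfolding y(2) s_def[symmetric] using s(1) by (simp add: field_simps)
      also have "\<dots> \<le> F * A + 1"
        using elim(1) by simp
      finally have "(sqrt (real l * F) - sqrt y)\<^sup>2 \<le> (F * A + 1)\<^sup>2"
        using F_pos A by (subst abs_le_square_iff[symmetric]) auto
      then have "exp (- \<tau> + (sqrt (real l * F) - sqrt y)\<^sup>2) \<le> K"
        by (simp add: K_def)
      moreover have "real n * exp (real l * F - t * (u n * sqrt (real l))) = exp (- \<tau> + (sqrt (real l * F) - sqrt y)\<^sup>2)"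
      proof -
        have "real n = exp (L n)"
          using elim by (simp add: L_def)
        then show ?thesis
          using exponent[of n l] Lt by (simp add: y_def flip: exp_add)
      qed
      ultimately show "real n * exp (real l * F - t * (u n * sqrt (real l))) \<le> K"
        by simp
    qed
  qed
  moreover have "K > 0"
    by (simp add: K_def)
  ultimately show ?thesis
    by blast
qed

text \<open>The uniform tail bound, with \<open>l\<close> of order \<open>L n\<close>. The strip
  offers order \<open>sqrt (L n)\<close> lengths for each of \<open>n\<close> starting points, so
  this is the order at which the expected number of exceedances stays bounded.\<close>

lemma single_bound:
  "\<exists>K>0. eventually (\<lambda>n. \<forall>i j. i < j \<longrightarrow> j - i \<in> strip a b n \<longrightarrow>
    prob (exceed (u n) i j) \<le> K / (real n * sqrt (L n))) sequentially"
proof -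
  obtain K where K: "K > 0" and Kb: "\<And>A z. finite A \<Longrightarrow>
      sqrt (real (card A)) * prob {\<omega> \<in> space M. z < isum A \<omega>} \<le> K * exp (real (card A) * \<phi> t - t * z)"
    using tail_bound by auto
  obtain K0 where K0: "K0 > 0" and ev: "eventually (\<lambda>n. \<forall>l\<in>strip a b n. real n * exp (real l * F - t * (u n * sqrt (real l))) \<le> K0) sequentially"
    using exponent_bound by blast
  define C where "C = K * K0 * sqrt (2 * F)"
  have C: "C > 0"
    using K K0 F_pos by (simp add: C_def)
  have half: "1 / 2 < (1::real)" by simp
  have "eventually (\<lambda>n. \<forall>i j. i < j \<longrightarrow> j - i \<in> strip a b n \<longrightarrow> prob (exceed (u n) i j) \<le> C / (real n * sqrt (L n))) sequentially"
    using ev strip_lower[OF half, of a b] eventually_gt_at_top[of 0] eventually_L[of 0]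
  proof (eventually_elim, intro allI impI)
    fix n i j :: nat
    assume h: "\<forall>l\<in>strip a b n. real n * exp (real l * F - t * (u n * sqrt (real l))) \<le> K0"
      "\<forall>l\<in>strip a b n. 1 / 2 * L n / F \<le> real l" "0 < n" "0 < L n" "i < j" "j - i \<in> strip a b n"
    define l where "l = j - i"
    have l: "l \<in> strip a b n" "0 < l"
      using h by (auto simp: l_def)
    have "sqrt (L n) \<le> sqrt (2 * F * real l)"
      using h(2) l(1) F_pos by (intro real_sqrt_le_mono) (auto simp: field_simps)
    then have sl: "sqrt (L n) \<le> sqrt (2 * F) * sqrt (real l)"
      by (simp add: real_sqrt_mult)
    define p where "p = prob (exceed (u n) i j)"
    have "sqrt (real l) * p \<le> K * exp (real l * F - t * (u n * sqrt (real l)))"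
      using Kb[of "{i..<j}" "u n * sqrt (real l)"] by (simp add: p_def exceed_def l_def F_def)
    then have "real n * (sqrt (real l) * p) \<le> real n * (K * exp (real l * F - t * (u n * sqrt (real l))))"
      by (rule mult_left_mono) simp
    also have "\<dots> = K * (real n * exp (real l * F - t * (u n * sqrt (real l))))"
      by simp
    also have "\<dots> \<le> K * K0"
      using h(1) l K by (intro mult_left_mono) auto
    finally have 1: "sqrt (2 * F) * (real n * (sqrt (real l) * p)) \<le> sqrt (2 * F) * (K * K0)"
      using F_pos by (intro mult_left_mono) auto
    have "sqrt (L n) * (real n * p) \<le> sqrt (2 * F) * sqrt (real l) * (real n * p)"
      by (intro mult_right_mono sl) (simp add: p_def)
    with 1 have "p * (real n * sqrt (L n)) \<le> C"
      by (simp add: C_def mult_ac)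
    then show "prob (exceed (u n) i j) \<le> C / (real n * sqrt (L n))"
      using h(3,4) by (simp add: p_def pos_le_divide_eq)
  qed
  with C show ?thesis
    by blast
qed

text \<open>For overlapping intervals the symmetric difference consists of the points between the
  two left ends and those between the two right ends.\<close>

lemma card_sym_diff_interval:
  assumes "i < j" "i' < j'" "{i..<j} \<inter> {i'..<j'} \<noteq> {}"
  shows "real (card ({i..<j} - {i'..<j'}) + card ({i'..<j'} - {i..<j})) = \<bar>real i - real i'\<bar> + \<bar>real j - real j'\<bar>"
    and "real (card ({i..<j} - {i'..<j'}) + card ({i'..<j'} - {i..<j})) =
      real (j - i) + real (j' - i') - 2 * real (card ({i..<j} \<inter> {i'..<j'}))"
proof -
  have I: "{i..<j} \<inter> {i'..<j'} = {max i i'..<min j j'}"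
    by auto
  have lt: "max i i' < min j j'"
    using assms(3) unfolding I by auto
  have "card {i..<j} = card ({i..<j} \<inter> {i'..<j'}) + card ({i..<j} - {i'..<j'})"
    "card {i'..<j'} = card ({i..<j} \<inter> {i'..<j'}) + card ({i'..<j'} - {i..<j})"
    using card_Int_Diff[of "{i..<j}" "{i'..<j'}"] card_Int_Diff[of "{i'..<j'}" "{i..<j}"] by (auto simp: Int_commute)
  then show *: "real (card ({i..<j} - {i'..<j'}) + card ({i'..<j'} - {i..<j})) =
      real (j - i) + real (j' - i') - 2 * real (card ({i..<j} \<inter> {i'..<j'}))"
    by simp
  have "real (card ({i..<j} \<inter> {i'..<j'})) = real (min j j') - real (max i i')"
    unfolding I using lt by (simp add: of_nat_diff)
  with * show "real (card ({i..<j} - {i'..<j'}) + card ({i'..<j'} - {i..<j})) = \<bar>real i - real i'\<bar> + \<bar>real j - real j'\<bar>"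
    using assms(1,2) by (auto simp: of_nat_diff min_def max_def split: if_splits)
qed

text \<open>The pair bound has the root of the overlap where \<open>sqrt (L n)\<close> is wanted. If
  the overlap is at least \<open>L n / (4 * F)\<close>, the two are comparable. Otherwise the
  distance is at least \<open>L n / F\<close>, because both lengths are at least
  \<open>3 / 4 * L n / F\<close>, and half of the exponential decay absorbs
  \<open>sqrt (L n)\<close>; hence the rate \<open>gap / 2\<close>.\<close>

lemma overlap_bound:
  "\<exists>K>0. eventually (\<lambda>n. \<forall>i j i' j'. i < j \<longrightarrow> i' < j' \<longrightarrow> {i..<j} \<inter> {i'..<j'} \<noteq> {} \<longrightarrow>
    j - i \<in> strip a b n \<longrightarrow> j' - i' \<in> strip a b n \<longrightarrow>
    prob (exceed (u n) i j \<inter> exceed (u n) i' j') \<le>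
      K / (real n * sqrt (L n)) * exp (- (gap / 2) * (\<bar>real i - real i'\<bar> + \<bar>real j - real j'\<bar>))) sequentially"
proof -
  obtain K where K: "K > 0" and Kb: "\<And>I J a b. finite I \<Longrightarrow> finite J \<Longrightarrow>
    sqrt (real (card (I \<inter> J))) * prob {\<omega> \<in> space M. a < isum I \<omega> \<and> b < isum J \<omega>} \<le>
    K * exp ((real (card I) * \<phi> t - t * a) / 2 + (real (card J) * \<phi> t - t * b) / 2 - gap * real (card (I - J) + card (J - I)))"
    using pair_bound by blast
  obtain K0 where K0: "K0 > 0" and ev: "eventually (\<lambda>n. \<forall>l\<in>strip a b n. real n * exp (real l * F - t * (u n * sqrt (real l))) \<le> K0) sequentially"
    using exponent_bound by blast
  define C where "C = max (2 * sqrt F) 1"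
  have C: "2 * sqrt F \<le> C" "1 \<le> C"
    by (auto simp: C_def)
  have pos: "0 < K * K0 * C"
    using K K0 C by (intro mult_pos_pos) auto
  have "(\<lambda>n. sqrt (L n) * exp (- (gap / (2 * F)) * L n)) \<longlonglongrightarrow> 0"
  proof -
    have *: "((\<lambda>x. sqrt x * exp (- c * x)) \<longlongrightarrow> 0) at_top" if "0 < c" for c :: real
      using that by real_asymp
    have "0 < gap / (2 * F)"
      using gap_pos F_pos by simp
    from filterlim_compose[OF *[OF this] L_at_top] show ?thesis .
  qed
  then have dec: "eventually (\<lambda>n. sqrt (L n) * exp (- (gap / (2 * F)) * L n) < 1) sequentially"
    by (rule order_tendstoD) simp
  have lt: "3 / 4 < (1::real)" by simp
  have "eventually (\<lambda>n. \<forall>i j i' j'. i < j \<longrightarrow> i' < j' \<longrightarrow> {i..<j} \<inter> {i'..<j'} \<noteq> {} \<longrightarrow>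
    j - i \<in> strip a b n \<longrightarrow> j' - i' \<in> strip a b n \<longrightarrow>
    prob (exceed (u n) i j \<inter> exceed (u n) i' j') \<le>
      K * K0 * C / (real n * sqrt (L n)) * exp (- (gap / 2) * (\<bar>real i - real i'\<bar> + \<bar>real j - real j'\<bar>))) sequentially"
    using ev dec strip_lower[OF lt, of a b] eventually_gt_at_top[of 0] eventually_L[of 0]
  proof (eventually_elim, intro allI impI)
    fix n i j i' j' :: nat
    assume h: "\<forall>l\<in>strip a b n. real n * exp (real l * F - t * (u n * sqrt (real l))) \<le> K0"
      "sqrt (L n) * exp (- (gap / (2 * F)) * L n) < 1" "\<forall>l\<in>strip a b n. 3 / 4 * L n / F \<le> real l"
      "0 < n" "0 < L n" "i < j" "i' < j'" "{i..<j} \<inter> {i'..<j'} \<noteq> {}" "j - i \<in> strip a b n" "j' - i' \<in> strip a b n"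
    define l where "l = j - i"
    define l' where "l' = j' - i'"
    define c0 where "c0 = real (card ({i..<j} \<inter> {i'..<j'}))"
    define D where "D = \<bar>real i - real i'\<bar> + \<bar>real j - real j'\<bar>"
    define p where "p = prob (exceed (u n) i j \<inter> exceed (u n) i' j')"
    have D0: "0 \<le> D" and p0: "0 \<le> p"
      by (auto simp: D_def p_def)
    have "card ({i..<j} \<inter> {i'..<j'}) \<noteq> 0"
      using h(8) by (metis card_0_eq finite_Int finite_atLeastLessThan)
    then have c1: "1 \<le> c0"
      unfolding c0_def by linarith
    have Dl: "D = real l + real l' - 2 * c0"
      using card_sym_diff_interval[OF h(6-8)] by (simp add: D_def l_def l'_def c0_def)
    define e where "e k = real k * F - t * (u n * sqrt (real k))" for k :: nat
    have "sqrt c0 * p \<le> K * exp (e l / 2 + e l' / 2 - gap * D)"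
      using Kb[of "{i..<j}" "{i'..<j'}" "u n * sqrt (real l)" "u n * sqrt (real l')"]
      unfolding card_sym_diff_interval(1)[OF h(6-8)]
      by (simp add: p_def exceed_def l_def l'_def F_def e_def D_def c0_def Int_def conj_ac)
    then have "real n * (sqrt c0 * p) \<le> real n * (K * exp (e l / 2 + e l' / 2 - gap * D))"
      by (rule mult_left_mono) simp
    also have "\<dots> = K * exp (- gap * D) * (real n * exp (e l / 2 + e l' / 2))"
    proof -
      have "exp (x - gap * D) = exp (- gap * D) * exp x" for x
        by (simp flip: exp_add)
      then show ?thesis
        by (simp only: mult_ac)
    qed
    also have "\<dots> \<le> K * exp (- gap * D) * K0"
    proof (intro mult_left_mono)
      have "exp (e l / 2 + e l' / 2) \<le> max (exp (e l)) (exp (e l'))"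
        by (cases "e l \<le> e l'") (auto simp: le_max_iff_disj)
      then have "real n * exp (e l / 2 + e l' / 2) \<le> real n * max (exp (e l)) (exp (e l'))"
        by (rule mult_left_mono) simp
      also have "\<dots> \<le> K0"
        using h(1,9,10) by (auto simp: max_def e_def l_def l'_def)
      finally show "real n * exp (e l / 2 + e l' / 2) \<le> K0" .
    qed (use K in auto)
    finally have 1: "real n * (sqrt c0 * p) \<le> K * K0 * exp (- gap * D)"
      by (simp add: mult_ac)
    have 2: "sqrt (L n) * exp (- gap * D) \<le> C * sqrt c0 * exp (- (gap / 2) * D)"
    proof (cases "L n / (4 * F) \<le> c0")
      case True
      have "sqrt (L n) = 2 * sqrt F * sqrt (L n / (4 * F))"
        using F_pos by (simp add: real_sqrt_divide real_sqrt_mult)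
      also have "\<dots> \<le> C * sqrt c0"
        using True C F_pos h(5) by (intro mult_mono) auto
      finally have "sqrt (L n) \<le> C * sqrt c0" .
      moreover have "exp (- gap * D) \<le> exp (- (gap / 2) * D)"
        using gap_pos D0 by simp
      moreover have "0 \<le> C * sqrt c0"
        using C c1 by simp
      ultimately show ?thesis
        by (intro mult_mono) auto
    next
      case False
      have "3 / 4 * L n / F \<le> real l" "3 / 4 * L n / F \<le> real l'"
        using h(3,9,10) by (auto simp: l_def l'_def)
      then have "L n / F \<le> D"
        using False F_pos unfolding Dl by (simp add: field_simps)
      then have "gap / 2 * (L n / F) \<le> gap / 2 * D"
        using gap_pos by (intro mult_left_mono) auto
      then have "exp (- (gap / 2) * D) \<le> exp (- (gap / (2 * F)) * L n)"
        by simp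
      then have "sqrt (L n) * exp (- (gap / 2) * D) \<le> sqrt (L n) * exp (- (gap / (2 * F)) * L n)"
        using h(5) by (intro mult_left_mono) auto
      also have "\<dots> \<le> 1"
        using h(2) by simp
      also have "1 \<le> C * sqrt c0"
        using C c1 mult_mono[of 1 C 1 "sqrt c0"] by simp
      finally have "sqrt (L n) * exp (- (gap / 2) * D) * exp (- (gap / 2) * D) \<le> C * sqrt c0 * exp (- (gap / 2) * D)"
        by (rule mult_right_mono) simp
      moreover have "exp (- gap * D) = exp (- (gap / 2) * D) * exp (- (gap / 2) * D)"
        by (simp flip: exp_add)
      ultimately show ?thesis
        by (simp add: mult.assoc)
    qed
    have "sqrt (L n) * (real n * (sqrt c0 * p)) \<le> sqrt (L n) * (K * K0 * exp (- gap * D))"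
      using h(5) by (intro mult_left_mono 1) auto
    also have "\<dots> = K * K0 * (sqrt (L n) * exp (- gap * D))"
      by simp
    also have "\<dots> \<le> K * K0 * (C * sqrt c0 * exp (- (gap / 2) * D))"
      using K K0 by (intro mult_left_mono 2) auto
    finally have "sqrt c0 * (p * (real n * sqrt (L n))) \<le> sqrt c0 * (K * K0 * C * exp (- (gap / 2) * D))"
      by (simp add: mult_ac)
    then have "p * (real n * sqrt (L n)) \<le> K * K0 * C * exp (- (gap / 2) * D)"
      using c1 by (subst (asm) mult_le_cancel_left_pos) auto
    then show "prob (exceed (u n) i j \<inter> exceed (u n) i' j') \<le>
      K * K0 * C / (real n * sqrt (L n)) * exp (- (gap / 2) * (\<bar>real i - real i'\<bar> + \<bar>real j - real j'\<bar>))"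
      using h(4,5) by (simp add: p_def D_def field_simps)
  qed
  with pos show ?thesis
    by blast
qed

text \<open>The bounds on single and joint exceedances needed for the block estimates, with a common
  \<open>q\<close>; the summand \<open>q\<^sup>2\<close> covers disjoint intervals, which are
  independent.\<close>

definition Q_ok :: "real \<Rightarrow> nat \<Rightarrow> bool" where
  "Q_ok q n \<longleftrightarrow> (\<forall>i j. i < j \<longrightarrow> j - i \<in> strip A1 A2 n \<longrightarrow> prob (exceed (u n) i j) \<le> q) \<and>
    (\<forall>i j i' j'. i < j \<longrightarrow> i' < j' \<longrightarrow> j - i \<in> strip A1 A2 n \<longrightarrow> j' - i' \<in> strip A1 A2 n \<longrightarrow>
      prob (exceed (u n) i j \<inter> exceed (u n) i' j') \<le> q * exp (- (gap / 2) * (\<bar>real i - real i'\<bar> + \<bar>real j - real j'\<bar>)) + q\<^sup>2)"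

lemma eventually_Q_ok: "\<exists>K>0. eventually (\<lambda>n. Q_ok (K / (real n * sqrt (L n))) n) sequentially"
proof -
  obtain K1 where K1: "K1 > 0" "eventually (\<lambda>n. \<forall>i j. i < j \<longrightarrow> j - i \<in> strip A1 A2 n \<longrightarrow>
    prob (exceed (u n) i j) \<le> K1 / (real n * sqrt (L n))) sequentially"
    using single_bound by blast
  obtain K2 where K2: "K2 > 0" "eventually (\<lambda>n. \<forall>i j i' j'. i < j \<longrightarrow> i' < j' \<longrightarrow> {i..<j} \<inter> {i'..<j'} \<noteq> {} \<longrightarrow>
    j - i \<in> strip A1 A2 n \<longrightarrow> j' - i' \<in> strip A1 A2 n \<longrightarrow>
    prob (exceed (u n) i j \<inter> exceed (u n) i' j') \<le>
      K2 / (real n * sqrt (L n)) * exp (- (gap / 2) * (\<bar>real i - real i'\<bar> + \<bar>real j - real j'\<bar>))) sequentially"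
    using overlap_bound by blast
  define K where "K = max K1 K2"
  have "eventually (\<lambda>n. Q_ok (K / (real n * sqrt (L n))) n) sequentially"
    using K1(2) K2(2) eventually_gt_at_top[of 0] eventually_L[of 0]
  proof eventually_elim
    case (elim n)
    define q where "q = K / (real n * sqrt (L n))"
    have q1: "K1 / (real n * sqrt (L n)) \<le> q" and q2: "K2 / (real n * sqrt (L n)) \<le> q"
      unfolding q_def using elim(3,4) by (auto intro!: divide_right_mono simp: K_def)
    have s: "prob (exceed (u n) i j) \<le> q" if "i < j" "j - i \<in> strip A1 A2 n" for i j
      using elim(1) that q1 by (meson order_trans)
    have q0: "0 \<le> q"
      using K1 elim(3,4) by (simp add: q_def K_def)
    have "prob (exceed (u n) i j \<inter> exceed (u n) i' j') \<le> q * exp (- (gap / 2) * (\<bar>real i - real i'\<bar> + \<bar>real j - real j'\<bar>)) + q\<^sup>2"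
      if h: "i < j" "i' < j'" "j - i \<in> strip A1 A2 n" "j' - i' \<in> strip A1 A2 n" for i j i' j'
    proof (cases "{i..<j} \<inter> {i'..<j'} = {}")
      case True
      have "exceed (u n) i j \<inter> exceed (u n) i' j' =
        {\<omega> \<in> space M. u n * sqrt (real (j - i)) < isum {i..<j} \<omega> \<and> u n * sqrt (real (j' - i')) < isum {i'..<j'} \<omega>}"
        by (auto simp: exceed_def)
      then have "prob (exceed (u n) i j \<inter> exceed (u n) i' j') = prob (exceed (u n) i j) * prob (exceed (u n) i' j')"
        using prob_disjoint_pair[OF True] by (simp add: exceed_def)
      also have "\<dots> \<le> q * q"
        using s h q0 by (intro mult_mono) auto
      finally show ?thesis
        using q0 by (simp add: power2_eq_square add_increasing)
    next
      case False
      have "prob (exceed (u n) i j \<inter> exceed (u n) i' j') \<le>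
        K2 / (real n * sqrt (L n)) * exp (- (gap / 2) * (\<bar>real i - real i'\<bar> + \<bar>real j - real j'\<bar>))"
        using elim(2) h False by blast
      also have "\<dots> \<le> q * exp (- (gap / 2) * (\<bar>real i - real i'\<bar> + \<bar>real j - real j'\<bar>))"
        by (intro mult_right_mono q2) simp
      finally show ?thesis
        by (simp add: add_increasing2)
    qed
    with s show ?case
      unfolding Q_ok_def q_def by blast
  qed
  moreover have "K > 0"
    using K1 by (simp add: K_def)
  ultimately show ?thesis
    by blast
qed

end

section \<open>Summation over the lengths\<close>

lemma affine_sqrt_at_top:
  fixes a c :: real
  assumes "0 < c"
  shows "filterlim (\<lambda>x. x / c + a * sqrt x) at_top at_top"
proof -
  have "((\<lambda>x. 1 / c + a / sqrt x) \<longlongrightarrow> 1 / c + 0) at_top"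
    by (intro tendsto_add tendsto_const real_tendsto_divide_at_top[OF tendsto_const] sqrt_at_top)
  then have "filterlim (\<lambda>x. (1 / c + a / sqrt x) * x) at_top at_top"
    using filterlim_tendsto_pos_mult_at_top[OF _ _ filterlim_ident] assms by fastforce
  moreover have "eventually (\<lambda>x. (1 / c + a / sqrt x) * x = x / c + a * sqrt x) at_top"
    using eventually_gt_at_top[of 0]
  proof eventually_elim
    case (elim x)
    then have "x / sqrt x = sqrt x"
      by (simp add: real_div_sqrt)
    then have "a / sqrt x * x = a * sqrt x"
      by (metis times_divide_eq_left times_divide_eq_right)
    then show ?case
      by (simp add: distrib_right)
  qed
  ultimately show ?thesis
    by (simp add: filterlim_cong)
qed

text \<open>Applied at \<open>L n\<close>, it compares the strip lengths with the square of
  \<open>L n\<close>, the order of the block length.\<close>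

lemma affine_sqrt_negligible:
  fixes b c :: real
  shows "((\<lambda>x. (x / c + b * sqrt x) / x\<^sup>2) \<longlongrightarrow> 0) at_top"
proof -
  have "((\<lambda>x::real. x / x\<^sup>2) \<longlongrightarrow> 0) at_top" "((\<lambda>x::real. sqrt x / x\<^sup>2) \<longlongrightarrow> 0) at_top"
    by real_asymp+
  then have "((\<lambda>x. (1 / c) * (x / x\<^sup>2) + b * (sqrt x / x\<^sup>2)) \<longlongrightarrow> (1 / c) * 0 + b * 0) at_top"
    by (intro tendsto_intros)
  then show ?thesis
    by (simp add: add_divide_distrib)
qed

context exceedances
begin

text \<open>Union bound over the pairs \<open>(a, b)\<close> of the cell; it provides the majorant
  for the Riemann sum.\<close>

lemma prob_cell_le:
  assumes q: "\<And>i j. i < j \<Longrightarrow> j - i \<in> S \<Longrightarrow> prob (exceed v i j) \<le> q"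
    and l: "0 < l" and S: "\<And>k. l \<le> k \<Longrightarrow> k \<le> l + 2 * B \<Longrightarrow> k \<in> S"
  shows "prob (cell v l B) \<le> (real B + 1)\<^sup>2 * q"
proof -
  define E where "E = (\<lambda>(a, b). exceed v (B - a) (B + l + b))"
  have "cell v l B \<subseteq> (\<Union>z\<in>{..B} \<times> {..B}. E z)"
  proof
    fix \<omega> assume "\<omega> \<in> cell v l B"
    then obtain a b where ab: "a \<le> B" "b \<le> B" "\<omega> \<in> space M" "v * sqrt (real (l + a + b)) < isum {B - a..<B + l + b} \<omega>"
      by (auto simp: cell_def)
    have eq: "B + l + b - (B - a) = l + a + b"
      using ab by simp
    have "\<omega> \<in> E (a, b)"
      unfolding E_def exceed_def prod.case mem_Collect_eq eq using ab by blast
    with ab show "\<omega> \<in> (\<Union>z\<in>{..B} \<times> {..B}. E z)"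
      by (intro UN_I[of "(a, b)"]) auto
  qed
  moreover have "prob (E z) \<le> q" if "z \<in> {..B} \<times> {..B}" for z
    using that l by (auto simp: E_def intro!: q S)
  ultimately have "prob (cell v l B) \<le> real (card ({..B} \<times> {..B})) * q"
    by (intro union_bound) (auto simp: E_def split: prod.split)
  then show ?thesis
    by (simp add: card_cartesian_product power2_eq_square algebra_simps)
qed

lemma continuous_\<kappa>: "continuous_on A \<kappa>"
  unfolding \<kappa>_def by (intro continuous_intros)

text \<open>The sum over \<open>k\<close> is the integral of a step function in the coordinate
  \<open>a\<close>, with steps of width \<open>s / sqrt (L n)\<close>. For \<open>a\<close> in the
  open interval, the step containing it has a coordinate tending to \<open>a\<close>, so
  \<open>cell_limit\<close> applies; the bound for single exceedances, on a strip enlarged by 1 at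
  both ends, gives the majorant. The index set stays abstract because the upper estimate counts the
  cells that meet the strip and the lower one those inside it.\<close>

lemma riemann:
  fixes K :: "nat \<Rightarrow> nat set" and s B :: nat
  assumes s: "0 < s"
    and fin: "eventually (\<lambda>n. finite (K n) \<and> (\<forall>k\<in>K n. B < k * s \<and>
      L n / F + (A1 - 1) * sqrt (L n) + real B \<le> real (k * s) \<and> real (k * s) + real B + real s \<le> L n / F + (A2 + 1) * sqrt (L n))) sequentially"
    and inn: "\<And>a. A1 < a \<Longrightarrow> a < A2 \<Longrightarrow> eventually (\<lambda>n. \<forall>k. real (k * s) \<le> L n / F + a * sqrt (L n) \<longrightarrow>
      L n / F + a * sqrt (L n) < real (k * s) + real s \<longrightarrow> k \<in> K n) sequentially"
    and out: "\<And>a. a < A1 \<or> A2 < a \<Longrightarrow> eventually (\<lambda>n. \<forall>k. real (k * s) \<le> L n / F + a * sqrt (L n) \<longrightarrow>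
      L n / F + a * sqrt (L n) < real (k * s) + real s \<longrightarrow> k \<notin> K n) sequentially"
  shows "(\<lambda>n. real n * (\<Sum>k\<in>K n. prob (cell (u n) (k * s - B) B))) \<longlonglongrightarrow> (hmax B)\<^sup>2 * integral {A1..A2} \<kappa> / real s"
proof -
  obtain Q where Q: "Q > 0" and Qev: "eventually (\<lambda>n. \<forall>i j. i < j \<longrightarrow> j - i \<in> strip (A1 - 1) (A2 + 1) n \<longrightarrow>
    prob (exceed (u n) i j) \<le> Q / (real n * sqrt (L n))) sequentially"
    using single_bound by blast
  define v where "v n k = real n * sqrt (L n) * prob (cell (u n) (k * s - B) B)" for n k
  define pos where "pos n a = L n / F + a * sqrt (L n)" for n a
  define \<alpha> where "\<alpha> n k = (real (k * s) - L n / F) / sqrt (L n)" for n k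
  define C where "C = (real B + 1)\<^sup>2 * Q"
  \<comment> \<open>For the remaining \<open>n\<close> the step function is replaced by 0, so that
    the majorant holds without exception.\<close>
  define good where "good n \<longleftrightarrow> 0 < L n \<and> finite (K n) \<and> (\<forall>k\<in>K n. v n k \<le> C \<and> A1 - 1 \<le> \<alpha> n k \<and> \<alpha> n (Suc k) \<le> A2 + 1)" for n
  define G where "G n a = (if good n then \<Sum>k\<in>K n. v n k * indicator {\<alpha> n k..<\<alpha> n (Suc k)} a else 0)" for n a
  have \<alpha>_iff: "a \<in> {\<alpha> n k..<\<alpha> n (Suc k)} \<longleftrightarrow> real (k * s) \<le> pos n a \<and> pos n a < real (k * s) + real s"
    if "0 < L n" for a n k
    using that by (auto simp: \<alpha>_def pos_def pos_divide_le_eq pos_less_divide_eq algebra_simps)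
  have ev_good: "eventually good sequentially"
    using fin Qev eventually_L[of 0] eventually_gt_at_top[of 0]
  proof eventually_elim
    case (elim n)
    have "v n k \<le> C \<and> A1 - 1 \<le> \<alpha> n k \<and> \<alpha> n (Suc k) \<le> A2 + 1" if k: "k \<in> K n" for k
    proof (intro conjI)
      have kk: "B < k * s" "L n / F + (A1 - 1) * sqrt (L n) + real B \<le> real (k * s)"
        "real (k * s) + real B + real s \<le> L n / F + (A2 + 1) * sqrt (L n)"
        using elim(1) k by auto
      have "prob (cell (u n) (k * s - B) B) \<le> (real B + 1)\<^sup>2 * (Q / (real n * sqrt (L n)))"
      proof (rule prob_cell_le)
        show "prob (exceed (u n) i j) \<le> Q / (real n * sqrt (L n))" if "i < j" "j - i \<in> strip (A1 - 1) (A2 + 1) n" for i j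
          using elim(2) that by blast
        show "0 < k * s - B"
          using kk(1) by simp
        show "r \<in> strip (A1 - 1) (A2 + 1) n" if "k * s - B \<le> r" "r \<le> k * s - B + 2 * B" for r
        proof -
          have "k * s \<le> r + B" "r \<le> k * s + B" "0 < r"
            using that kk(1) by auto
          then have "real (k * s) \<le> real r + real B" "real r \<le> real (k * s) + real B"
            by (metis of_nat_add of_nat_le_iff)+
          then show ?thesis
            using kk \<open>0 < r\<close> by (auto simp: strip_def simp del: of_nat_mult)
        qed
      qed
      then have "real n * sqrt (L n) * prob (cell (u n) (k * s - B) B) \<le> real n * sqrt (L n) * ((real B + 1)\<^sup>2 * (Q / (real n * sqrt (L n))))"
        using elim(3) by (intro mult_left_mono) auto
      then show "v n k \<le> C"
        using elim by (simp add: v_def C_def)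
      show "A1 - 1 \<le> \<alpha> n k" "\<alpha> n (Suc k) \<le> A2 + 1"
      proof -
        have r: "0 < sqrt (L n)"
          using elim(3) by simp
        show "A1 - 1 \<le> \<alpha> n k"
          unfolding \<alpha>_def pos_le_divide_eq[OF r] using kk(2) by linarith
        have "real (Suc k * s) = real (k * s) + real s"
          by simp
        then show "\<alpha> n (Suc k) \<le> A2 + 1"
          unfolding \<alpha>_def pos_divide_le_eq[OF r] using kk(3) by linarith
      qed
    qed
    with elim show ?case
      by (simp add: good_def)
  qed
  \<comment> \<open>The steps are disjoint, being indexed by multiples of \<open>s\<close> that are
    \<open>s\<close> apart, so at most one of them contributes at \<open>a\<close>.\<close>
  have G_unique: "G n a = v n k" if "good n" "k \<in> K n" "real (k * s) \<le> pos n a" "pos n a < real (k * s) + real s" for n a k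
  proof -
    have L: "0 < L n" and fK: "finite (K n)"
      using that(1) by (auto simp: good_def)
    have "indicator {\<alpha> n k'..<\<alpha> n (Suc k')} a = (if k' = k then 1 else 0 :: real)" for k'
    proof (cases "k' = k")
      case False
      have "a \<notin> {\<alpha> n k'..<\<alpha> n (Suc k')}"
      proof
        assume "a \<in> {\<alpha> n k'..<\<alpha> n (Suc k')}"
        then have "real (k' * s) \<le> pos n a" "pos n a < real (k' * s) + real s"
          using \<alpha>_iff[OF L] by auto
        with that(3,4) have "real (k' * s) < real (k * s + s)" "real (k * s) < real (k' * s + s)"
          by auto
        then have "k' * s < Suc k * s" "k * s < Suc k' * s"
          unfolding of_nat_less_iff by simp_all
        then have "k' < Suc k" "k < Suc k'"
          by (simp_all only: mult_less_cancel2)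
        with False show False
          by simp
      qed
      with False show ?thesis
        by (simp add: indicator_def)
    next
      case True
      then have "a \<in> {\<alpha> n k'..<\<alpha> n (Suc k')}"
        using that(3,4) \<alpha>_iff[OF L] by auto
      with True show ?thesis
        by (simp add: indicator_def)
    qed
    then show ?thesis
      using that(1,2) fK by (simp add: G_def sum.delta if_distrib[of "\<lambda>x. v n _ * x"] cong: if_cong)
  qed
  have G_zero: "G n a = 0" if "good n" "\<And>k. k \<in> K n \<Longrightarrow> \<not> (real (k * s) \<le> pos n a \<and> pos n a < real (k * s) + real s)" for n a
  proof -
    have L: "0 < L n"
      using that(1) by (simp add: good_def)
    have "indicator {\<alpha> n k..<\<alpha> n (Suc k)} a = (0 :: real)" if "k \<in> K n" for k
      using \<open>k \<in> K n \<Longrightarrow> _\<close>[OF that] \<alpha>_iff[OF L, of a k] by (simp only: indicator_def of_bool_eq simp_thms)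
    then show ?thesis
      by (simp add: G_def)
  qed
  have v0: "0 \<le> v n k" if "0 < L n" for n k
    using that by (simp add: v_def)
  have lim: "(\<lambda>n. \<integral>a. G n a \<partial>lborel) \<longlonglongrightarrow> (\<integral>a. indicator {A1..A2} a *\<^sub>R (\<kappa> a * (hmax B)\<^sup>2) \<partial>lborel)"
  proof (rule integral_dominated_convergence[where w = "\<lambda>a. C * indicator {A1 - 1..A2 + 1} a"])
    show "(\<lambda>a. indicator {A1..A2} a *\<^sub>R (\<kappa> a * (hmax B)\<^sup>2)) \<in> borel_measurable lborel"
      unfolding \<kappa>_def by measurable
    show "G n \<in> borel_measurable lborel" for n
      unfolding G_def[abs_def] by measurable
    show "integrable lborel (\<lambda>a. C * indicator {A1 - 1..A2 + 1} a)"
      by (intro integrable_mult_right integrable_real_indicator) (auto simp: emeasure_lborel_Icc_eq)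
    show "AE a in lborel. norm (G n a) \<le> C * indicator {A1 - 1..A2 + 1} a" for n
    proof (rule AE_I2)
      fix a
      have C0: "0 \<le> C"
        using Q by (simp add: C_def)
      show "norm (G n a) \<le> C * indicator {A1 - 1..A2 + 1} a"
      proof (cases "good n \<and> (\<exists>k\<in>K n. real (k * s) \<le> pos n a \<and> pos n a < real (k * s) + real s)")
        case True
        then obtain k where g: "good n" and k: "k \<in> K n" "real (k * s) \<le> pos n a" "pos n a < real (k * s) + real s"
          by blast
        have L: "0 < L n"
          using g by (simp add: good_def)
        have "a \<in> {\<alpha> n k..<\<alpha> n (Suc k)}"
          using k \<alpha>_iff[OF L] by auto
        moreover have "v n k \<le> C" "A1 - 1 \<le> \<alpha> n k" "\<alpha> n (Suc k) \<le> A2 + 1"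
          using g k(1) by (auto simp: good_def)
        ultimately show ?thesis
          using G_unique[OF g k] v0[OF L, of k] by (simp add: indicator_def)
      next
        case False
        then have "G n a = 0"
          using G_zero[of n a] by (cases "good n") (auto simp: G_def)
        with C0 show ?thesis
          by simp
      qed
    qed
    \<comment> \<open>The end points \<open>A1\<close> and \<open>A2\<close> are exempt, since the
      hypotheses do not control the index set there.\<close>
    show "AE a in lborel. (\<lambda>n. G n a) \<longlonglongrightarrow> indicator {A1..A2} a *\<^sub>R (\<kappa> a * (hmax B)\<^sup>2)"
      using AE_lborel_singleton[of A1] AE_lborel_singleton[of A2]
    proof eventually_elim
      case (elim a)
      show ?case
      proof (cases "A1 < a \<and> a < A2")
        case True
        define k where "k n = nat \<lfloor>pos n a / real s\<rfloor>" for n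
        have posL: "filterlim (\<lambda>n. pos n a) at_top sequentially"
          unfolding pos_def by (rule filterlim_compose[OF affine_sqrt_at_top[OF F_pos] L_at_top])
        then have "eventually (\<lambda>n. 0 < pos n a) sequentially"
          by (simp add: filterlim_at_top_dense)
        then have kpos: "eventually (\<lambda>n. real (k n * s) \<le> pos n a \<and> pos n a < real (k n * s) + real s) sequentially"
        proof eventually_elim
          case (elim n)
          have "real (k n) = of_int \<lfloor>pos n a / real s\<rfloor>"
            using elim s by (simp add: k_def)
          then have "real (k n) \<le> pos n a / real s" "pos n a / real s < real (k n) + 1"
            by linarith+
          then show ?case
            using s by (simp add: pos_le_divide_eq pos_divide_less_eq distrib_right)
        qed
        have "eventually (\<lambda>n. v n (k n) = G n a) sequentially"
        proof -
          have "eventually (\<lambda>n. \<forall>k. real (k * s) \<le> pos n a \<longrightarrow> pos n a < real (k * s) + real s \<longrightarrow> k \<in> K n) sequentially"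
            using inn[of a] True unfolding pos_def by blast
          from this kpos ev_good show ?thesis
            by eventually_elim (rule G_unique[symmetric], blast+)
        qed
        moreover have "(\<lambda>n. v n (k n)) \<longlonglongrightarrow> \<kappa> a * (hmax B)\<^sup>2"
          unfolding v_def
        proof (rule cell_limit)
          have "(\<lambda>n. (real (k n * s - B) - pos n a) / sqrt (L n)) \<longlonglongrightarrow> 0"
          proof (rule Lim_null_comparison)
            show "eventually (\<lambda>n. norm ((real (k n * s - B) - pos n a) / sqrt (L n)) \<le> real (s + B) / sqrt (L n)) sequentially"
              using kpos eventually_L[of 0]
            proof eventually_elim
              case (elim n)
              have "real (k n * s) - real B \<le> real (k n * s - B)" "real (k n * s - B) \<le> real (k n * s)"
                by linarith+
              then have "\<bar>real (k n * s - B) - pos n a\<bar> \<le> real (s + B)"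
                using elim(1) by (simp only: of_nat_add) linarith
              then show ?case
                using elim(2) by (simp add: abs_of_pos divide_right_mono del: of_nat_add)
            qed
            show "(\<lambda>n. real (s + B) / sqrt (L n)) \<longlonglongrightarrow> 0"
              by (intro real_tendsto_divide_at_top[OF tendsto_const] filterlim_compose[OF sqrt_at_top L_at_top])
          qed
          from tendsto_add[OF this tendsto_const[of a]]
          have "(\<lambda>n. (real (k n * s - B) - pos n a) / sqrt (L n) + a) \<longlonglongrightarrow> a"
            by simp
          moreover have "eventually (\<lambda>n. (real (k n * s - B) - pos n a) / sqrt (L n) + a = (real (k n * s - B) - L n / F) / sqrt (L n)) sequentially"
            using eventually_L[of 0] by eventually_elim (simp add: pos_def field_simps)
          ultimately show "(\<lambda>n. (real (k n * s - B) - L n / F) / sqrt (L n)) \<longlonglongrightarrow> a"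
            using Lim_transform_eventually by fastforce
        qed
        ultimately have "(\<lambda>n. G n a) \<longlonglongrightarrow> \<kappa> a * (hmax B)\<^sup>2"
          using Lim_transform_eventually by fastforce
        with True show ?thesis
          by simp
      next
        case False
        with elim have *: "a < A1 \<or> A2 < a"
          by auto
        have "eventually (\<lambda>n. G n a = 0) sequentially"
          using out[OF *] ev_good by eventually_elim (rule G_zero, auto simp: pos_def)
        then have "(\<lambda>n. G n a) \<longlonglongrightarrow> 0"
          by (rule tendsto_eventually)
        with * show ?thesis
          by (auto simp: indicator_def)
      qed
    qed
  qed
  have "(\<integral>a. indicator {A1..A2} a *\<^sub>R (\<kappa> a * (hmax B)\<^sup>2) \<partial>lborel) = (hmax B)\<^sup>2 * integral {A1..A2} \<kappa>"
  proof -
    have "set_integrable lborel {A1..A2} \<kappa>"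
      unfolding set_integrable_def by (intro borel_integrable_compact continuous_\<kappa>) auto
    from set_borel_integral_eq_integral(2)[OF this]
    have "(\<integral>a. indicator {A1..A2} a *\<^sub>R \<kappa> a \<partial>lborel) = integral {A1..A2} \<kappa>"
      by (simp only: set_lebesgue_integral_def)
    moreover have "(\<lambda>a. indicator {A1..A2} a *\<^sub>R (\<kappa> a * (hmax B)\<^sup>2)) = (\<lambda>a. (hmax B)\<^sup>2 * (indicator {A1..A2} a *\<^sub>R \<kappa> a))"
      by auto
    ultimately show ?thesis
      by (simp only: integral_mult_right_zero)
  qed
  moreover have "eventually (\<lambda>n. (\<integral>a. G n a \<partial>lborel) = real s * (real n * (\<Sum>k\<in>K n. prob (cell (u n) (k * s - B) B)))) sequentially"
    using ev_good
  proof eventually_elim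
    case (elim n)
    have L: "0 < L n" and fK: "finite (K n)"
      using elim by (auto simp: good_def)
    have "\<alpha> n (Suc k) - \<alpha> n k = real s / sqrt (L n)" for k
      by (simp add: \<alpha>_def diff_divide_distrib[symmetric])
    moreover from this have le: "\<alpha> n k \<le> \<alpha> n (Suc k)" for k
      using L s by (smt (verit, best) divide_nonneg_nonneg of_nat_0_le_iff real_sqrt_ge_zero)
    ultimately have m: "measure lborel {\<alpha> n k..<\<alpha> n (Suc k)} = real s / sqrt (L n)" for k
      by (simp add: measure_lborel_Ico)
    have "(\<integral>a. G n a \<partial>lborel) = (\<Sum>k\<in>K n. v n k * (real s / sqrt (L n)))"
    proof -
      have "integrable lborel (\<lambda>a. v n k * indicator {\<alpha> n k..<\<alpha> n (Suc k)} a)" for k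
        by (intro integrable_mult_right integrable_real_indicator) (auto simp: emeasure_lborel_Ico[OF le])
      then show ?thesis
        using elim unfolding G_def by (simp add: Bochner_Integration.integral_sum m del: integrable_mult_right_iff)
    qed
    also have "\<dots> = real s * (real n * (\<Sum>k\<in>K n. prob (cell (u n) (k * s - B) B)))"
      using L by (simp add: v_def sum_distrib_left mult_ac)
    finally show ?case .
  qed
  ultimately have "(\<lambda>n. real s * (real n * (\<Sum>k\<in>K n. prob (cell (u n) (k * s - B) B)))) \<longlonglongrightarrow> (hmax B)\<^sup>2 * integral {A1..A2} \<kappa>"
    using lim Lim_transform_eventually by fastforce
  from tendsto_divide[OF this tendsto_const[of "real s"]] s show ?thesis
    by simp
qed


section \<open>Exceedances in a single block\<close>

lemma strip_end_at_top: "filterlim (\<lambda>n. L n / F + a * sqrt (L n)) at_top sequentially"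
  by (rule filterlim_compose[OF affine_sqrt_at_top[OF F_pos] L_at_top])

lemma eventually_strip_end: "eventually (\<lambda>n. c < L n / F + a * sqrt (L n)) sequentially"
  using strip_end_at_top[of a] by (simp add: filterlim_at_top_dense)

lemma finite_strip: "finite (strip a b n)"
proof (rule finite_subset)
  show "strip a b n \<subseteq> {..nat \<lfloor>L n / F + b * sqrt (L n)\<rfloor>}"
    by (auto simp: strip_def le_nat_floor)
qed simp

lemma eventually_width: "0 < d \<Longrightarrow> eventually (\<lambda>n. c \<le> d * sqrt (L n)) sequentially"
  using eventually_sqrt_L[of "c / d"] by (auto elim!: eventually_mono simp: pos_divide_less_eq mult.commute)

lemma card_strip: "eventually (\<lambda>n. real (card (strip A1 A2 n)) \<le> (A2 - A1) * sqrt (L n) + 1) sequentially"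
  using eventually_strip_end[of 0 A1] eventually_L[of 0]
proof eventually_elim
  case (elim n)
  define x where "x = L n / F + A1 * sqrt (L n)"
  define y where "y = L n / F + A2 * sqrt (L n)"
  have xy: "0 < x" "x \<le> y" "y - x = (A2 - A1) * sqrt (L n)"
    using elim A12 by (auto simp: x_def y_def left_diff_distrib intro!: mult_right_mono)
  have "strip A1 A2 n \<subseteq> {nat \<lceil>x\<rceil>..nat \<lfloor>y\<rfloor>}"
    by (auto simp: strip_def x_def y_def le_nat_floor)
  then have "card (strip A1 A2 n) \<le> card {nat \<lceil>x\<rceil>..nat \<lfloor>y\<rfloor>}"
    by (intro card_mono) auto
  also have "\<dots> = nat \<lfloor>y\<rfloor> + 1 - nat \<lceil>x\<rceil>"
    by simp
  finally have "real (card (strip A1 A2 n)) \<le> real (nat \<lfloor>y\<rfloor> + 1 - nat \<lceil>x\<rceil>)"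
    by simp
  also have "\<dots> \<le> y - x + 1"
    using xy(1,2) by linarith
  finally show ?case
    by (simp add: xy(3))
qed

text \<open>Long compared with the lengths of the strip, which are of order \<open>L n\<close>, so
  that few intervals cross a block boundary; short compared with \<open>n\<close>, so that many
  independent blocks fit.\<close>

definition N :: "nat \<Rightarrow> nat" where "N n = nat \<lceil>(L n)\<^sup>2\<rceil>"

definition pN :: "nat \<Rightarrow> real" where "pN n = prob (exc (u n) (strip A1 A2 n) 0 (N n))"

definition J :: real where "J = integral {A1..A2} \<kappa>"

lemma N_bounds: "(L n)\<^sup>2 \<le> real (N n)" "real (N n) \<le> (L n)\<^sup>2 + 1"
  unfolding N_def using zero_le_power2[of "L n"] by linarith+

lemma eventually_N_pos: "eventually (\<lambda>n. 0 < N n) sequentially"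
  using eventually_L[of 0]
proof eventually_elim
  case (elim n)
  then have "0 < (L n)\<^sup>2" by simp
  then show ?case
    using N_bounds(1)[of n] by linarith
qed

lemma N_div_n: "(\<lambda>n. real (N n) / real n) \<longlonglongrightarrow> 0"
proof (rule tendsto_sandwich[where f = "\<lambda>_. 0"])
  show "eventually (\<lambda>n. real (N n) / real n \<le> ((ln (real n))\<^sup>2 + 1) / real n) sequentially"
    using N_bounds(2) by (intro always_eventually allI divide_right_mono) (auto simp: L_def)
  show "(\<lambda>n. ((ln (real n))\<^sup>2 + 1) / real n) \<longlonglongrightarrow> 0"
    by real_asymp
qed (auto intro: always_eventually)

lemma strip_div_N: "(\<lambda>n. (L n / F + b * sqrt (L n)) / real (N n)) \<longlonglongrightarrow> 0"
proof (rule Lim_null_comparison)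
  show "eventually (\<lambda>n. norm ((L n / F + b * sqrt (L n)) / real (N n)) \<le> \<bar>(L n / F + b * sqrt (L n)) / (L n)\<^sup>2\<bar>) sequentially"
    using eventually_L[of 0]
  proof eventually_elim
    case (elim n)
    then have "0 < (L n)\<^sup>2" by simp
    moreover from this have "0 < real (N n)"
      using N_bounds(1)[of n] by linarith
    ultimately show ?case
      using N_bounds(1)[of n] unfolding real_norm_def abs_divide
      by (intro divide_left_mono mult_pos_pos) auto
  qed
  from tendsto_rabs[OF filterlim_compose[OF affine_sqrt_negligible[of F b] L_at_top]]
  show "(\<lambda>n. \<bar>(L n / F + b * sqrt (L n)) / (L n)\<^sup>2\<bar>) \<longlonglongrightarrow> 0"
    by simp
qed

lemma inverse_N: "(\<lambda>n. 1 / real (N n)) \<longlonglongrightarrow> 0"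
proof (rule tendsto_sandwich[where f = "\<lambda>_. 0"])
  show "eventually (\<lambda>n. 1 / real (N n) \<le> 1 / (L n)\<^sup>2) sequentially"
    using eventually_L[of 0]
  proof eventually_elim
    case (elim n)
    then have "0 < (L n)\<^sup>2" by simp
    moreover from this have "0 < real (N n)"
      using N_bounds(1)[of n] by linarith
    ultimately show ?case
      using N_bounds(1)[of n] by (intro divide_left_mono mult_pos_pos) auto
  qed
  have "((\<lambda>x::real. 1 / x\<^sup>2) \<longlongrightarrow> 0) at_top"
    by real_asymp
  from filterlim_compose[OF this L_at_top] show "(\<lambda>n. 1 / (L n)\<^sup>2) \<longlonglongrightarrow> 0" .
qed (auto intro: always_eventually)

text \<open>Cells of side \<open>B + 1\<close> without spacing, where \<open>K n\<close> collects
  those meeting the strip. One factor 1 / s comes from the number of positions in the block, the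
  other from the Riemann sum.\<close>

lemma pN_upper:
  assumes \<epsilon>: "0 < \<epsilon>"
  shows "eventually (\<lambda>n. real n / real (N n) * pN n \<le> J * (hmax B / real (B + 1))\<^sup>2 + \<epsilon>) sequentially"
proof -
  define s where "s = B + 1"
  define K where "K n = {k. \<exists>l\<in>strip A1 A2 n. k * s \<le> l + B \<and> l \<le> k * s + B}" for n
  have finK: "finite (K n)" for n
  proof (rule finite_subset)
    show "K n \<subseteq> (\<Union>l\<in>strip A1 A2 n. {..l + B})"
    proof
      fix k assume "k \<in> K n"
      then obtain l where "l \<in> strip A1 A2 n" "k * s \<le> l + B"
        by (auto simp: K_def)
      moreover have "k \<le> k * s"
        by (simp add: s_def)
      ultimately have "k \<le> l + B"
        by linarith
      with \<open>l \<in> strip A1 A2 n\<close> show "k \<in> (\<Union>l\<in>strip A1 A2 n. {..l + B})"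
        by auto
    qed
  qed (auto intro: finite_strip)
  have K_D: "\<exists>l. L n / F + A1 * sqrt (L n) \<le> real l \<and> real l \<le> L n / F + A2 * sqrt (L n) \<and>
      real (k * s) \<le> real l + real B \<and> real l \<le> real (k * s) + real B" if "k \<in> K n" for n k
  proof -
    obtain l where l: "l \<in> strip A1 A2 n" "k * s \<le> l + B" "l \<le> k * s + B"
      using \<open>k \<in> K n\<close> unfolding K_def by blast
    have "real (k * s) \<le> real (l + B)" "real l \<le> real (k * s + B)"
      using l(2,3) by (simp_all only: of_nat_le_iff)
    then show ?thesis
      using l(1) by (intro exI[of _ l]) (auto simp: strip_def)
  qed
  have riem: "(\<lambda>n. real n * (\<Sum>k\<in>K n. prob (cell (u n) (k * s - B) B))) \<longlonglongrightarrow> (hmax B)\<^sup>2 * J / real s"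
    unfolding J_def
  proof (rule riemann)
    show "0 < s" by (simp add: s_def)
    show "eventually (\<lambda>n. finite (K n) \<and> (\<forall>k\<in>K n. B < k * s \<and>
      L n / F + (A1 - 1) * sqrt (L n) + real B \<le> real (k * s) \<and> real (k * s) + real B + real s \<le> L n / F + (A2 + 1) * sqrt (L n))) sequentially"
      using eventually_sqrt_L[of "2 * real B + real s"] eventually_strip_end[of "2 * real B" A1]
    proof (eventually_elim, intro conjI ballI)
      fix n k assume h: "2 * real B + real s < sqrt (L n)" "2 * real B < L n / F + A1 * sqrt (L n)" "k \<in> K n"
      obtain l where l: "L n / F + A1 * sqrt (L n) \<le> real l" "real l \<le> L n / F + A2 * sqrt (L n)"
        "real (k * s) \<le> real l + real B" "real l \<le> real (k * s) + real B"
        using K_D[OF h(3)] by blast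
      have "real B < real (k * s)"
        using h l by linarith
      then show "B < k * s"
        by (simp only: of_nat_less_iff)
      show "L n / F + (A1 - 1) * sqrt (L n) + real B \<le> real (k * s)"
        unfolding left_diff_distrib using h l by linarith
      show "real (k * s) + real B + real s \<le> L n / F + (A2 + 1) * sqrt (L n)"
        unfolding distrib_right using h l by linarith
    qed (rule finK)
    show "eventually (\<lambda>n. \<forall>k. real (k * s) \<le> L n / F + a * sqrt (L n) \<longrightarrow>
      L n / F + a * sqrt (L n) < real (k * s) + real s \<longrightarrow> k \<in> K n) sequentially" if a: "A1 < a" "a < A2" for a
    proof -
      have "0 < a - A1" using a by simp
      from eventually_width[OF this, of "real s"] eventually_strip_end[of 0 A1] eventually_L[of 0] show ?thesis
      proof (eventually_elim, intro allI impI)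
        fix n k assume h: "real s \<le> (a - A1) * sqrt (L n)" "0 < L n / F + A1 * sqrt (L n)" "0 < L n"
          "real (k * s) \<le> L n / F + a * sqrt (L n)" "L n / F + a * sqrt (L n) < real (k * s) + real s"
        have "a * sqrt (L n) \<le> A2 * sqrt (L n)"
          using a h(3) by (intro mult_right_mono) auto
        moreover have "L n / F + A1 * sqrt (L n) < real (k * s)"
          using h(1,5) unfolding left_diff_distrib by linarith
        moreover from this have "0 < k * s"
          using h(2) by (metis gr0I less_trans of_nat_0 less_irrefl)
        ultimately have "k * s \<in> strip A1 A2 n"
          using h(4) unfolding strip_def mem_Collect_eq by (intro conjI) linarith+
        then show "k \<in> K n"
          unfolding K_def mem_Collect_eq by (intro bexI[of _ "k * s"]) auto
      qed
    qed
    show "eventually (\<lambda>n. \<forall>k. real (k * s) \<le> L n / F + a * sqrt (L n) \<longrightarrow>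
      L n / F + a * sqrt (L n) < real (k * s) + real s \<longrightarrow> k \<notin> K n) sequentially" if a: "a < A1 \<or> A2 < a" for a
      using a
    proof
      assume "a < A1"
      then have "0 < A1 - a" by simp
      from eventually_width[OF this, of "real B + 1"] show ?thesis
      proof (eventually_elim, intro allI impI notI)
        fix n k assume h: "real B + 1 \<le> (A1 - a) * sqrt (L n)" "real (k * s) \<le> L n / F + a * sqrt (L n)" "k \<in> K n"
        obtain l where "L n / F + A1 * sqrt (L n) \<le> real l" "real l \<le> real (k * s) + real B"
          using K_D[OF h(3)] by blast
        then show False
          using h unfolding left_diff_distrib by linarith
      qed
    next
      assume "A2 < a"
      then have "0 < a - A2" by simp
      from eventually_width[OF this, of "real B + real s"] show ?thesis
      proof (eventually_elim, intro allI impI notI)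
        fix n k assume h: "real B + real s \<le> (a - A2) * sqrt (L n)" "L n / F + a * sqrt (L n) < real (k * s) + real s" "k \<in> K n"
        obtain l where "real l \<le> L n / F + A2 * sqrt (L n)" "real (k * s) \<le> real l + real B"
          using K_D[OF h(3)] by blast
        then show False
          using h unfolding left_diff_distrib by linarith
      qed
    qed
  qed
  define \<Sigma> where "\<Sigma> n = real n * (\<Sum>k\<in>K n. prob (cell (u n) (k * s - B) B))" for n
  have "(\<lambda>n. (1 / real s + 1 / real (N n)) * \<Sigma> n) \<longlonglongrightarrow> (1 / real s + 0) * ((hmax B)\<^sup>2 * J / real s)"
    unfolding \<Sigma>_def by (intro tendsto_mult tendsto_add tendsto_const inverse_N riem)
  also have "(1 / real s + 0) * ((hmax B)\<^sup>2 * J / real s) = J * (hmax B / real (B + 1))\<^sup>2"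
    by (simp add: s_def power2_eq_square)
  finally have "eventually (\<lambda>n. (1 / real s + 1 / real (N n)) * \<Sigma> n < J * (hmax B / real (B + 1))\<^sup>2 + \<epsilon>) sequentially"
    using \<epsilon> by (intro order_tendstoD(2)) auto
  then show ?thesis
    using eventually_N_pos eventually_strip_end[of "2 * real B" A1]
  proof eventually_elim
    case (elim n)
    define S where "S = (\<Sum>k\<in>K n. prob (cell (u n) (k * s - B) B))"
    have S0: "0 \<le> S"
      by (auto simp: S_def intro: sum_nonneg)
    have "pN n \<le> real (N n div s + 1) * S"
      unfolding pN_def S_def
    proof (rule exc_le_cells[OF s_def finK])
      fix l assume "l \<in> strip A1 A2 n"
      then have "2 * real B < real l"
        using elim(3) by (simp add: strip_def)
      then show "2 * B < l"
        by linarith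
    qed (auto simp: K_def)
    then have "real n / real (N n) * pN n \<le> real n / real (N n) * (real (N n div s + 1) * S)"
      by (intro mult_left_mono) auto
    also have "\<dots> \<le> real n / real (N n) * ((real (N n) / real s + 1) * S)"
      using S0 by (intro mult_left_mono mult_right_mono) (auto simp: of_nat_div_le_of_nat)
    also have "\<dots> = (1 / real s + 1 / real (N n)) * \<Sigma> n"
    proof -
      have "\<Sigma> n = real n * S" "0 < real s"
        by (simp_all add: \<Sigma>_def S_def s_def)
      then show ?thesis
        using elim(2) by (simp add: field_simps)
    qed
    also have "\<dots> \<le> J * (hmax B / real (B + 1))\<^sup>2 + \<epsilon>"
      using elim(1) by simp
    finally show ?case .
  qed
qed

text \<open>\<open>K n\<close> collects the cells that lie inside the strip. It matters that
  \<open>C\<close> is chosen before \<open>B\<close>, \<open>g\<close> and \<epsilon>: the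
  Bonferroni error is governed by \<open>q\<close> times the number of pairs in the strip, not by
  the cells.\<close>

lemma pN_lower:
  "\<exists>C\<ge>0. \<forall>B g \<epsilon>. 0 < \<epsilon> \<longrightarrow>
    eventually (\<lambda>n. J * (hmax B / real (B + 1 + g))\<^sup>2 - C * exp (- (gap / 2 / 2) * real g) - \<epsilon> \<le> real n / real (N n) * pN n) sequentially"
proof -
  obtain Q where Q: "Q > 0" "eventually (\<lambda>n. Q_ok (Q / (real n * sqrt (L n))) n) sequentially"
    using eventually_Q_ok by blast
  \<comment> \<open>An eventual bound for \<open>n * q * card (strip A1 A2 n)\<close>; the 1 covers
    the rounding in \<open>card_strip\<close> once \<open>1 < sqrt (L n)\<close>.\<close>
  define Cq where "Cq = Q * (A2 - A1 + 1)"
  have Cq: "0 \<le> Cq"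
    using Q A12 by (simp add: Cq_def)
  define S2 where "S2 = (2 / (1 - exp (- (gap / 2) / 2)))\<^sup>2"
  have "eventually (\<lambda>n. J * (hmax B / real (B + 1 + g))\<^sup>2 - Cq * S2 * exp (- (gap / 2 / 2) * real g) - \<epsilon> \<le> real n / real (N n) * pN n) sequentially"
    if \<epsilon>: "0 < \<epsilon>" for B g \<epsilon>
  proof -
    define s where "s = B + 1 + g"
    have s0: "0 < s" by (simp add: s_def)
    define K where "K n = {k. B < k * s \<and> (\<forall>l. k * s \<le> l + B \<longrightarrow> l \<le> k * s + B \<longrightarrow> l \<in> strip A1 A2 n)}" for n
    have K_D: "L n / F + A1 * sqrt (L n) + real B \<le> real (k * s)" "real (k * s) + real B \<le> L n / F + A2 * sqrt (L n)" "B < k * s"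
      if "k \<in> K n" for n k
    proof -
      have k: "B < k * s" "k * s - B \<in> strip A1 A2 n" "k * s + B \<in> strip A1 A2 n"
        using that by (auto simp: K_def)
      then show "L n / F + A1 * sqrt (L n) + real B \<le> real (k * s)" "real (k * s) + real B \<le> L n / F + A2 * sqrt (L n)" "B < k * s"
        by (auto simp: strip_def of_nat_diff)
    qed
    have finK: "finite (K n)" for n
    proof (rule finite_subset)
      show "K n \<subseteq> {..nat \<lfloor>L n / F + A2 * sqrt (L n)\<rfloor>}"
      proof
        fix k assume "k \<in> K n"
        then have "real (k * s) \<le> L n / F + A2 * sqrt (L n)"
          using K_D(2)[of k n] by linarith
        moreover have "real k \<le> real (k * s)"
          unfolding of_nat_le_iff using s0 by simp
        ultimately show "k \<in> {..nat \<lfloor>L n / F + A2 * sqrt (L n)\<rfloor>}"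
          by (simp add: le_nat_floor)
      qed
    qed simp
    have riem: "(\<lambda>n. real n * (\<Sum>k\<in>K n. prob (cell (u n) (k * s - B) B))) \<longlonglongrightarrow> (hmax B)\<^sup>2 * J / real s"
      unfolding J_def
    proof (rule riemann[OF s0])
      show "eventually (\<lambda>n. finite (K n) \<and> (\<forall>k\<in>K n. B < k * s \<and>
        L n / F + (A1 - 1) * sqrt (L n) + real B \<le> real (k * s) \<and> real (k * s) + real B + real s \<le> L n / F + (A2 + 1) * sqrt (L n))) sequentially"
        using eventually_sqrt_L[of "2 * real B + real s"]
      proof (eventually_elim, intro conjI ballI)
        fix n k assume h: "2 * real B + real s < sqrt (L n)" "k \<in> K n"
        show "B < k * s"
          by (rule K_D(3)[OF h(2)])
        show "L n / F + (A1 - 1) * sqrt (L n) + real B \<le> real (k * s)"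
          unfolding left_diff_distrib using h K_D(1)[OF h(2)] by linarith
        show "real (k * s) + real B + real s \<le> L n / F + (A2 + 1) * sqrt (L n)"
          unfolding distrib_right using h K_D(2)[OF h(2)] by linarith
      qed (rule finK)
      show "eventually (\<lambda>n. \<forall>k. real (k * s) \<le> L n / F + a * sqrt (L n) \<longrightarrow>
        L n / F + a * sqrt (L n) < real (k * s) + real s \<longrightarrow> k \<in> K n) sequentially" if a: "A1 < a" "a < A2" for a
      proof -
        have "0 < a - A1" "0 < A2 - a" using a by simp_all
        from eventually_width[OF this(1), of "real s + real B"] eventually_width[OF this(2), of "real B"]
          eventually_strip_end[of "real B" A1] show ?thesis
        proof (eventually_elim, intro allI impI)
          fix n k assume h: "real s + real B \<le> (a - A1) * sqrt (L n)" "real B \<le> (A2 - a) * sqrt (L n)" "real B < L n / F + A1 * sqrt (L n)"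
            "real (k * s) \<le> L n / F + a * sqrt (L n)" "L n / F + a * sqrt (L n) < real (k * s) + real s"
          have low: "L n / F + A1 * sqrt (L n) + real B < real (k * s)"
            using h(1,5) unfolding left_diff_distrib by linarith
          have up: "real (k * s) + real B \<le> L n / F + A2 * sqrt (L n)"
            using h(2,4) unfolding left_diff_distrib by linarith
          have "real B < real (k * s)"
            using low h(3) by linarith
          then have Bk: "B < k * s"
            by (simp only: of_nat_less_iff)
          have "l \<in> strip A1 A2 n" if "k * s \<le> l + B" "l \<le> k * s + B" for l
          proof -
            have "real (k * s) \<le> real (l + B)" "real l \<le> real (k * s + B)"
              using that by (simp_all only: of_nat_le_iff)
            moreover have "0 < l"
              using that Bk by linarith
            ultimately show ?thesis
              unfolding strip_def mem_Collect_eq of_nat_add using low up by (intro conjI) linarith+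
          qed
          then show "k \<in> K n"
            using Bk unfolding K_def by blast
        qed
      qed
      show "eventually (\<lambda>n. \<forall>k. real (k * s) \<le> L n / F + a * sqrt (L n) \<longrightarrow>
        L n / F + a * sqrt (L n) < real (k * s) + real s \<longrightarrow> k \<notin> K n) sequentially" if a: "a < A1 \<or> A2 < a" for a
        using a
      proof
        assume "a < A1"
        then have "0 < A1 - a" by simp
        from eventually_width[OF this, of 1] show ?thesis
        proof (eventually_elim, intro allI impI notI)
          fix n k assume h: "1 \<le> (A1 - a) * sqrt (L n)" "real (k * s) \<le> L n / F + a * sqrt (L n)" "k \<in> K n"
          show False
            using h K_D(1)[OF h(3)] unfolding left_diff_distrib by linarith
        qed
      next
        assume "A2 < a"
        then have "0 < a - A2" by simp
        from eventually_width[OF this, of "real s"] show ?thesis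
        proof (eventually_elim, intro allI impI notI)
          fix n k assume h: "real s \<le> (a - A2) * sqrt (L n)" "L n / F + a * sqrt (L n) < real (k * s) + real s" "k \<in> K n"
          show False
            using h K_D(2)[OF h(3)] unfolding left_diff_distrib by linarith
        qed
      qed
    qed
    define \<Sigma> where "\<Sigma> n = real n * (\<Sum>k\<in>K n. prob (cell (u n) (k * s - B) B))" for n
    define y where "y n = L n / F + A2 * sqrt (L n)" for n
    have "(\<lambda>n. \<Sigma> n * (1 / real s - y n / real (N n) / real s - 1 / real (N n)) - Cq\<^sup>2 * (real (N n) / real n))
      \<longlonglongrightarrow> ((hmax B)\<^sup>2 * J / real s) * (1 / real s - 0 / real s - 0) - Cq\<^sup>2 * 0"
      unfolding \<Sigma>_def y_def using s0
      by (intro tendsto_mult tendsto_diff tendsto_divide tendsto_const inverse_N strip_div_N N_div_n riem) auto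
    also have "((hmax B)\<^sup>2 * J / real s) * (1 / real s - 0 / real s - 0) - Cq\<^sup>2 * 0 = J * (hmax B / real (B + 1 + g))\<^sup>2"
      by (simp add: s_def power2_eq_square)
    finally have "eventually (\<lambda>n. J * (hmax B / real (B + 1 + g))\<^sup>2 - \<epsilon> <
        \<Sigma> n * (1 / real s - y n / real (N n) / real s - 1 / real (N n)) - Cq\<^sup>2 * (real (N n) / real n)) sequentially"
      using \<epsilon> by (intro order_tendstoD(1)) auto
    then show ?thesis
      using Q(2) card_strip eventually_N_pos eventually_sqrt_L[of 1] eventually_gt_at_top[of 0]
    proof eventually_elim
      case (elim n)
      define q where "q = Q / (real n * sqrt (L n))"
      define c where "c = card (strip A1 A2 n)"
      define S where "S = (\<Sum>k\<in>K n. prob (cell (u n) (k * s - B) B))"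
      \<comment> \<open>Positions are kept only as long as the longest intervals starting there
        still end within the block.\<close>
      define P where "P = nat \<lfloor>(real (N n) - y n) / real s\<rfloor>"
      have S0: "0 \<le> S"
        by (auto simp: S_def intro: sum_nonneg)
      have q0: "0 \<le> q"
        using Q(1) elim(5) by (simp add: q_def)
      define E where "E = S2 * exp (- (gap / 2) / 2 * real g)"
      have E0: "0 \<le> E"
        by (simp add: E_def S2_def)
      have cq: "real n * q * real c \<le> Cq"
      proof -
        have "real n * q * real c = Q / sqrt (L n) * real c"
          using elim(6) by (simp add: q_def)
        also have "\<dots> \<le> Q / sqrt (L n) * ((A2 - A1) * sqrt (L n) + 1)"
          using elim(3,5) Q(1) by (intro mult_left_mono) (auto simp: c_def)
        also have "\<dots> = Q * (A2 - A1) + Q / sqrt (L n)"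
          using elim(5) by (simp add: distrib_left)
        also have "Q / sqrt (L n) \<le> Q / 1"
          using elim(5) Q(1) by (intro divide_left_mono) auto
        finally show ?thesis
          by (simp add: Cq_def distrib_left)
      qed
      have main: "real P * S - real (N n * c) * (q * E + q\<^sup>2 * real (N n * c)) \<le> pN n"
        unfolding S_def c_def E_def S2_def pN_def
      proof (rule exc_ge_cells[OF s_def finK finite_strip])
        show "p * s + k * s + B \<le> N n" if p: "p < P" and k: "k \<in> K n" for p k
        proof -
          have "real P \<le> (real (N n) - y n) / real s"
            using p by (simp add: P_def) linarith
          then have "real P * real s \<le> real (N n) - y n"
            using s0 by (simp add: pos_le_divide_eq)
          moreover have "real (p * s) \<le> real P * real s"
            using p by (simp add: mult_right_mono)
          ultimately have "real (p * s) + real (k * s) + real B \<le> real (N n)"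
            using K_D(2)[OF k] by (simp add: y_def)
          then have "real (p * s + k * s + B) \<le> real (N n)"
            by (simp only: of_nat_add)
          then show ?thesis
            by (simp only: of_nat_le_iff)
        qed
        show "prob (exceed (u n) i j \<inter> exceed (u n) i' j') \<le> q * exp (- (gap / 2) * (\<bar>real i - real i'\<bar> + \<bar>real j - real j'\<bar>)) + q\<^sup>2"
          if "i < j" "i' < j'" "j - i \<in> strip A1 A2 n" "j' - i' \<in> strip A1 A2 n" for i j i' j'
          using elim(2) that unfolding Q_ok_def q_def by blast
        show "l \<in> strip A1 A2 n" if "k \<in> K n" "k * s \<le> l + B" "l \<le> k * s + B" for k l
          using that unfolding K_def by blast
        show "B < k * s" if "k \<in> K n" for k
          by (rule K_D(3)[OF that])
        show "0 \<le> q" "0 < gap / 2"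
          using q0 gap_pos by simp_all
      qed
      have Nn: "0 < real n" "0 < real (N n)"
        using elim(4,6) by auto
      \<comment> \<open>Scaled by \<open>n / N n\<close>, the Bonferroni error splits into a part
        bounded by \<open>Cq * E\<close>, which decays in \<open>g\<close>, and a part with the
        factor \<open>N n / n\<close>, which vanishes as \<open>n\<close> grows.\<close>
      have "\<Sigma> n * (1 / real s - y n / real (N n) / real s - 1 / real (N n)) - (Cq * E + Cq\<^sup>2 * (real (N n) / real n))
        \<le> real n / real (N n) * (real P * S) - ((real n * q * real c) * E + (real n * q * real c)\<^sup>2 * (real (N n) / real n))"
      proof (rule diff_mono)
        have "(real (N n) - y n) / real s - 1 \<le> real P"
          unfolding P_def by linarith
        then have "real n / real (N n) * (((real (N n) - y n) / real s - 1) * S) \<le> real n / real (N n) * (real P * S)"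
          using S0 by (intro mult_left_mono mult_right_mono) auto
        also have "real n / real (N n) * (((real (N n) - y n) / real s - 1) * S) = \<Sigma> n * (1 / real s - y n / real (N n) / real s - 1 / real (N n))"
          using Nn s0 by (simp add: \<Sigma>_def S_def[symmetric] field_simps)
        finally show "\<Sigma> n * (1 / real s - y n / real (N n) / real s - 1 / real (N n)) \<le> real n / real (N n) * (real P * S)" .
        have "0 \<le> real n * q * real c"
          using q0 by simp
        then show "(real n * q * real c) * E + (real n * q * real c)\<^sup>2 * (real (N n) / real n) \<le> Cq * E + Cq\<^sup>2 * (real (N n) / real n)"
          using cq E0 by (intro add_mono mult_right_mono power_mono) auto
      qed
      also have "\<dots> = real n / real (N n) * (real P * S - real (N n * c) * (q * E + q\<^sup>2 * real (N n * c)))"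
        using Nn by (simp add: field_simps power2_eq_square)
      also have "\<dots> \<le> real n / real (N n) * pN n"
        by (intro mult_left_mono main) simp
      finally have "\<Sigma> n * (1 / real s - y n / real (N n) / real s - 1 / real (N n)) - Cq\<^sup>2 * (real (N n) / real n) - Cq * E \<le> real n / real (N n) * pN n"
        by simp
      moreover have "Cq * E = Cq * S2 * exp (- (gap / 2 / 2) * real g)"
        by (simp add: E_def)
      ultimately show ?case
        using elim(1) by linarith
    qed
  qed
  moreover have "0 \<le> Cq * S2"
    using Cq by (simp add: S2_def)
  ultimately show ?thesis
    by blast
qed

end

section \<open>The limit over all blocks and the lower tail\<close>

lemma (in iid_walk) isum_second_moment:
  assumes sq: "integrable M (\<lambda>\<omega>. (X 0 \<omega>)\<^sup>2)" and mean: "expectation (X 0) = 0" and var: "expectation (\<lambda>\<omega>. (X 0 \<omega>)\<^sup>2) = 1"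
  shows "integrable M (\<lambda>\<omega>. (isum {..<l} \<omega>)\<^sup>2) \<and> expectation (isum {..<l}) = 0 \<and> expectation (\<lambda>\<omega>. (isum {..<l} \<omega>)\<^sup>2) = real l"
proof (induction l)
  case (Suc l)
  have sqX: "integrable M (\<lambda>\<omega>. (X l \<omega>)\<^sup>2)"
    using integrable_ident[of "\<lambda>x. x\<^sup>2" l] sq by simp
  have iX: "integrable M (X l)"
    by (rule square_integrable_imp_integrable[OF rv sqX])
  have iS: "integrable M (isum {..<l})"
    by (rule square_integrable_imp_integrable[OF isum_measurable]) (use Suc in blast)
  have ind: "indep_var borel (isum {..<l}) borel (X l)"
    using indep_isum[of "{..<l}" "{l}"] by (simp add: isum_def[of "{l}", abs_def])
  have mX: "expectation (X l) = 0"
    using expectation_ident[of "\<lambda>x. x" l] mean by simp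
  have cross: "integrable M (\<lambda>\<omega>. isum {..<l} \<omega> * X l \<omega>)" "expectation (\<lambda>\<omega>. isum {..<l} \<omega> * X l \<omega>) = 0"
    using indep_var_integrable[OF ind iS iX] indep_var_lebesgue_integral[OF ind iS iX] mX by auto
  have eq: "isum {..<Suc l} \<omega> = isum {..<l} \<omega> + X l \<omega>" for \<omega>
    by (simp add: isum_def)
  have hb: "has_bochner_integral M (\<lambda>\<omega>. (isum {..<l} \<omega>)\<^sup>2 + 2 * (isum {..<l} \<omega> * X l \<omega>) + (X l \<omega>)\<^sup>2) (real l + 2 * 0 + 1)"
  proof (intro has_bochner_integral_add has_bochner_integral_mult_right)
    show "has_bochner_integral M (\<lambda>\<omega>. (isum {..<l} \<omega>)\<^sup>2) (real l)"
      using Suc by (auto simp: has_bochner_integral_iff)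
    show "has_bochner_integral M (\<lambda>\<omega>. isum {..<l} \<omega> * X l \<omega>) 0"
      using cross by (auto simp: has_bochner_integral_iff)
    show "has_bochner_integral M (\<lambda>\<omega>. (X l \<omega>)\<^sup>2) 1"
      using sqX expectation_ident[of "\<lambda>x. x\<^sup>2" l] var by (auto simp: has_bochner_integral_iff)
  qed
  have "(\<lambda>\<omega>. (isum {..<Suc l} \<omega>)\<^sup>2) = (\<lambda>\<omega>. (isum {..<l} \<omega>)\<^sup>2 + 2 * (isum {..<l} \<omega> * X l \<omega>) + (X l \<omega>)\<^sup>2)"
    by (simp add: eq power2_sum algebra_simps fun_eq_iff)
  moreover have "expectation (isum {..<Suc l}) = 0"
  proof -
    have "isum {..<Suc l} = (\<lambda>\<omega>. isum {..<l} \<omega> + X l \<omega>)"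
      by (rule ext) (rule eq)
    then show ?thesis
      using iS iX Suc mX by simp
  qed
  ultimately show ?case
    using hb by (auto simp: has_bochner_integral_iff)
qed (simp add: isum_def)

lemma (in iid_walk) hmax_nonneg: "0 \<le> hmax B"
  unfolding hmax_def by (intro Bochner_Integration.integral_nonneg) (auto simp: Max_ge_iff)

context exceedances
begin

text \<open>The sign of \<open>m / \<sigma>2 - 1\<close> is not known here, hence the absolute value
  in the lower bound for \<open>\<kappa>\<close>. Positivity lets \<open>squeeze_cells\<close>
  divide by \<open>J\<close>.\<close>

lemma J_pos: "0 < J"
proof -
  define A where "A = max \<bar>A1\<bar> \<bar>A2\<bar>"
  define b where "b = F\<^sup>2 / 4 * (m / \<sigma>2 - 1)"
  define C where "C = exp (- \<tau>) * (sqrt F / (\<sigma> * sqrt (2 * pi) * t))"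
  have C: "0 < C"
    unfolding C_def using F_pos \<sigma>_pos t_pos by (intro mult_pos_pos divide_pos_pos) auto
  define c where "c = C * exp (- (\<bar>b\<bar> * A\<^sup>2))"
  have "c \<le> \<kappa> a" if "a \<in> {A1..A2}" for a
  proof -
    have "\<bar>a\<bar> \<le> A"
      using that by (auto simp: A_def)
    then have "a\<^sup>2 \<le> A\<^sup>2"
      using abs_le_square_iff[of a A] by (auto simp: A_def)
    then have "\<bar>b\<bar> * a\<^sup>2 \<le> \<bar>b\<bar> * A\<^sup>2"
      by (rule mult_left_mono) simp
    moreover have "b * a\<^sup>2 \<le> \<bar>b\<bar> * a\<^sup>2"
      by (intro mult_right_mono) auto
    ultimately have "exp (- (\<bar>b\<bar> * A\<^sup>2)) \<le> exp (- (b * a\<^sup>2))"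
      by simp
    then show ?thesis
      using C unfolding c_def \<kappa>_def C_def[symmetric] b_def[symmetric] by (intro mult_left_mono) auto
  qed
  then have "integral {A1..A2} (\<lambda>_. c) \<le> J"
    unfolding J_def by (intro integral_le integrable_continuous_interval continuous_\<kappa> continuous_intros) auto
  moreover have "integral {A1..A2} (\<lambda>_. c) = c * (A2 - A1)"
    using A12 by simp
  moreover have "0 < c * (A2 - A1)"
    using C A12 by (simp add: c_def)
  ultimately show ?thesis
    by linarith
qed

text \<open>With \<open>R n = n div N n\<close>, the \<open>R n\<close> blocks that fit give the
  upper bound, and \<open>R n + 1\<close> blocks cover and give the lower bound up to intervals
  crossing a boundary. Both block counts times \<open>pN n\<close> tend to the same limit.\<close>

lemma no_exceedance_limit:
  "\<exists>x. (\<lambda>B. hmax B / real B) \<longlonglongrightarrow> x \<and>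
    (\<lambda>n. prob (space M - exc (u n) (strip A1 A2 n) 0 n)) \<longlonglongrightarrow> exp (- (J * x\<^sup>2))"
proof -
  obtain C where C: "0 \<le> C" "\<And>B g \<epsilon>. 0 < \<epsilon> \<Longrightarrow>
    eventually (\<lambda>n. J * (hmax B / real (B + 1 + g))\<^sup>2 - C * exp (- (gap / 2 / 2) * real g) - \<epsilon> \<le> real n / real (N n) * pN n) sequentially"
    using pN_lower by blast
  have "0 < gap / 2 / 2"
    using gap_pos by simp
  from squeeze_cells[OF J_pos hmax_nonneg this C(1) pN_upper C(2)]
  obtain x where x: "(\<lambda>B. hmax B / real B) \<longlonglongrightarrow> x" and a: "(\<lambda>n. real n / real (N n) * pN n) \<longlonglongrightarrow> J * x\<^sup>2"
    by blast
  define z where "z = J * x\<^sup>2"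
  define R where "R n = n div N n" for n
  have pN01: "0 \<le> pN n" "pN n \<le> 1" for n
    by (simp_all add: pN_def)
  have evn: "eventually (\<lambda>n. 0 < n) sequentially"
    by (rule eventually_gt_at_top)
  \<comment> \<open>One block more or less does not matter, because \<open>N n / n\<close> tends to
    0.\<close>
  have p0: "pN \<longlonglongrightarrow> 0"
  proof -
    have "(\<lambda>n. real n / real (N n) * pN n * (real (N n) / real n)) \<longlonglongrightarrow> z * 0"
      unfolding z_def by (intro tendsto_mult a N_div_n)
    moreover have "eventually (\<lambda>n. real n / real (N n) * pN n * (real (N n) / real n) = pN n) sequentially"
      using evn eventually_N_pos by eventually_elim simp
    ultimately show ?thesis
      using Lim_transform_eventually by fastforce
  qed
  have ratio: "(\<lambda>n. real (N n) / real n * real (R n)) \<longlonglongrightarrow> 1"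
  proof (rule tendsto_sandwich)
    show "eventually (\<lambda>n. 1 - real (N n) / real n \<le> real (N n) / real n * real (R n)) sequentially"
      using evn eventually_N_pos
    proof eventually_elim
      case (elim n)
      have "n < R n * N n + N n"
        unfolding R_def using elim(2) by (metis add.commute dividend_less_div_times)
      then have "real n \<le> real (R n * N n + N n)"
        by linarith
      then have "1 \<le> real (R n * N n + N n) / real n"
        using elim(1) by (simp only: of_nat_0_less_iff pos_le_divide_eq mult_1)
      also have "\<dots> = real (N n) / real n * real (R n) + real (N n) / real n"
        by (simp add: add_divide_distrib mult.commute)
      finally show ?case
        by simp
    qed
    show "eventually (\<lambda>n. real (N n) / real n * real (R n) \<le> 1) sequentially"
      using evn
    proof eventually_elim
      case (elim n)
      have "R n * N n \<le> n"
        by (simp add: R_def)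
      then have "real (R n * N n) \<le> real n"
        by (simp only: of_nat_le_iff)
      then have "real (R n * N n) / real n \<le> 1"
        using elim by (simp only: of_nat_0_less_iff pos_divide_le_eq mult_1)
      then show ?case
        by (simp add: mult.commute)
    qed
    show "(\<lambda>n. 1 - real (N n) / real n) \<longlonglongrightarrow> 1"
      using tendsto_diff[OF tendsto_const[of 1] N_div_n] by simp
  qed simp
  have R1: "(\<lambda>n. real (R n) * pN n) \<longlonglongrightarrow> z"
  proof -
    have "(\<lambda>n. real n / real (N n) * pN n * (real (N n) / real n * real (R n))) \<longlonglongrightarrow> z * 1"
      unfolding z_def by (intro tendsto_mult a ratio)
    moreover have "eventually (\<lambda>n. real n / real (N n) * pN n * (real (N n) / real n * real (R n)) = real (R n) * pN n) sequentially"
      using evn eventually_N_pos by eventually_elim simp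
    ultimately show ?thesis
      using Lim_transform_eventually by fastforce
  qed
  have R2: "(\<lambda>n. real (R n + 1) * pN n) \<longlonglongrightarrow> z"
    using tendsto_add[OF R1 p0] by (simp add: distrib_right add.commute)
  obtain Q where Q: "Q > 0" "eventually (\<lambda>n. Q_ok (Q / (real n * sqrt (L n))) n) sequentially"
    using eventually_Q_ok by blast
  define Cq where "Cq = Q * (A2 - A1 + 1)"
  define y where "y n = L n / F + A2 * sqrt (L n)" for n
  \<comment> \<open>Crossing intervals: at most \<open>n / N n + 1\<close> boundaries, at most
    \<open>y n\<close> starting points before each, and a total weight of at most
    \<open>Cq / n\<close> over the lengths.\<close>
  define err where "err n = Cq * (y n / real (N n) + y n / real (N n) * (real (N n) / real n))" for n
  have "(\<lambda>n. prob (space M - exc (u n) (strip A1 A2 n) 0 n)) \<longlonglongrightarrow> exp (- z)"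
  proof (rule tendsto_sandwich[where f = "\<lambda>n. (1 - pN n) ^ (R n + 1) - err n" and h = "\<lambda>n. (1 - pN n) ^ R n"])
    show "eventually (\<lambda>n. prob (space M - exc (u n) (strip A1 A2 n) 0 n) \<le> (1 - pN n) ^ R n) sequentially"
      unfolding pN_def R_def by (intro always_eventually allI block_upper) simp
    show "(\<lambda>n. (1 - pN n) ^ R n) \<longlonglongrightarrow> exp (- z)"
      by (rule power_one_minus_limit[OF pN01(1) p0 R1])
    have "(\<lambda>n. err n) \<longlonglongrightarrow> Cq * (0 + 0 * 0)"
      unfolding err_def y_def by (intro tendsto_mult tendsto_add tendsto_const strip_div_N N_div_n)
    from tendsto_diff[OF power_one_minus_limit[OF pN01(1) p0 R2] this]
    show "(\<lambda>n. (1 - pN n) ^ (R n + 1) - err n) \<longlonglongrightarrow> exp (- z)"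
      by simp
    show "eventually (\<lambda>n. (1 - pN n) ^ (R n + 1) - err n \<le> prob (space M - exc (u n) (strip A1 A2 n) 0 n)) sequentially"
      using Q(2) card_strip evn eventually_N_pos eventually_sqrt_L[of 1] eventually_strip_end[of 0 A2]
    proof eventually_elim
      case (elim n)
      define q where "q = Q / (real n * sqrt (L n))"
      define c where "c = card (strip A1 A2 n)"
      define lmax where "lmax = nat \<lfloor>y n\<rfloor>"
      have q0: "0 \<le> q"
        using Q(1) elim(5) by (simp add: q_def)
      have cq: "real n * q * real c \<le> Cq"
      proof -
        have "real n * q * real c = Q / sqrt (L n) * real c"
          using elim(3) by (simp add: q_def)
        also have "\<dots> \<le> Q / sqrt (L n) * ((A2 - A1) * sqrt (L n) + 1)"
          using elim(2,5) Q(1) by (intro mult_left_mono) (auto simp: c_def)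
        also have "\<dots> = Q * (A2 - A1) + Q / sqrt (L n)"
          using elim(5) by (simp add: distrib_left)
        also have "Q / sqrt (L n) \<le> Q / 1"
          using elim(5) Q(1) by (intro divide_left_mono) auto
        finally show ?thesis
          by (simp add: Cq_def distrib_left)
      qed
      have "(1 - prob (exc (u n) (strip A1 A2 n) 0 (N n))) ^ (R n + 1) - real (R n + 1) * real lmax * real c * q \<le>
          prob (space M - exc (u n) (strip A1 A2 n) 0 n)"
        unfolding c_def
      proof (rule block_lower)
        show "n \<le> (R n + 1) * N n"
          unfolding R_def using elim(4) dividend_less_div_times[of "N n" n] by (simp add: add.commute less_imp_le)
        show "strip A1 A2 n \<subseteq> {1..lmax}"
          by (auto simp: strip_def lmax_def y_def le_nat_floor)
        show "prob (exceed (u n) i j) \<le> q" if "i < j" "j - i \<in> strip A1 A2 n" for i j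
          using elim(1) that unfolding Q_ok_def q_def by blast
      qed (use elim q0 in auto)
      moreover have "real (R n + 1) * real lmax * real c * q \<le> err n"
      proof -
        have y0: "0 < y n"
          using elim(6) by (simp add: y_def)
        have "real (R n) \<le> real n / real (N n)"
          unfolding R_def by (rule of_nat_div_le_of_nat)
        then have "real (R n + 1) * real lmax \<le> (real n / real (N n) + 1) * y n"
          using y0 by (intro mult_mono) (auto simp: lmax_def)
        then have "real (R n + 1) * real lmax * (real c * q) \<le> (real n / real (N n) + 1) * y n * (real c * q)"
          using q0 by (intro mult_right_mono) auto
        also have "\<dots> = (real n * q * real c) * (y n / real (N n) + y n / real (N n) * (real (N n) / real n))"
          using elim(3,4) by (simp add: field_simps)
        also have "\<dots> \<le> err n"
          unfolding err_def using y0 by (intro mult_right_mono cq) auto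
        finally show ?thesis
          by (simp add: mult.assoc)
      qed
      ultimately show ?case
        by (simp add: pN_def)
    qed
  qed
  with x show ?thesis
    unfolding z_def by blast
qed

text \<open>The square of the maximum is also large when every normalised increment lies below
  \<open>- u n\<close>; this event has to be removed separately.\<close>

definition all_low :: "nat \<Rightarrow> 'a set" where
  "all_low n = {\<omega> \<in> space M. \<forall>i j. i < j \<longrightarrow> j \<le> n \<longrightarrow> j - i \<in> strip A1 A2 n \<longrightarrow> isum {i..<j} \<omega> < - (u n * sqrt (real (j - i)))}"

lemma all_low_events [measurable]: "all_low n \<in> events"
  unfolding all_low_def by measurable

text \<open>The width of the strip tends to infinity and its upper end is eventually below
  \<open>n\<close>. Without an admissible pair, \<open>Max\<close> would be taken over the empty
  set.\<close>

lemma strip_nonempty: "eventually (\<lambda>n. \<exists>l. l \<in> strip A1 A2 n \<and> 0 < l \<and> l \<le> n) sequentially"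
proof -
  have "0 < A2 - A1" using A12 by simp
  have "(\<lambda>n. (L n / F + A2 * sqrt (L n)) / real (N n) * (real (N n) / real n)) \<longlonglongrightarrow> 0 * 0"
    by (intro tendsto_mult strip_div_N N_div_n)
  then have "eventually (\<lambda>n. (L n / F + A2 * sqrt (L n)) / real (N n) * (real (N n) / real n) < 1) sequentially"
    by (intro order_tendstoD(2)) auto
  with eventually_width[OF \<open>0 < A2 - A1\<close>, of 1] eventually_strip_end[of 0 A1] eventually_N_pos eventually_gt_at_top[of 0]
  show ?thesis
  proof eventually_elim
    case (elim n)
    define x where "x = L n / F + A1 * sqrt (L n)"
    define y where "y = L n / F + A2 * sqrt (L n)"
    have xy: "0 < x" "x + 1 \<le> y"
      using elim(1,2) by (auto simp: x_def y_def left_diff_distrib)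
    have yn: "y < real n"
      using elim(3-5) by (simp add: y_def[symmetric] pos_divide_less_eq)
    have "real (nat \<lceil>x\<rceil>) \<le> y" "x \<le> real (nat \<lceil>x\<rceil>)" "0 < nat \<lceil>x\<rceil>"
      using xy by linarith+
    moreover from this have "nat \<lceil>x\<rceil> \<le> n"
      using yn by linarith
    ultimately show ?case
      by (intro exI[of _ "nat \<lceil>x\<rceil>"]) (auto simp: strip_def x_def y_def)
  qed
qed

text \<open>One interval of admissible length suffices: its sum has variance \<open>l\<close>, and
  Chebyshev's inequality at \<open>u n * sqrt l\<close> gives
  \<open>1 / (u n)\<^sup>2\<close>.\<close>

lemma prob_all_low:
  assumes sq: "integrable M (\<lambda>\<omega>. (X 0 \<omega>)\<^sup>2)" and mean: "expectation (X 0) = 0" and var: "expectation (\<lambda>\<omega>. (X 0 \<omega>)\<^sup>2) = 1"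
  shows "(\<lambda>n. prob (all_low n)) \<longlonglongrightarrow> 0"
proof (rule tendsto_sandwich[where f = "\<lambda>_. 0"])
  have ev: "eventually (\<lambda>n. 0 < L n + \<tau>) sequentially"
    using eventually_L[of "- \<tau>"] by eventually_elim simp
  show "eventually (\<lambda>n. prob (all_low n) \<le> 1 / (2 * m * (L n + \<tau>))) sequentially"
    using strip_nonempty ev
  proof eventually_elim
    case (elim n)
    obtain l where l: "l \<in> strip A1 A2 n" "0 < l" "l \<le> n"
      using elim(1) by blast
    have u: "0 < u n" "(u n)\<^sup>2 = 2 * m * (L n + \<tau>)"
      using elim(2) m_pos by (auto simp: u_def)
    note mom = isum_second_moment[OF sq mean var, of l]
    have pos: "0 < u n * sqrt (real l)"
      using u l by simp
    have "prob (all_low n) \<le> prob {\<omega> \<in> space M. u n * sqrt (real l) \<le> \<bar>isum {..<l} \<omega> - expectation (isum {..<l})\<bar>}"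
    proof (rule finite_measure_mono)
      show "all_low n \<subseteq> {\<omega> \<in> space M. u n * sqrt (real l) \<le> \<bar>isum {..<l} \<omega> - expectation (isum {..<l})\<bar>}"
      proof
        fix \<omega> assume \<omega>: "\<omega> \<in> all_low n"
        then have "isum {0..<l} \<omega> < - (u n * sqrt (real (l - 0)))"
          using l unfolding all_low_def by (metis (mono_tags, lifting) diff_zero mem_Collect_eq)
        then have "u n * sqrt (real l) \<le> \<bar>isum {..<l} \<omega>\<bar>"
          by (simp add: lessThan_atLeast0)
        with \<omega> show "\<omega> \<in> {\<omega> \<in> space M. u n * sqrt (real l) \<le> \<bar>isum {..<l} \<omega> - expectation (isum {..<l})\<bar>}"
          using mom by (simp add: all_low_def)
      qed
    qed measurable
    also have "\<dots> \<le> variance (isum {..<l}) / (u n * sqrt (real l))\<^sup>2"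
      using mom pos by (intro Chebyshev_inequality) auto
    also have "\<dots> = real l / ((u n)\<^sup>2 * real l)"
      using mom by (simp add: power_mult_distrib)
    also have "\<dots> = 1 / (2 * m * (L n + \<tau>))"
      using l(2) by (simp add: u(2))
    finally show ?case .
  qed
  have "filterlim (\<lambda>n. 2 * m * (\<tau> + L n)) at_top sequentially"
    using m_pos by (intro filterlim_tendsto_pos_mult_at_top[OF tendsto_const] filterlim_tendsto_add_at_top[OF tendsto_const L_at_top]) auto
  then have "filterlim (\<lambda>n. 2 * m * (L n + \<tau>)) at_top sequentially"
    by (simp only: add.commute)
  then show "(\<lambda>n. 1 / (2 * m * (L n + \<tau>))) \<longlonglongrightarrow> 0"
    by (rule real_tendsto_divide_at_top[OF tendsto_const])
qed auto

text \<open>\<open>y\<^sup>2 \<le> (u n)\<^sup>2\<close> means \<open>y \<le> u n\<close> and not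
  \<open>y < - u n\<close>; for the maximum these are the absence of an exceedance and the
  complement of \<open>all_low\<close>.\<close>

lemma Mmax_event:
  "eventually (\<lambda>n. {\<omega> \<in> space M. (1/2) * (Mmax X n (L n / F + A1 * sqrt (L n)) (L n / F + A2 * sqrt (L n)) \<omega>)\<^sup>2 \<le> m * (L n + \<tau>)} =
    (space M - exc (u n) (strip A1 A2 n) 0 n) - all_low n) sequentially"
proof -
  have ev: "eventually (\<lambda>n. 0 < L n + \<tau>) sequentially"
    using eventually_L[of "- \<tau>"] by eventually_elim simp
  show ?thesis
    using strip_nonempty ev
  proof eventually_elim
    case (elim n)
    define Z where "Z = {(i, j). i < j \<and> j \<le> n \<and> j - i \<in> strip A1 A2 n}"
    have finZ: "finite Z"
      by (rule finite_subset[of _ "{..n} \<times> {..n}"]) (auto simp: Z_def)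
    have Z0: "Z \<noteq> {}"
    proof -
      obtain l where "l \<in> strip A1 A2 n" "0 < l" "l \<le> n"
        using elim(1) by blast
      then have "(0, l) \<in> Z"
        by (simp add: Z_def)
      then show ?thesis
        by blast
    qed
    define f where "f \<omega> = (\<lambda>(i, j). isum {i..<j} \<omega> / sqrt (real (j - i)))" for \<omega>
    have diff: "psum X j \<omega> - psum X i \<omega> = isum {i..<j} \<omega>" if "i < j" for i j \<omega>
      using that sum.atLeastLessThan_concat[of 0 i j "\<lambda>k. X k \<omega>"] by (simp add: psum_def isum_def lessThan_atLeast0)
    have Mx: "Mmax X n (L n / F + A1 * sqrt (L n)) (L n / F + A2 * sqrt (L n)) \<omega> = Max (f \<omega> ` Z)" for \<omega>
      unfolding Mmax_def
    proof (rule arg_cong[where f = Max])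
      show "{(psum X j \<omega> - psum X i \<omega>) / sqrt (real (j - i)) | i j. i < j \<and> j \<le> n \<and>
        L n / F + A1 * sqrt (L n) \<le> real (j - i) \<and> real (j - i) \<le> L n / F + A2 * sqrt (L n)} = f \<omega> ` Z"
      proof (intro set_eqI iffI)
        fix r assume "r \<in> {(psum X j \<omega> - psum X i \<omega>) / sqrt (real (j - i)) | i j. i < j \<and> j \<le> n \<and>
          L n / F + A1 * sqrt (L n) \<le> real (j - i) \<and> real (j - i) \<le> L n / F + A2 * sqrt (L n)}"
        then obtain i j where ij: "r = (psum X j \<omega> - psum X i \<omega>) / sqrt (real (j - i))" "i < j" "j \<le> n"
          "L n / F + A1 * sqrt (L n) \<le> real (j - i)" "real (j - i) \<le> L n / F + A2 * sqrt (L n)"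
          by blast
        then have "(i, j) \<in> Z"
          unfolding Z_def strip_def by simp
        moreover have "r = f \<omega> (i, j)"
          using ij by (simp add: f_def diff)
        ultimately show "r \<in> f \<omega> ` Z"
          by blast
      next
        fix r assume "r \<in> f \<omega> ` Z"
        then obtain i j where ij: "(i, j) \<in> Z" "r = f \<omega> (i, j)"
          by auto
        then have "i < j"
          by (simp add: Z_def)
        with ij(2) have "r = (psum X j \<omega> - psum X i \<omega>) / sqrt (real (j - i))"
          by (simp only: diff f_def prod.case)
        with ij(1) show "r \<in> {(psum X j \<omega> - psum X i \<omega>) / sqrt (real (j - i)) | i j. i < j \<and> j \<le> n \<and>
          L n / F + A1 * sqrt (L n) \<le> real (j - i) \<and> real (j - i) \<le> L n / F + A2 * sqrt (L n)}"
          unfolding Z_def strip_def by blast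
      qed
    qed
    have u: "0 < u n" "(u n)\<^sup>2 = 2 * m * (L n + \<tau>)"
      using elim(2) m_pos by (auto simp: u_def)
    have sq: "(1/2) * y\<^sup>2 \<le> m * (L n + \<tau>) \<longleftrightarrow> y \<le> u n \<and> \<not> y < - u n" for y
    proof -
      have "(1/2) * y\<^sup>2 \<le> m * (L n + \<tau>) \<longleftrightarrow> y\<^sup>2 \<le> (u n)\<^sup>2"
        by (simp add: u(2) mult_ac)
      also have "\<dots> \<longleftrightarrow> \<bar>y\<bar> \<le> u n"
        using abs_le_square_iff[of y "u n"] u(1) by simp
      finally show ?thesis
        by (auto simp: abs_le_iff)
    qed
    have exc_iff: "\<omega> \<in> exc (u n) (strip A1 A2 n) 0 n \<longleftrightarrow> \<not> Max (f \<omega> ` Z) \<le> u n" if "\<omega> \<in> space M" for \<omega>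
    proof -
      have "Max (f \<omega> ` Z) \<le> u n \<longleftrightarrow> (\<forall>(i, j)\<in>Z. isum {i..<j} \<omega> \<le> u n * sqrt (real (j - i)))"
        using finZ Z0 by (subst Max_le_iff) (auto simp: f_def Z_def pos_divide_le_eq)
      then show ?thesis
        using that by (auto simp: exc_def exceed_def Z_def not_le simp del: of_nat_diff)
    qed
    have low_iff: "\<omega> \<in> all_low n \<longleftrightarrow> Max (f \<omega> ` Z) < - u n" if "\<omega> \<in> space M" for \<omega>
    proof -
      have "Max (f \<omega> ` Z) < - u n \<longleftrightarrow> (\<forall>(i, j)\<in>Z. isum {i..<j} \<omega> < - (u n * sqrt (real (j - i))))"
        using finZ Z0 by (subst Max_less_iff) (auto simp: f_def Z_def pos_divide_less_eq)
      then show ?thesis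
        using that by (auto simp: all_low_def Z_def simp del: of_nat_diff)
    qed
    show ?case
      unfolding Mx sq using exc_iff low_iff by auto
  qed
qed

theorem Mmax_limit:
  assumes sq: "integrable M (\<lambda>\<omega>. (X 0 \<omega>)\<^sup>2)" and mean: "expectation (X 0) = 0" and var: "expectation (\<lambda>\<omega>. (X 0 \<omega>)\<^sup>2) = 1"
  shows "(\<lambda>n. prob {\<omega> \<in> space M. (1/2) * (Mmax X n (L n / F + A1 * sqrt (L n)) (L n / F + A2 * sqrt (L n)) \<omega>)\<^sup>2 \<le> m * (L n + \<tau>)})
    \<longlonglongrightarrow> exp (- (J * (lim (\<lambda>B. hmax B / real B))\<^sup>2))"
proof -
  obtain x where x: "(\<lambda>B. hmax B / real B) \<longlonglongrightarrow> x" and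
    U: "(\<lambda>n. prob (space M - exc (u n) (strip A1 A2 n) 0 n)) \<longlonglongrightarrow> exp (- (J * x\<^sup>2))"
    using no_exceedance_limit by blast
  define U' where "U' n = space M - exc (u n) (strip A1 A2 n) 0 n" for n
  have [measurable]: "U' n \<in> events" for n
    unfolding U'_def by measurable
  have "(\<lambda>n. prob (U' n - all_low n)) \<longlonglongrightarrow> exp (- (J * x\<^sup>2))"
  proof (rule tendsto_sandwich)
    show "eventually (\<lambda>n. prob (U' n - all_low n) \<le> prob (U' n)) sequentially"
      by (intro always_eventually allI finite_measure_mono) auto
    show "eventually (\<lambda>n. prob (U' n) - prob (all_low n) \<le> prob (U' n - all_low n)) sequentially"
    proof (intro always_eventually allI)
      fix n
      have "prob (U' n) \<le> prob ((U' n - all_low n) \<union> all_low n)"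
        by (intro finite_measure_mono) auto
      also have "\<dots> \<le> prob (U' n - all_low n) + prob (all_low n)"
        by (intro measure_Un_le) auto
      finally show "prob (U' n) - prob (all_low n) \<le> prob (U' n - all_low n)"
        by simp
    qed
    show "(\<lambda>n. prob (U' n)) \<longlonglongrightarrow> exp (- (J * x\<^sup>2))"
      using U by (simp add: U'_def)
    show "(\<lambda>n. prob (U' n) - prob (all_low n)) \<longlonglongrightarrow> exp (- (J * x\<^sup>2))"
      using tendsto_diff[OF U prob_all_low[OF assms]] by (simp add: U'_def)
  qed
  moreover have "lim (\<lambda>B. hmax B / real B) = x"
    by (rule limI[OF x])
  moreover have "eventually (\<lambda>n. prob (U' n - all_low n) =
    prob {\<omega> \<in> space M. (1/2) * (Mmax X n (L n / F + A1 * sqrt (L n)) (L n / F + A2 * sqrt (L n)) \<omega>)\<^sup>2 \<le> m * (L n + \<tau>)}) sequentially"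
    using Mmax_event by eventually_elim (simp add: U'_def)
  ultimately show ?thesis
    using Lim_transform_eventually by fastforce
qed

end

theorem theorem1p5:
  fixes M :: "'a measure" and X :: "nat \<Rightarrow> 'a \<Rightarrow> real"
    and \<sigma>0 tstar A1 A2 \<tau> :: real
  assumes P: "prob_space M"
    and rv: "\<And>k. X k \<in> borel_measurable M"
    and indep: "prob_space.indep_vars M (\<lambda>_. borel) X UNIV"
    and ident: "\<And>k. distr M borel (X k) = distr M borel (X 0)"
    and nonlattice: "\<not> (\<exists>a>0. \<exists>b. AE \<omega> in M. \<exists>z::int. X 0 \<omega> = a * real_of_int z + b)"
    and int1: "integrable M (X 0)" and mean0: "integral\<^sup>L M (X 0) = 0"
    and int2: "integrable M (\<lambda>\<omega>. (X 0 \<omega>)\<^sup>2)" and var1: "prob_space.variance M (X 0) = 1"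
    and \<sigma>0_pos: "\<sigma>0 > 0"
    and mgf: "\<And>t. t \<ge> -\<sigma>0 \<Longrightarrow> integrable M (\<lambda>\<omega>. exp (t * X 0 \<omega>))"
    and tstar_pos: "tstar > 0"
    and mstar_gt1: "cgf M (X 0) tstar / (tstar\<^sup>2 / 2) > 1"
    and sup_left: "\<And>\<epsilon>. \<epsilon> > 0 \<Longrightarrow> \<exists>c < cgf M (X 0) tstar / (tstar\<^sup>2 / 2).
        \<forall>t. 0 < t \<and> t < tstar - \<epsilon> \<longrightarrow> cgf M (X 0) t / (t\<^sup>2 / 2) \<le> c"
    and sup_right: "\<And>\<epsilon>. \<epsilon> > 0 \<Longrightarrow> \<exists>c < cgf M (X 0) tstar / (tstar\<^sup>2 / 2).
        \<forall>t. t > tstar + \<epsilon> \<longrightarrow> cgf M (X 0) t / (t\<^sup>2 / 2) \<le> c"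
    and A12: "A1 < A2"
  shows
    "let \<phi> = cgf M (X 0);
         m = \<phi> tstar / (tstar\<^sup>2 / 2);
         d = 1 / \<phi> tstar;
         \<sigma>2 = deriv (deriv \<phi>) tstar;
         \<beta>2 = (deriv \<phi> tstar) ^ 4 / (8 * m) * (1 / \<sigma>2 - 1 / m);
         H = lim (\<lambda>B::nat. (1 / real B) *
               integral\<^sup>L M (\<lambda>\<omega>. Max ((\<lambda>k. exp (tstar * psum X k \<omega> - real k * \<phi> tstar)) ` {0..B})));
         \<Theta> = (\<lambda>a. sqrt m * H\<^sup>2 / (2 * sqrt pi * sqrt \<sigma>2) * exp (- \<beta>2 * a\<^sup>2 / 2));
         lminus = (\<lambda>n::nat. d * ln (real n) + A1 * sqrt (ln (real n)));
         lplus = (\<lambda>n::nat. d * ln (real n) + A2 * sqrt (ln (real n)))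
     in (\<lambda>n. measure M {\<omega> \<in> space M. (1/2) * (Mmax X n (lminus n) (lplus n) \<omega>)\<^sup>2 \<le> m * (ln (real n) + \<tau>)})
        \<longlonglongrightarrow> exp (- exp (-\<tau>) * integral {A1..A2} \<Theta>)"
proof -
  define m where "m = cgf M (X 0) tstar / (tstar\<^sup>2 / 2)"
  interpret W: iid_walk M X tstar
    using P rv indep ident nonlattice tstar_pos mgf \<sigma>0_pos
    by (auto simp: iid_walk_def iid_walk_axioms_def)
  have m1: "1 < m"
    using mstar_gt1 by (simp add: m_def)
  have phi: "cgf M (X 0) tstar = m * tstar\<^sup>2 / 2"
    using tstar_pos by (simp add: m_def)
  \<comment> \<open>The strict suprema are used with \<epsilon> equal to half the distance of
    \<open>s\<close> from \<open>tstar\<close>, so that \<open>s\<close> lies in the range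
    concerned.\<close>
  have le: "cgf M (X 0) s \<le> m * s\<^sup>2 / 2" if s: "0 < s" for s
  proof (cases "s = tstar")
    case False
    have "\<exists>c<m. cgf M (X 0) s / (s\<^sup>2 / 2) \<le> c"
    proof (cases "s < tstar")
      case True
      then have "0 < (tstar - s) / 2" "s < tstar - (tstar - s) / 2"
        by (simp_all add: field_simps)
      then show ?thesis
        using sup_left[of "(tstar - s) / 2"] s unfolding m_def by blast
    next
      case False
      with \<open>s \<noteq> tstar\<close> have "0 < (s - tstar) / 2" "tstar + (s - tstar) / 2 < s"
        by (simp_all add: field_simps)
      then show ?thesis
        using sup_right[of "(s - tstar) / 2"] unfolding m_def by blast
    qed
    then have "cgf M (X 0) s / (s\<^sup>2 / 2) \<le> m"
      by force
    then show ?thesis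
      using s by (simp add: pos_divide_le_eq)
  qed (simp add: phi)
  \<comment> \<open>The difference of \<phi> and \<open>m * s\<^sup>2 / 2\<close> is at most 0 on
    the positive axis and vanishes at \<open>tstar\<close>, so its derivative is 0 there.\<close>
  have mu: "W.\<mu> = m * tstar"
  proof -
    have "((\<lambda>s. cgf M (X 0) s - m * s\<^sup>2 / 2) has_real_derivative W.\<mu> - m * tstar) (at tstar)"
      using W.DERIV_cgf[OF tstar_pos] by (auto intro!: derivative_eq_intros simp: W.\<mu>_def)
    then have "W.\<mu> - m * tstar = 0"
    proof (rule DERIV_local_max[OF _ tstar_pos], intro allI impI)
      fix y assume "\<bar>tstar - y\<bar> < tstar"
      then have "0 < y"
        by linarith
      then show "cgf M (X 0) y - m * y\<^sup>2 / 2 \<le> cgf M (X 0) tstar - m * tstar\<^sup>2 / 2"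
        using le[of y] phi by simp
    qed
    then show ?thesis
      by simp
  qed
  interpret E: exceedances M X tstar m \<tau> A1 A2
    by unfold_locales (use m1 phi mu A12 in auto)
  have EX2: "(\<integral>\<omega>. (X 0 \<omega>)\<^sup>2 \<partial>M) = 1"
    using var1 mean0 by simp
  define H where "H = lim (\<lambda>B. W.hmax B / real B)"
  define \<Theta> where "\<Theta> a = sqrt m * H\<^sup>2 / (2 * sqrt pi * sqrt W.\<sigma>2) *
    exp (- ((deriv (cgf M (X 0)) tstar) ^ 4 / (8 * m) * (1 / W.\<sigma>2 - 1 / m)) * a\<^sup>2 / 2)" for a
  \<comment> \<open>\<open>sqrt F = sqrt m * tstar / sqrt 2\<close> accounts for the prefactor. As
    the derivative of \<phi> at \<open>tstar\<close> is \<open>m * tstar\<close>, its fourth power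
    over \<open>16 * m\<close> is \<open>m * F\<^sup>2 / 4\<close>, which matches the Gaussian
    exponents.\<close>
  have \<Theta>: "E.\<kappa> a * H\<^sup>2 = exp (- \<tau>) * \<Theta> a" for a
  proof -
    define r :: real where "r = sqrt 2"
    have r: "0 < r" "r * r = 2"
      by (simp_all add: r_def)
    have F: "sqrt E.F = sqrt m * tstar / r" and pi2: "sqrt (2 * pi) = r * sqrt pi"
      unfolding E.F_eq r_def using tstar_pos by (simp_all add: real_sqrt_divide real_sqrt_mult)
    have "sqrt E.F / (W.\<sigma> * sqrt (2 * pi) * tstar) = sqrt m / ((r * r) * sqrt pi * W.\<sigma>)"
      unfolding F pi2 using tstar_pos r(1) by (simp add: mult_ac)
    then have "sqrt E.F / (W.\<sigma> * sqrt (2 * pi) * tstar) = sqrt m / (2 * sqrt pi * sqrt W.\<sigma>2)"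
      unfolding r(2) W.\<sigma>_def .
    moreover have "E.F\<^sup>2 / 4 * (m / W.\<sigma>2 - 1) * a\<^sup>2 = (deriv (cgf M (X 0)) tstar) ^ 4 / (8 * m) * (1 / W.\<sigma>2 - 1 / m) * a\<^sup>2 / 2"
      unfolding E.F_eq W.deriv_cgf mu using m1 W.\<sigma>2_pos
      by (simp add: field_simps power_mult_distrib power2_eq_square power4_eq_xxxx)
    ultimately show ?thesis
      unfolding E.\<kappa>_def \<Theta>_def by (simp add: mult_ac)
  qed
  have "E.J * H\<^sup>2 = integral {A1..A2} (\<lambda>a. E.\<kappa> a * H\<^sup>2)"
    unfolding E.J_def by simp
  also have "\<dots> = exp (- \<tau>) * integral {A1..A2} \<Theta>"
    unfolding \<Theta> by simp
  finally have J: "E.J * H\<^sup>2 = exp (- \<tau>) * integral {A1..A2} \<Theta>" .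
  have "(\<lambda>n. measure M {\<omega> \<in> space M. (1/2) * (Mmax X n (1 / cgf M (X 0) tstar * ln (real n) + A1 * sqrt (ln (real n)))
      (1 / cgf M (X 0) tstar * ln (real n) + A2 * sqrt (ln (real n))) \<omega>)\<^sup>2 \<le> m * (ln (real n) + \<tau>)})
    \<longlonglongrightarrow> exp (- exp (- \<tau>) * integral {A1..A2} \<Theta>)"
    using E.Mmax_limit[OF int2 mean0 EX2] unfolding H_def[symmetric] J by (simp add: E.L_def E.F_def)
  then show ?thesis
    unfolding Let_def m_def[symmetric] W.deriv_deriv_cgf \<Theta>_def[abs_def] H_def W.hmax_def by simp
qed

end
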